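(* For every integer $\omega\ge 1$ there exists a constant $\varepsilon=\varepsilon(\omega)>0$ with the following property. Let $\gamma_0:\mathbb{S}^1\to\mathbb{R}^2$ be a smooth immersed curve with absolute turning number $\left|\frac{1}{2\pi}\int_{\gamma_0}k\,ds\right|=\omega$ such that $$L[\gamma_0]^3\int_{\gamma_0}k_s^2\,ds<\varepsilon .$$ Let $\gamma:\mathbb{S}^1\times[0,\infty)\to\mathbb{R}^2$ be the free elastic flow with initial data $\gamma_0$, and let $L(t)=L[\gamma(\cdot,t)]$. Then the rescaled flow $\eta(\cdot,t):=\frac{1}{L(t)}\gamma(\cdot,t)$ converges smoothly, up to reparametrisation, as $t\to\infty$ to an $\omega$-fold circle with radius $\frac{1}{2\omega\pi}$ centred at the origin.
   Context: $\mathbb{S}^1:=\mathbb{R}/\mathbb{Z}$. For a smooth immersion $\gamma:\mathbb{S}^1\to\mathbb{R}^2$, $u\mapsto\gamma(u)$: $\partial_s:=|\gamma_u|^{-1}\partial_u$ is the arc-length derivative, $ds:=|\gamma_u|\,du$, $\tau:=\gamma_s$ is the unit tangent, $\nu$ is the unit normal obtained by rotating $\tau$ counterclockwise by $\pi/2$, $k:=\langle\gamma_{ss},\nu\rangle$ is the signed curvature, and $L[\gamma]=\int_{\mathbb{S}^1}ds$ is the length. Subscripts $s$ denote arc-length derivatives. The free elastic flow with initial data $\gamma_0$ is the smooth one-parameter family of smooth immersed curves $\gamma:\mathbb{S}^1\times[0,T)\to\mathbb{R}^2$ solving $$\partial_t\gamma=-\Big(k_{ss}+\tfrac12k^3\Big)\nu,\qquad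 \gamma(\cdot,0)=\gamma_0 .$$ It is known (Dziuk--Kuwert--Schätzle) that for every smooth immersed closed $\gamma_0$ this flow exists uniquely for all $t\in[0,\infty)$. An $\omega$-fold circle with radius $r$ centred at the origin is the origin-centred circle of radius $r$ traversed $\omega$ times, e.g. $u\mapsto r(\cos 2\pi\omega u,\sin2\pi\omega u)$, up to reparametrisation. Smooth convergence up to reparametrisation means that there are diffeomorphisms $\varphi_t$ of $\mathbb{S}^1$ such that $\eta(\varphi_t(\cdot),t)$ converges in $C^\infty(\mathbb{S}^1;\mathbb{R}^2)$ to the limit curve as $t\to\infty$. *)

theory Defs imports "HOL-Analysis.Analysis" begin

text \<open>
  Maps on the circle R/Z are represented by 1-periodic functions on the real line, and
  integrals over the circle by integrals over [0,1].  A time-dependent curve is written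
  \<open>\<gamma> t u\<close>, with time as the first argument; only its values for \<open>t \<ge> 0\<close> matter.
\<close>

definition smooth :: "(real \<Rightarrow> 'a::real_normed_vector) \<Rightarrow> bool" where
  "smooth f \<longleftrightarrow> (\<forall>n u. ((\<lambda>g v. vector_derivative g (at v)) ^^ n) f differentiable (at u))"

definition immersed_curve :: "(real \<Rightarrow> real^2) \<Rightarrow> bool" where
  "immersed_curve \<gamma> \<longleftrightarrow>
     smooth \<gamma> \<and> (\<forall>u. \<gamma> (u + 1) = \<gamma> u) \<and> (\<forall>u. vector_derivative \<gamma> (at u) \<noteq> 0)"

definition speed :: "(real \<Rightarrow> real^2) \<Rightarrow> real \<Rightarrow> real" where
  "speed \<gamma> u = norm (vector_derivative \<gamma> (at u))"

definition arc_deriv :: "(real \<Rightarrow> real^2) \<Rightarrow> (real \<Rightarrow> 'a::real_normed_vector) \<Rightarrow> real \<Rightarrow> 'a" where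
  "arc_deriv \<gamma> f u = (1 / speed \<gamma> u) *\<^sub>R vector_derivative f (at u)"

definition arc_integral :: "(real \<Rightarrow> real^2) \<Rightarrow> (real \<Rightarrow> real) \<Rightarrow> real" where
  "arc_integral \<gamma> f = integral {0..1} (\<lambda>u. f u * speed \<gamma> u)"

definition curve_length :: "(real \<Rightarrow> real^2) \<Rightarrow> real" where
  "curve_length \<gamma> = arc_integral \<gamma> (\<lambda>u. 1)"

definition rot90 :: "real^2 \<Rightarrow> real^2" where
  "rot90 v = vector [- (v $ 2), v $ 1]"

definition unit_tangent :: "(real \<Rightarrow> real^2) \<Rightarrow> real \<Rightarrow> real^2" where
  "unit_tangent \<gamma> = arc_deriv \<gamma> \<gamma>"

definition unit_normal :: "(real \<Rightarrow> real^2) \<Rightarrow> real \<Rightarrow> real^2" where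
  "unit_normal \<gamma> u = rot90 (unit_tangent \<gamma> u)"

definition curvature :: "(real \<Rightarrow> real^2) \<Rightarrow> real \<Rightarrow> real" where
  "curvature \<gamma> u = arc_deriv \<gamma> (arc_deriv \<gamma> \<gamma>) u \<bullet> unit_normal \<gamma> u"

definition turning_number :: "(real \<Rightarrow> real^2) \<Rightarrow> real" where
  "turning_number \<gamma> = 1 / (2 * pi) * arc_integral \<gamma> (curvature \<gamma>)"

definition partial_u :: "(real \<Rightarrow> real \<Rightarrow> 'a::real_normed_vector) \<Rightarrow> real \<Rightarrow> real \<Rightarrow> 'a" where
  "partial_u f t u = vector_derivative (f t) (at u)"

text \<open>The time derivative is one-sided at \<open>t = 0\<close>.\<close>

definition partial_t :: "(real \<Rightarrow> real \<Rightarrow> 'a::real_normed_vector) \<Rightarrow> real \<Rightarrow> real \<Rightarrow> 'a" where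
  "partial_t f t u = vector_derivative (\<lambda>r. f r u) (at t within {0..})"

inductive_set mixed_partials ::
    "(real \<Rightarrow> real \<Rightarrow> 'a::real_normed_vector) \<Rightarrow> (real \<Rightarrow> real \<Rightarrow> 'a) set"
  for f where
  base: "f \<in> mixed_partials f"
| step_u: "g \<in> mixed_partials f \<Longrightarrow> partial_u g \<in> mixed_partials f"
| step_t: "g \<in> mixed_partials f \<Longrightarrow> partial_t g \<in> mixed_partials f"

text \<open>
  Smoothness on \<open>{0..} \<times> UNIV\<close> up to the boundary \<open>t = 0\<close>: mixed partial derivatives of
  every order exist and are jointly continuous.
\<close>

definition smooth_family :: "(real \<Rightarrow> real \<Rightarrow> 'a::real_normed_vector) \<Rightarrow> bool" where
  "smooth_family f \<longleftrightarrow>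
     (\<forall>g\<in>mixed_partials f.
        continuous_on ({0..} \<times> UNIV) (\<lambda>(t, u). g t u) \<and>
        (\<forall>t\<ge>0. \<forall>u. g t differentiable (at u) \<and>
                   (\<lambda>r. g r u) differentiable (at t within {0..})))"

definition free_elastic_flow ::
    "(real \<Rightarrow> real^2) \<Rightarrow> (real \<Rightarrow> real \<Rightarrow> real^2) \<Rightarrow> bool" where
  "free_elastic_flow \<gamma>0 \<gamma> \<longleftrightarrow>
     smooth_family \<gamma> \<and> (\<forall>t\<ge>0. immersed_curve (\<gamma> t)) \<and> \<gamma> 0 = \<gamma>0 \<and>
     (\<forall>t\<ge>0. \<forall>u. partial_t \<gamma> t u =
        - ((arc_deriv (\<gamma> t) (arc_deriv (\<gamma> t) (curvature (\<gamma> t))) u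
            + 1 / 2 * curvature (\<gamma> t) u ^ 3) *\<^sub>R unit_normal (\<gamma> t) u))"

text \<open>
  Smooth self-maps of R/Z are given by their lifts to the real line, the integer \<open>d\<close> being
  the degree.  A diffeomorphism is such a map with a smooth inverse; the lift of the inverse
  can always be chosen to invert the lift of the map.  Reversal of orientation is allowed.
\<close>

definition circle_map_lift :: "(real \<Rightarrow> real) \<Rightarrow> bool" where
  "circle_map_lift \<phi> \<longleftrightarrow> smooth \<phi> \<and> (\<exists>d::int. \<forall>u. \<phi> (u + 1) = \<phi> u + of_int d)"

definition circle_diffeo :: "(real \<Rightarrow> real) \<Rightarrow> bool" where
  "circle_diffeo \<phi> \<longleftrightarrow>
     circle_map_lift \<phi> \<and>
     (\<exists>\<psi>. circle_map_lift \<psi> \<and> (\<forall>u. \<psi> (\<phi> u) = u) \<and> (\<forall>u. \<phi> (\<psi> u) = u))"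

definition multiple_circle :: "nat \<Rightarrow> real \<Rightarrow> (real \<Rightarrow> real^2) \<Rightarrow> bool" where
  "multiple_circle \<omega> r c \<longleftrightarrow>
     (\<exists>\<phi>. circle_diffeo \<phi> \<and>
        (\<forall>u. c u = r *\<^sub>R vector [cos (2 * pi * real \<omega> * \<phi> u), sin (2 * pi * real \<omega> * \<phi> u)]))"

definition converges_smoothly :: "(real \<Rightarrow> real \<Rightarrow> real^2) \<Rightarrow> (real \<Rightarrow> real^2) \<Rightarrow> bool" where
  "converges_smoothly \<eta> c \<longleftrightarrow>
     (\<forall>n. uniform_limit UNIV
            (\<lambda>t. ((\<lambda>g v. vector_derivative g (at v)) ^^ n) (\<eta> t))
            (((\<lambda>g v. vector_derivative g (at v)) ^^ n) c) at_top)"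

definition converges_smoothly_up_to_reparam ::
    "(real \<Rightarrow> real \<Rightarrow> real^2) \<Rightarrow> (real \<Rightarrow> real^2) \<Rightarrow> bool" where
  "converges_smoothly_up_to_reparam \<eta> c \<longleftrightarrow>
     (\<exists>\<phi>. (\<forall>t\<ge>0. circle_diffeo (\<phi> t)) \<and> converges_smoothly (\<lambda>t u. \<eta> t (\<phi> t u)) c)"

end

theory Submission imports Defs begin

text \<open>
  A locally convex closed curve is determined up to translation by its curvature as a function of
  the tangent angle \<open>\<theta>\<close>, and in this variable the flow is a scalar equation.  On an \<open>\<omega>\<close>-fold
  curve \<open>\<theta>\<close> runs through a circle of length \<open>2 \<pi> \<omega>\<close>; the normal velocity is
  \<open>F = - \<kappa> A(\<kappa>\<^sup>2) / 2\<close> with \<open>A = 1 + d\<^sup>2/d\<theta>\<^sup>2\<close>, and the radius of curvature \<open>\<rho> = 1/\<kappa>\<close> satisfies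
  \<open>\<rho>\<^sub>t = A(\<kappa> A(\<kappa>\<^sup>2)) / 2\<close>.  A circle has radius \<open>R\<close> with \<open>R' = 1 / (2 R\<^sup>3)\<close>.  Write
  \<open>\<rho> = R (1 + g)\<close>, where \<open>R\<close> starts at the mean radius of the initial curve.  The Fourier
  coefficients \<open>a\<^sub>n\<close> of \<open>g\<close> then satisfy
  \<open>a\<^sub>n' = R\<^sup>-\<^sup>4 (- q\<^sub>n a\<^sub>n + \<mu>\<^sub>n N\<^sub>n / 2)\<close>, where \<open>\<mu>\<^sub>n = 1 - (n/\<omega>)\<^sup>2\<close>,
  \<open>q\<^sub>n = \<mu>\<^sub>n\<^sup>2 + \<mu>\<^sub>n / 2 + 1/2\<close> and \<open>N\<close> is at least quadratic in \<open>g\<close> (\<open>coeff_g_derivative\<close>).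

  The theorem holds because \<open>q\<^sub>n\<close> is bounded below by a positive multiple of \<open>(1 + |n|)\<^sup>4\<close>
  (\<open>q_ge\<close>): relative to the expanding circle every mode is strictly stable, also the modes
  \<open>0 < |n| < \<omega>\<close> of a multiply covered circle and the modes \<open>|n| = \<omega>\<close>, on which \<open>A\<close> vanishes.

  The nonlinear term is controlled in the weighted absolute norms
  \<open>\<parallel>g\<parallel>\<^sub>j = \<Sum>\<^sub>n (1 + |n|)\<^sup>j |a\<^sub>n|\<close>.  The product of functions is a convolution of coefficients, and
  every term contains at most four derivatives in total, so
  \<open>\<parallel>\<mu> N\<parallel>\<^sub>j \<le> C \<parallel>g\<parallel>\<^sub>0 \<parallel>g\<parallel>\<^sub>j\<^sub>+\<^sub>4\<close> (\<open>nonlinear_estimate\<close>).  When \<open>\<parallel>g\<parallel>\<^sub>0\<close> is small, this loss of four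
  derivatives is absorbed by the dissipation \<open>q\<^sub>n\<close>, and \<open>\<parallel>g\<parallel>\<^sub>j R\<^sup>c\<close> does not increase, for some
  \<open>c > 0\<close> (\<open>weighted_decay\<close>, \<open>decay_step\<close>).  For \<open>j = 0\<close> a continuity argument gives smallness and
  local convexity for all times (\<open>curvature_close\<close>).  Since \<open>\<parallel>g\<parallel>\<^sub>0 \<rightarrow> 0\<close>, the smallness needed for a
  given \<open>j\<close> holds from some time on, so all norms tend to zero (\<open>G_tendsto_0\<close>).

  The hypothesis on \<open>L\<^sup>3 \<integral> k\<^sub>s\<^sup>2 ds\<close> enters twice: it bounds the oscillation of \<open>L k\<close>
  (\<open>initial_curvature\<close>), and with Bessel's inequality and the Cauchy-Schwarz inequality it bounds
  \<open>\<parallel>g\<parallel>\<^sub>0\<close> at time 0 (\<open>initial_coefficients\<close>).  The mean position of the curve with respect to \<open>\<theta>\<close>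
  moves, up to a factor \<open>2 \<i>\<close>, with the coefficient of \<open>F\<close> at the mode \<open>\<omega>\<close> or \<open>- \<omega>\<close>.  It
  vanishes for a circle, so the drift is of smaller order than the growth of \<open>R\<close>, and rescaling by
  \<open>1/L\<close> brings the curve to the origin (\<open>center_tendsto\<close>).  Finally, the rescaled curves are
  reparametrised by the inverse of the tangent angle, where convergence of all derivatives is convergence of the norms
  (\<open>rescaled_flow_converges\<close>).

  Time derivatives are always taken at a fixed parameter \<open>u\<close>: the coefficients are integrals over
  \<open>u\<close> against \<open>d\<theta>\<close>, so that no regularity in time of the inverse of \<open>\<theta>\<close> is used.
\<close>


section \<open>Families that are smooth in the space variable\<close>

text \<open>Only derivatives in \<open>u\<close> are iterated, but continuity is joint in \<open>(t, u)\<close>: this is what makes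
  bounds uniform for \<open>t\<close> in a compact set.  For a singleton \<open>S\<close> it is the smoothness of one curve.\<close>

primrec family_Ck :: "nat \<Rightarrow> real set \<Rightarrow> (real \<Rightarrow> real \<Rightarrow> 'a::real_normed_vector) \<Rightarrow> bool" where
  "family_Ck 0 S f \<longleftrightarrow> continuous_on (S \<times> UNIV) (\<lambda>(t, u). f t u)"
| "family_Ck (Suc n) S f \<longleftrightarrow> continuous_on (S \<times> UNIV) (\<lambda>(t, u). f t u) \<and>
     (\<forall>t\<in>S. \<forall>u. f t differentiable (at u)) \<and> family_Ck n S (partial_u f)"

definition u_smooth :: "real set \<Rightarrow> (real \<Rightarrow> real \<Rightarrow> 'a::real_normed_vector) \<Rightarrow> bool" where
  "u_smooth S f \<longleftrightarrow> (\<forall>n. family_Ck n S f)"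

lemma partial_u_eqI:
  "(f t has_vector_derivative d) (at u) \<Longrightarrow> partial_u f t u = d"
  by (simp add: partial_u_def vector_derivative_at)

lemma family_Ck_cong:
  assumes "\<And>t u. t \<in> S \<Longrightarrow> f t u = g t u"
  shows "family_Ck n S f \<longleftrightarrow> family_Ck n S g"
  using assms
proof (induction n arbitrary: f g)
  case 0
  have "continuous_on (S \<times> UNIV) (\<lambda>(t, u). f t u) = continuous_on (S \<times> UNIV) (\<lambda>(t, u). g t u)"
    by (rule continuous_on_cong) (use 0 in auto)
  then show ?case by simp
next
  case (Suc n)
  have e: "f t = g t" if "t \<in> S" for t using Suc.prems that by auto
  have c: "continuous_on (S \<times> UNIV) (\<lambda>(t, u). f t u) = continuous_on (S \<times> UNIV) (\<lambda>(t, u). g t u)"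
    by (rule continuous_on_cong) (use e in auto)
  have "family_Ck n S (partial_u f) = family_Ck n S (partial_u g)"
    by (rule Suc.IH) (simp add: partial_u_def e)
  moreover have "(\<forall>t\<in>S. \<forall>u. f t differentiable (at u)) = (\<forall>t\<in>S. \<forall>u. g t differentiable (at u))"
  proof (rule ball_cong[OF refl])
    fix t assume "t \<in> S"
    show "(\<forall>u. f t differentiable (at u)) = (\<forall>u. g t differentiable (at u))"
      unfolding e[OF \<open>t \<in> S\<close>] by (rule refl)
  qed
  ultimately show ?case unfolding family_Ck.simps c by (simp only:)
qed

lemma u_smooth_cong:
  assumes "\<And>t u. t \<in> S \<Longrightarrow> f t u = g t u"
  shows "u_smooth S f \<longleftrightarrow> u_smooth S g"
proof -
  have "family_Ck n S f = family_Ck n S g" for n by (rule family_Ck_cong) (rule assms)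
  then show ?thesis by (simp only: u_smooth_def)
qed

lemma family_Ck_SucD: "family_Ck (Suc n) S f \<Longrightarrow> family_Ck n S f"
proof (induction n arbitrary: f)
  case 0 then show ?case by simp
next
  case (Suc n)
  then show ?case by (simp only: family_Ck.simps(2)) blast
qed

lemma family_Ck_SucI:
  assumes c: "continuous_on (S \<times> UNIV) (\<lambda>(t, u). f t u)"
    and d: "\<And>t u. t \<in> S \<Longrightarrow> (f t has_vector_derivative f' t u) (at u)"
    and f': "family_Ck n S f'"
  shows "family_Ck (Suc n) S f"
proof -
  have "family_Ck n S (partial_u f)"
    using f' family_Ck_cong[of S "partial_u f" f' n] partial_u_eqI[OF d] by auto
  with c d show ?thesis
    by (auto intro: differentiableI_vector)
qed

lemma u_smoothI:
  assumes "continuous_on (S \<times> UNIV) (\<lambda>(t, u). f t u)"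
    and "\<And>t u. t \<in> S \<Longrightarrow> (f t has_vector_derivative f' t u) (at u)"
    and "u_smooth S f'"
  shows "u_smooth S f"
  unfolding u_smooth_def
proof
  fix n show "family_Ck n S f"
    using assms family_Ck_SucI[OF assms(1,2), of n] family_Ck_SucD unfolding u_smooth_def by blast
qed

lemma u_smooth_continuous: "u_smooth S f \<Longrightarrow> continuous_on (S \<times> UNIV) (\<lambda>(t, u). f t u)"
  unfolding u_smooth_def using family_Ck.simps(1) by blast

lemma family_Ck_derivative:
  assumes "family_Ck (Suc n) S f" "t \<in> S"
  shows "(f t has_vector_derivative partial_u f t u) (at u)"
proof -
  have "f t differentiable (at u)" using assms by simp
  then show ?thesis unfolding partial_u_def by (rule vector_derivative_works[THEN iffD1])
qed

lemma u_smooth_derivative: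
  "u_smooth S f \<Longrightarrow> t \<in> S \<Longrightarrow> (f t has_vector_derivative partial_u f t u) (at u)"
  unfolding u_smooth_def using family_Ck_derivative by blast

lemma u_smooth_partial: "u_smooth S f \<Longrightarrow> u_smooth S (partial_u f)"
  unfolding u_smooth_def using family_Ck.simps(2) by blast

lemma u_smooth_continuous_slice: "u_smooth S f \<Longrightarrow> t \<in> S \<Longrightarrow> continuous_on A (f t)"
  using u_smooth_derivative[of S f t]
  by (meson continuous_at_imp_continuous_on has_vector_derivative_continuous)

lemma u_smooth_subset: "u_smooth S f \<Longrightarrow> T \<subseteq> S \<Longrightarrow> u_smooth T f"
proof -
  have "family_Ck n S f \<Longrightarrow> T \<subseteq> S \<Longrightarrow> family_Ck n T f" for n
  proof (induction n arbitrary: f)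
    case 0 then show ?case by (auto intro: continuous_on_subset)
  next
    case (Suc n)
    have "continuous_on (T \<times> UNIV) (\<lambda>(t, u). f t u)"
      using Suc.prems by (auto intro: continuous_on_subset)
    with Suc show ?case by auto
  qed
  then show "u_smooth S f \<Longrightarrow> T \<subseteq> S \<Longrightarrow> u_smooth T f" unfolding u_smooth_def by blast
qed

lemma u_smooth_const:
  fixes r :: "real \<Rightarrow> 'b::real_normed_vector"
  assumes "continuous_on S r"
  shows "u_smooth S (\<lambda>t u. r t)"
proof -
  have z: "family_Ck n S (\<lambda>t u. 0::'b)" for n
  proof (induction n)
    case (Suc n) show ?case by (rule family_Ck_SucI[OF _ _ Suc]) auto
  qed simp
  have c: "continuous_on (S \<times> UNIV) (\<lambda>(t, u::real). r t)"
    using continuous_on_compose2[OF assms, of "S \<times> UNIV" fst]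
    by (auto simp: case_prod_unfold continuous_on_fst)
  show ?thesis unfolding u_smooth_def
  proof
    fix n show "family_Ck n S (\<lambda>t u. r t)"
    proof (cases n)
      case (Suc m)
      show ?thesis unfolding Suc by (rule family_Ck_SucI[OF c _ z]) simp
    qed (use c in simp)
  qed
qed

lemma family_Ck_add:
  "family_Ck n S f \<Longrightarrow> family_Ck n S g \<Longrightarrow> family_Ck n S (\<lambda>t u. f t u + g t u)"
proof (induction n arbitrary: f g)
  case 0 then show ?case by (auto simp: case_prod_unfold intro: continuous_intros)
next
  case (Suc n)
  show ?case
  proof (rule family_Ck_SucI)
    show "family_Ck n S (\<lambda>t u. partial_u f t u + partial_u g t u)"
      by (rule Suc.IH) (use Suc.prems in auto)
    show "continuous_on (S \<times> UNIV) (\<lambda>(t, u). f t u + g t u)"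
      using Suc.prems by (auto simp: case_prod_unfold intro: continuous_intros)
    show "((\<lambda>u. f t u + g t u) has_vector_derivative partial_u f t u + partial_u g t u) (at u)"
      if "t \<in> S" for t u
      using that Suc.prems by (intro has_vector_derivative_add family_Ck_derivative)
  qed
qed

lemma family_Ck_bilinear:
  assumes "bounded_bilinear pr"
  shows "family_Ck n S f \<Longrightarrow> family_Ck n S g \<Longrightarrow> family_Ck n S (\<lambda>t u. pr (f t u) (g t u))"
proof (induction n arbitrary: f g)
  case 0 
  interpret pr: bounded_bilinear pr by fact
  show ?case using 0 by (auto simp: case_prod_unfold intro: pr.continuous_on)
next
  case (Suc n)
  interpret pr: bounded_bilinear pr by fact
  show ?case
  proof (rule family_Ck_SucI)
    have "family_Ck n S f" "family_Ck n S g" using Suc.prems by (blast dest: family_Ck_SucD)+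
    moreover have "family_Ck n S (partial_u f)" "family_Ck n S (partial_u g)"
      using Suc.prems by auto
    ultimately show "family_Ck n S (\<lambda>t u. pr (f t u) (partial_u g t u) + pr (partial_u f t u) (g t u))"
      by (intro family_Ck_add Suc.IH)
    show "continuous_on (S \<times> UNIV) (\<lambda>(t, u). pr (f t u) (g t u))"
      using Suc.prems by (auto simp: case_prod_unfold intro: pr.continuous_on)
    show "((\<lambda>u. pr (f t u) (g t u)) has_vector_derivative
            pr (f t u) (partial_u g t u) + pr (partial_u f t u) (g t u)) (at u)"
      if "t \<in> S" for t u
      using that Suc.prems by (intro pr.has_vector_derivative family_Ck_derivative)
  qed
qed

lemma u_smooth_bilinear:
  "bounded_bilinear pr \<Longrightarrow> u_smooth S f \<Longrightarrow> u_smooth S g \<Longrightarrow> u_smooth S (\<lambda>t u. pr (f t u) (g t u))"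
  unfolding u_smooth_def using family_Ck_bilinear by blast

lemma u_smooth_linear:
  assumes "bounded_linear h" "u_smooth S f"
  shows "u_smooth S (\<lambda>t u. h (f t u))"
proof -
  interpret h: bounded_linear h by fact
  have "family_Ck n S f \<Longrightarrow> family_Ck n S (\<lambda>t u. h (f t u))" for n f
  proof (induction n arbitrary: f)
    case 0 then show ?case by (auto simp: case_prod_unfold intro: h.continuous_on)
  next
    case (Suc n)
    show ?case
    proof (rule family_Ck_SucI)
      show "family_Ck n S (\<lambda>t u. h (partial_u f t u))"
        by (intro Suc.IH) (use Suc.prems in auto)
      show "continuous_on (S \<times> UNIV) (\<lambda>(t, u). h (f t u))"
        using Suc.prems by (auto simp: case_prod_unfold intro: h.continuous_on)
      show "((\<lambda>u. h (f t u)) has_vector_derivative h (partial_u f t u)) (at u)"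
        if "t \<in> S" for t u
        using that Suc.prems by (intro h.has_vector_derivative family_Ck_derivative)
    qed
  qed
  with assms show ?thesis unfolding u_smooth_def by blast
qed

lemma u_smooth_add:
  "u_smooth S f \<Longrightarrow> u_smooth S g \<Longrightarrow> u_smooth S (\<lambda>t u. f t u + g t u)"
  unfolding u_smooth_def using family_Ck_add by blast

lemma u_smooth_minus: "u_smooth S f \<Longrightarrow> u_smooth S (\<lambda>t u. - f t u)"
  by (rule u_smooth_linear[OF bounded_linear_minus[OF bounded_linear_ident]])

lemma u_smooth_diff: "u_smooth S f \<Longrightarrow> u_smooth S g \<Longrightarrow> u_smooth S (\<lambda>t u. f t u - g t u)"
  using u_smooth_add[OF _ u_smooth_minus, of S f g] by simp

lemma u_smooth_mult:
  fixes f g :: "real \<Rightarrow> real \<Rightarrow> 'a::real_normed_algebra"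
  shows "u_smooth S f \<Longrightarrow> u_smooth S g \<Longrightarrow> u_smooth S (\<lambda>t u. f t u * g t u)"
  by (rule u_smooth_bilinear[OF bounded_bilinear_mult])

lemma u_smooth_power:
  fixes f :: "real \<Rightarrow> real \<Rightarrow> 'a::real_normed_algebra_1"
  shows "u_smooth S f \<Longrightarrow> u_smooth S (\<lambda>t u. f t u ^ m)"
  by (induction m) (auto intro: u_smooth_mult u_smooth_const)

lemma u_smooth_of_real: 
  "u_smooth S f \<Longrightarrow> u_smooth S (\<lambda>t u. of_real (f t u) :: 'a::real_normed_algebra_1)"
  by (rule u_smooth_linear[OF bounded_linear_of_real])

text \<open>A solution of a linear equation with smooth coefficients inherits their smoothness.  This
  covers exponentials, and hence powers of the speed, without a chain rule of higher order.\<close>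

lemma u_smooth_linear_ode:
  fixes f h :: "real \<Rightarrow> real \<Rightarrow> 'a::real_normed_algebra"
  assumes c: "continuous_on (S \<times> UNIV) (\<lambda>(t, u). f t u)"
    and d: "\<And>t u. t \<in> S \<Longrightarrow> (f t has_vector_derivative f t u * h t u) (at u)"
    and h: "u_smooth S h"
  shows "u_smooth S f"
proof -
  have "family_Ck n S f" for n
  proof (induction n)
    case 0 then show ?case using c by simp
  next
    case (Suc n)
    show ?case
      by (rule family_Ck_SucI[OF c d family_Ck_bilinear[OF bounded_bilinear_mult]])
         (use Suc h in \<open>auto simp: u_smooth_def\<close>)
  qed
  then show ?thesis by (simp add: u_smooth_def)
qed

lemma u_smooth_inverse:
  fixes f :: "real \<Rightarrow> real \<Rightarrow> 'a::real_normed_field"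
  assumes f: "u_smooth S f" and nz: "\<And>t u. t \<in> S \<Longrightarrow> f t u \<noteq> 0"
  shows "u_smooth S (\<lambda>t u. inverse (f t u))"
proof -
  have c: "continuous_on (S \<times> UNIV) (\<lambda>(t, u). inverse (f t u))"
    using u_smooth_continuous[OF f] nz by (auto simp: case_prod_unfold intro!: continuous_on_inverse)
  have d: "((\<lambda>u. inverse (f t u)) has_vector_derivative
      inverse (f t u) * (- (inverse (f t u) * partial_u f t u))) (at u)" if "t \<in> S" for t u
  proof -
    have "((\<lambda>u. inverse (f t u)) has_derivative
        (\<lambda>h. - (inverse (f t u) * (h *\<^sub>R partial_u f t u) * inverse (f t u)))) (at u)"
      using Deriv.has_derivative_inverse[OF nz[OF that, of u]
          u_smooth_derivative[OF f that, of u, unfolded has_vector_derivative_def]] .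
    then show ?thesis unfolding has_vector_derivative_def
      by (rule has_derivative_eq_rhs) (simp add: fun_eq_iff algebra_simps)
  qed
  have "family_Ck n S (\<lambda>t u. inverse (f t u))" for n
  proof (induction n)
    case 0 then show ?case using c by simp
  next
    case (Suc n)
    have "family_Ck n S (\<lambda>t u. inverse (f t u) * partial_u f t u)"
      by (rule family_Ck_bilinear[OF bounded_bilinear_mult Suc])
        (use u_smooth_partial[OF f] in \<open>simp add: u_smooth_def\<close>)
    from family_Ck_bilinear[OF bounded_bilinear_mult _ this, of "\<lambda>t u. -1"]
    have "family_Ck n S (\<lambda>t u. - (inverse (f t u) * partial_u f t u))"
      using u_smooth_const[of S "\<lambda>t. -1::'a"] by (simp add: u_smooth_def)
    note f' = family_Ck_bilinear[OF bounded_bilinear_mult Suc this]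
    show ?case
      by (rule family_Ck_SucI[OF c _ f']) (rule d)
  qed
  then show ?thesis by (simp add: u_smooth_def)
qed

lemma u_smooth_divide:
  fixes f g :: "real \<Rightarrow> real \<Rightarrow> 'a::real_normed_field"
  shows "u_smooth S f \<Longrightarrow> u_smooth S g \<Longrightarrow> (\<And>t u. t \<in> S \<Longrightarrow> g t u \<noteq> 0) \<Longrightarrow>
    u_smooth S (\<lambda>t u. f t u / g t u)"
  unfolding divide_inverse by (intro u_smooth_mult u_smooth_inverse)

abbreviation iterated_vd :: "nat \<Rightarrow> (real \<Rightarrow> 'a::real_normed_vector) \<Rightarrow> real \<Rightarrow> 'a" where
  "iterated_vd n f \<equiv> ((\<lambda>g v. vector_derivative g (at v)) ^^ n) f"

lemma u_smooth_imp_smooth: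
  assumes "u_smooth S f" "t \<in> S"
  shows "smooth (f t)"
proof -
  have "u_smooth S f \<Longrightarrow> iterated_vd n (f t) differentiable (at u)" for n u
  proof (induction n arbitrary: f)
    case 0 then show ?case
      using differentiableI_vector[OF u_smooth_derivative[OF 0 assms(2)]] by simp
  next
    case (Suc n)
    from Suc.IH[OF u_smooth_partial[OF Suc.prems]]
    show ?case by (simp only: funpow_Suc_right o_def partial_u_def[abs_def])
  qed
  with assms show ?thesis unfolding smooth_def by blast
qed

lemma smooth_family_imp_u_smooth:
  assumes "smooth_family f"
  shows "u_smooth {0..} f"
proof -
  have "g \<in> mixed_partials f \<Longrightarrow> family_Ck n {0..} g" for n g
  proof (induction n arbitrary: g)
    case 0 then show ?case using assms by (simp add: smooth_family_def)
  next
    case (Suc n)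
    have "family_Ck n {0..} (partial_u g)" by (rule Suc.IH[OF mixed_partials.step_u[OF Suc.prems]])
    with Suc.prems show ?case using assms by (simp add: smooth_family_def)
  qed
  then show ?thesis unfolding u_smooth_def using mixed_partials.base by blast
qed

section \<open>Weighted absolute norms of coefficient sequences\<close>

abbreviation wt :: "int \<Rightarrow> real" where "wt n \<equiv> 1 + \<bar>real_of_int n\<bar>"

definition rapid :: "(int \<Rightarrow> complex) \<Rightarrow> bool" where
  "rapid a \<longleftrightarrow> (\<forall>j. (\<lambda>n. wt n ^ j * norm (a n)) summable_on UNIV)"

text \<open>For the coefficients of a function, \<open>wnorm 0\<close> is the norm of the Wiener algebra.\<close>

definition wnorm :: "nat \<Rightarrow> (int \<Rightarrow> complex) \<Rightarrow> real" where
  "wnorm j a = (\<Sum>\<^sub>\<infinity>n. wt n ^ j * norm (a n))"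

lemma rapidD: "rapid a \<Longrightarrow> (\<lambda>n. wt n ^ j * norm (a n)) summable_on UNIV"
  by (simp add: rapid_def)

lemma rapid_summable: "rapid a \<Longrightarrow> (\<lambda>n. norm (a n)) summable_on UNIV"
  using rapidD[of a 0] by simp

lemma wnorm_0: "wnorm 0 a = (\<Sum>\<^sub>\<infinity>n. norm (a n))"
  by (simp add: wnorm_def)

lemma wnorm_nonneg: "wnorm j a \<ge> 0"
  unfolding wnorm_def by (rule infsum_nonneg) simp

lemma sum_le_wnorm:
  assumes "rapid a" "finite F"
  shows "(\<Sum>n\<in>F. wt n ^ j * norm (a n)) \<le> wnorm j a"
  unfolding wnorm_def by (rule finite_sum_le_infsum) (use assms rapidD in auto)

lemma term_le_wnorm: "rapid a \<Longrightarrow> wt n ^ j * norm (a n) \<le> wnorm j a"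
  using sum_le_wnorm[of a "{n}" j] by simp

lemma wnorm_leI:
  assumes "\<And>F. finite F \<Longrightarrow> (\<Sum>n\<in>F. wt n ^ j * norm (a n)) \<le> B"
  shows "(\<lambda>n. wt n ^ j * norm (a n)) summable_on UNIV" "wnorm j a \<le> B"
proof -
  show s: "(\<lambda>n. wt n ^ j * norm (a n)) summable_on UNIV"
    by (rule nonneg_bdd_above_summable_on) (use assms in \<open>auto intro!: bdd_aboveI2[where M = B]\<close>)
  show "wnorm j a \<le> B"
    unfolding wnorm_def by (rule infsum_le_finite_sums[OF s]) (use assms in auto)
qed

lemma wnorm_mono_exponent:
  assumes "rapid a" "i \<le> j"
  shows "wnorm i a \<le> wnorm j a"
  unfolding wnorm_def
  by (rule infsum_mono) (use assms rapidD in \<open>auto intro!: mult_right_mono power_increasing\<close>)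

text \<open>A Fourier multiplier of order \<open>i\<close> costs \<open>i\<close> powers of the weight.\<close>

lemma wnorm_compare:
  assumes b: "rapid b" and le: "\<And>n. norm (a n) \<le> c * wt n ^ i * norm (b n)"
  shows "rapid a" "wnorm j a \<le> c * wnorm (j + i) b"
proof -
  have "c \<ge> 0 \<or> (\<forall>n. norm (b n) = 0)"
  proof (rule ccontr)
    assume "\<not> ?thesis"
    then obtain n where n: "c < 0" "norm (b n) > 0" by auto
    then have "c * wt n ^ i * norm (b n) < 0" by (simp add: mult_less_0_iff)
    with le[of n] show False using norm_ge_zero[of "a n"] by linarith
  qed
  then have *: "(\<Sum>n\<in>F. wt n ^ j * norm (a n)) \<le> c * wnorm (j + i) b" if F: "finite F" for F j
  proof
    assume c: "c \<ge> 0"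
    have "(\<Sum>n\<in>F. wt n ^ j * norm (a n)) \<le> (\<Sum>n\<in>F. c * (wt n ^ (j + i) * norm (b n)))"
    proof (rule sum_mono)
      fix n
      have "wt n ^ j * norm (a n) \<le> wt n ^ j * (c * wt n ^ i * norm (b n))"
        by (rule mult_left_mono[OF le]) simp
      then show "wt n ^ j * norm (a n) \<le> c * (wt n ^ (j + i) * norm (b n))"
        by (simp add: power_add algebra_simps)
    qed
    also have "\<dots> = c * (\<Sum>n\<in>F. wt n ^ (j + i) * norm (b n))" by (simp add: sum_distrib_left)
    also have "\<dots> \<le> c * wnorm (j + i) b" by (rule mult_left_mono[OF sum_le_wnorm[OF b F] c])
    finally show ?thesis .
  next
    assume z: "\<forall>n. norm (b n) = 0"
    then have "norm (a n) = 0" for n using le[of n] norm_ge_zero[of "a n"] by simp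
    with z show ?thesis by (simp add: wnorm_def)
  qed
  show "rapid a" unfolding rapid_def using wnorm_leI(1)[OF *] by blast
  show "wnorm j a \<le> c * wnorm (j + i) b" by (rule wnorm_leI(2)[OF *])
qed

lemma wnorm_compare0:
  assumes b: "rapid b" and le: "\<And>n. norm (a n) \<le> c * norm (b n)"
  shows "rapid a" "wnorm j a \<le> c * wnorm j b"
  using wnorm_compare(1)[of b a c 0] wnorm_compare(2)[of b a c 0 j] assms by auto

lemma wnorm_add:
  assumes "rapid a" "rapid b" and le: "\<And>n. norm (c n) \<le> norm (a n) + norm (b n)"
  shows "rapid c" "wnorm j c \<le> wnorm j a + wnorm j b"
proof -
  have *: "(\<Sum>n\<in>F. wt n ^ j * norm (c n)) \<le> wnorm j a + wnorm j b" if F: "finite F" for F j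
  proof -
    have "(\<Sum>n\<in>F. wt n ^ j * norm (c n)) \<le> (\<Sum>n\<in>F. wt n ^ j * norm (a n) + wt n ^ j * norm (b n))"
      by (rule sum_mono) (use le in \<open>auto simp: distrib_left[symmetric] intro!: mult_left_mono\<close>)
    also have "\<dots> \<le> wnorm j a + wnorm j b"
      using sum_le_wnorm[OF assms(1) F] sum_le_wnorm[OF assms(2) F] by (simp add: sum.distrib add_mono)
    finally show ?thesis .
  qed
  show "rapid c" unfolding rapid_def using wnorm_leI(1)[OF *] by blast
  show "wnorm j c \<le> wnorm j a + wnorm j b" by (rule wnorm_leI(2)[OF *])
qed

lemma summable_inverse_square_int: "(\<lambda>n::int. 1 / wt n ^ 2) summable_on UNIV"
proof -
  have s: "(\<lambda>n::nat. 1 / (1 + real n)^2) summable_on UNIV"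
    using inverse_squares_sums by (subst summable_on_UNIV_nonneg_real_iff) (auto simp: sums_iff add.commute)
  have 1: "(\<lambda>n::int. 1 / wt n ^ 2) summable_on range int"
    by (subst summable_on_reindex) (use s in \<open>auto simp: o_def\<close>)
  have 2: "(\<lambda>n::int. 1 / wt n ^ 2) summable_on range (\<lambda>n. - int n)"
    by (subst summable_on_reindex) (use s in \<open>auto simp: o_def inj_on_def\<close>)
  have "(UNIV::int set) = range int \<union> range (\<lambda>n. - int n)"
  proof -
    have "z \<in> range int \<union> range (\<lambda>n. - int n)" for z :: int
      by (cases z rule: int_cases2) auto
    then show ?thesis by blast
  qed
  then show ?thesis using summable_on_union[OF 1 2] by simp
qed

lemma wt_power_divide:
  assumes "wt n ^ (j + 2) * x \<le> C"
  shows "wt n ^ j * x \<le> C * (1 / wt n ^ 2)"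
proof -
  have "wt n ^ 2 > 0" by simp
  moreover have "(wt n ^ j * x) * wt n ^ 2 \<le> C" using assms by (simp only: power_add mult_ac)
  ultimately show ?thesis by (simp add: pos_le_divide_eq)
qed

lemma rapidI:
  assumes "\<And>j. \<exists>C. \<forall>n. wt n ^ j * norm (a n) \<le> C"
  shows "rapid a"
  unfolding rapid_def
proof
  fix j
  obtain C where C: "\<And>n. wt n ^ (j + 2) * norm (a n) \<le> C" using assms by blast
  have "(\<lambda>n. C * (1 / wt n ^ 2)) summable_on UNIV"
    by (rule summable_on_cmult_right[OF summable_inverse_square_int])
  then show "(\<lambda>n. wt n ^ j * norm (a n)) summable_on UNIV"
    by (rule summable_on_comparison_test) (use wt_power_divide[OF C] in auto)
qed

lemma finite_int_subset_Icc:
  fixes F :: "int set"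
  assumes "finite F"
  obtains N :: nat where "F \<subseteq> {- int N..int N}"
proof -
  have "F \<subseteq> {- int (nat (Max (insert 0 (abs ` F)))) .. int (nat (Max (insert 0 (abs ` F))))}"
  proof
    fix n assume "n \<in> F"
    then have "\<bar>n\<bar> \<le> Max (insert 0 (abs ` F))" using assms by (intro Max_ge) auto
    then show "n \<in> {- int (nat (Max (insert 0 (abs ` F)))) .. int (nat (Max (insert 0 (abs ` F))))}" by auto
  qed
  then show ?thesis by (rule that)
qed

text \<open>Two further powers of the weight give a summable majorant that does not depend on \<open>t\<close>, so one
  truncation serves all times.\<close>

lemma uniform_tail:
  assumes C: "\<And>t n. t \<in> K \<Longrightarrow> wt n ^ (j + 2) * norm (a t n) \<le> C" and e: "e > 0"
  obtains N :: nat where "\<And>t. t \<in> K \<Longrightarrow> wnorm j (a t) \<le> (\<Sum>n\<in>{-int N..int N}. wt n ^ j * norm (a t n)) + e"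
proof -
  define \<beta> where "\<beta> n = C * (1 / wt n ^ 2)" for n
  have s: "\<beta> summable_on UNIV" unfolding \<beta>_def
    by (rule summable_on_cmult_right[OF summable_inverse_square_int])
  obtain F where F: "finite F" "dist (sum \<beta> F) (infsum \<beta> UNIV) \<le> e"
    using infsum_finite_approximation[OF s e] by blast
  obtain N where N: "F \<subseteq> {-int N..int N}" by (rule finite_int_subset_Icc[OF F(1)])
  show ?thesis
  proof (rule that[of N])
    fix t assume t: "t \<in> K"
    have w: "wt n ^ j * norm (a t n) \<le> \<beta> n" for n
      using wt_power_divide[OF C[OF t, of n]] by (simp add: \<beta>_def)
    have \<beta>0: "\<beta> n \<ge> 0" for n by (rule order_trans[OF _ w]) simp
    show "wnorm j (a t) \<le> (\<Sum>n\<in>{-int N..int N}. wt n ^ j * norm (a t n)) + e"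
    proof (rule wnorm_leI)
      fix G :: "int set" assume G: "finite G"
      let ?I = "{-int N..int N}"
      have "(\<Sum>n\<in>G. wt n ^ j * norm (a t n)) \<le> (\<Sum>n\<in>G \<union> ?I. wt n ^ j * norm (a t n))"
        by (rule sum_mono2) (use G in auto)
      also have "\<dots> = (\<Sum>n\<in>?I. wt n ^ j * norm (a t n)) + (\<Sum>n\<in>G - ?I. wt n ^ j * norm (a t n))"
        using G by (subst sum.union_disjoint[symmetric]) (auto intro: sum.cong)
      also have "(\<Sum>n\<in>G - ?I. wt n ^ j * norm (a t n)) \<le> sum \<beta> (G - ?I)" by (rule sum_mono) (rule w)
      also have "sum \<beta> (G - ?I) \<le> sum \<beta> (G - F)" by (rule sum_mono2) (use G N \<beta>0 in auto)
      also have "sum \<beta> (G - F) = sum \<beta> (F \<union> (G - F)) - sum \<beta> F"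
        using G F(1) by (subst sum.union_disjoint) auto
      also have "sum \<beta> (F \<union> (G - F)) \<le> infsum \<beta> UNIV"
        by (rule finite_sum_le_infsum) (use s G F(1) \<beta>0 in auto)
      also have "infsum \<beta> UNIV - sum \<beta> F \<le> e" using F(2) by (auto simp: dist_real_def)
      finally show "(\<Sum>n\<in>G. wt n ^ j * norm (a t n)) \<le> (\<Sum>n\<in>?I. wt n ^ j * norm (a t n)) + e" by simp
    qed
  qed
qed

lemma continuous_on_wnorm:
  assumes C: "\<And>t n. t \<in> K \<Longrightarrow> wt n ^ (j + 2) * norm (a t n) \<le> C" 
    and r: "\<And>t. t \<in> K \<Longrightarrow> rapid (a t)" and c: "\<And>n. continuous_on K (\<lambda>t. a t n)"
  shows "continuous_on K (\<lambda>t. wnorm j (a t))"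
proof (rule uniform_limit_theorem)
  show "\<forall>\<^sub>F N in sequentially. continuous_on K (\<lambda>t. \<Sum>n\<in>{-int N..int N}. wt n ^ j * norm (a t n))"
    by (intro always_eventually allI continuous_intros c)
  show "uniform_limit K (\<lambda>N t. \<Sum>n\<in>{-int N..int N}. wt n ^ j * norm (a t n)) (\<lambda>t. wnorm j (a t)) sequentially"
    unfolding uniform_limit_iff
  proof (intro allI impI)
    fix e :: real assume "e > 0"
    then have "e / 2 > 0" by simp
    from uniform_tail[of K j a C, OF C this] obtain N0 :: nat where
      N0: "\<And>t. t \<in> K \<Longrightarrow> wnorm j (a t) \<le> (\<Sum>n\<in>{-int N0..int N0}. wt n ^ j * norm (a t n)) + e / 2" by blast
    show "\<forall>\<^sub>F N in sequentially. \<forall>t\<in>K. dist (\<Sum>n\<in>{-int N..int N}. wt n ^ j * norm (a t n)) (wnorm j (a t)) < e"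
      using eventually_ge_at_top[of N0]
    proof eventually_elim
      case (elim N)
      show ?case
      proof
        fix t assume t: "t \<in> K"
        have "(\<Sum>n\<in>{-int N0..int N0}. wt n ^ j * norm (a t n)) \<le> (\<Sum>n\<in>{-int N..int N}. wt n ^ j * norm (a t n))"
          by (rule sum_mono2) (use elim in auto)
        with N0[OF t] sum_le_wnorm[OF r[OF t], of "{-int N..int N}" j] \<open>e > 0\<close>
        show "dist (\<Sum>n\<in>{-int N..int N}. wt n ^ j * norm (a t n)) (wnorm j (a t)) < e"
          by (simp add: dist_real_def)
      qed
    qed
  qed
qed simp

text \<open>The left-hand side is a double sum, in which \<open>wt m ^ p * wt l ^ q\<close> is at most the power
  \<open>p + q\<close> of the larger of the two weights.  This moves all derivatives in a product onto one factor.\<close>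

lemma wnorm_interpolation:
  assumes a: "rapid a" and b: "rapid b"
  shows "wnorm p a * wnorm q b \<le> wnorm 0 a * wnorm (p + q) b + wnorm (p + q) a * wnorm 0 b"
proof -
  have w: "wt m ^ p * wt l ^ q \<le> wt m ^ (p + q) + wt l ^ (p + q)" for m l
  proof (cases "wt m \<le> wt l")
    case True
    then have "wt m ^ p * wt l ^ q \<le> wt l ^ p * wt l ^ q" by (intro mult_right_mono power_mono) auto
    then show ?thesis by (simp add: power_add add_increasing)
  next
    case False
    then have "wt m ^ p * wt l ^ q \<le> wt m ^ p * wt m ^ q" by (intro mult_left_mono power_mono) auto
    then show ?thesis by (simp add: power_add add_increasing2)
  qed
  have 1: "wt m ^ p * wnorm q b \<le> wt m ^ (p + q) * wnorm 0 b + wnorm (p + q) b" for m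
  proof -
    have "wt m ^ p * wnorm q b = (\<Sum>\<^sub>\<infinity>l. wt m ^ p * (wt l ^ q * norm (b l)))"
      unfolding wnorm_def by (rule infsum_cmult_right'[symmetric])
    also have "\<dots> \<le> (\<Sum>\<^sub>\<infinity>l. wt m ^ (p + q) * norm (b l) + wt l ^ (p + q) * norm (b l))"
    proof (rule infsum_mono)
      fix l
      have "(wt m ^ p * wt l ^ q) * norm (b l) \<le> (wt m ^ (p + q) + wt l ^ (p + q)) * norm (b l)"
        by (rule mult_right_mono[OF w]) simp
      then show "wt m ^ p * (wt l ^ q * norm (b l)) \<le> wt m ^ (p + q) * norm (b l) + wt l ^ (p + q) * norm (b l)"
        by (simp add: algebra_simps)
    qed (use rapidD[OF b] rapid_summable[OF b] in \<open>auto intro!: summable_on_add summable_on_cmult_right\<close>)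
    also have "\<dots> = wt m ^ (p + q) * wnorm 0 b + wnorm (p + q) b"
      using rapidD[OF b] rapid_summable[OF b]
      by (subst infsum_add) (auto intro!: summable_on_cmult_right simp: wnorm_def infsum_cmult_right')
    finally show ?thesis .
  qed
  have "wnorm p a * wnorm q b = (\<Sum>\<^sub>\<infinity>m. wt m ^ p * norm (a m) * wnorm q b)"
    unfolding wnorm_def[of p a] by (rule infsum_cmult_left'[symmetric])
  also have "\<dots> \<le> (\<Sum>\<^sub>\<infinity>m. wt m ^ (p + q) * norm (a m) * wnorm 0 b + norm (a m) * wnorm (p + q) b)"
  proof (rule infsum_mono)
    fix m
    have "norm (a m) * (wt m ^ p * wnorm q b) \<le> norm (a m) * (wt m ^ (p + q) * wnorm 0 b + wnorm (p + q) b)"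
      by (rule mult_left_mono[OF 1]) simp
    then show "wt m ^ p * norm (a m) * wnorm q b \<le> wt m ^ (p + q) * norm (a m) * wnorm 0 b + norm (a m) * wnorm (p + q) b"
      by (simp add: algebra_simps)
  qed (use rapidD[OF a] rapid_summable[OF a] in \<open>auto intro!: summable_on_add summable_on_cmult_left\<close>)
  also have "\<dots> = wnorm (p + q) a * wnorm 0 b + wnorm 0 a * wnorm (p + q) b"
    using rapidD[OF a] rapid_summable[OF a]
    by (subst infsum_add) (auto intro!: summable_on_cmult_left simp: wnorm_def[of _ a] infsum_cmult_left')
  finally show ?thesis by simp
qed

lemma has_sum_finite_sum:
  fixes f :: "'a \<Rightarrow> 'b \<Rightarrow> real"
  assumes "finite F" "\<And>n. n \<in> F \<Longrightarrow> (f n has_sum S n) A"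
  shows "((\<lambda>m. \<Sum>n\<in>F. f n m) has_sum (\<Sum>n\<in>F. S n)) A"
  using assms by (induction F rule: finite_induct) (auto intro: has_sum_add)

text \<open>The weight at \<open>n = m + (n - m)\<close> is at most twice the larger of the weights at \<open>m\<close> and
  \<open>n - m\<close>, so the power of the weight falls on only one of the two factors.\<close>

lemma wnorm_convolution:
  assumes a: "rapid a" and b: "rapid b"
    and c: "\<And>n. norm (c n) \<le> (\<Sum>\<^sub>\<infinity>m. norm (a m) * norm (b (n - m)))"
  shows "rapid c" "wnorm j c \<le> 2 ^ j * (wnorm 0 a * wnorm j b + wnorm j a * wnorm 0 b)"
proof -
  have bB: "norm (b n) \<le> wnorm 0 b" for n using term_le_wnorm[OF b, of n 0] by simp
  have s: "(\<lambda>m. norm (a m) * norm (b (n - m))) summable_on UNIV" for n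
    by (rule summable_on_comparison_test[OF summable_on_cmult_left[OF rapid_summable[OF a], of "wnorm 0 b"]])
      (use bB in \<open>auto intro: mult_left_mono\<close>)
  have *: "(\<Sum>n\<in>F. wt n ^ j * norm (c n)) \<le> 2 ^ j * (wnorm 0 a * wnorm j b + wnorm j a * wnorm 0 b)"
    if F: "finite F" for F j
  proof -
    have inner: "(\<Sum>n\<in>F. wt n ^ j * norm (b (n - m))) \<le> 2 ^ j * (wt m ^ j * wnorm 0 b + wnorm j b)" for m
    proof -
      have "wt n ^ j * norm (b (n - m)) \<le> 2 ^ j * (wt m ^ j * norm (b (n - m)) + wt (n - m) ^ j * norm (b (n - m)))" for n
      proof -
        have "wt n \<le> wt m + wt (n - m)" by simp
        also have "\<dots> \<le> 2 * max (wt m) (wt (n - m))"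
        proof -
          have "x + y \<le> 2 * max x y" for x y :: real by (simp add: max_def)
          then show ?thesis .
        qed
        finally have "wt n \<le> 2 * max (wt m) (wt (n - m))" .
        then have "wt n ^ j \<le> (2 * max (wt m) (wt (n - m))) ^ j" by (intro power_mono) auto
        also have "\<dots> = 2 ^ j * max (wt m) (wt (n - m)) ^ j" by (simp add: power_mult_distrib)
        also have "max (wt m) (wt (n - m)) ^ j \<le> wt m ^ j + wt (n - m) ^ j"
          by (simp add: max_def)
        finally have "wt n ^ j \<le> 2 ^ j * (wt m ^ j + wt (n - m) ^ j)" by simp
        then have "wt n ^ j * norm (b (n - m)) \<le> 2 ^ j * (wt m ^ j + wt (n - m) ^ j) * norm (b (n - m))"
          by (rule mult_right_mono) simp
        then show ?thesis by (simp add: algebra_simps)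
      qed
      then have "(\<Sum>n\<in>F. wt n ^ j * norm (b (n - m))) \<le>
        (\<Sum>n\<in>F. 2 ^ j * (wt m ^ j * norm (b (n - m)) + wt (n - m) ^ j * norm (b (n - m))))"
        by (rule sum_mono)
      also have "\<dots> = 2 ^ j * (wt m ^ j * (\<Sum>n\<in>F. norm (b (n - m))) + (\<Sum>n\<in>F. wt (n - m) ^ j * norm (b (n - m))))"
        by (simp add: sum_distrib_left sum.distrib distrib_left)
      also have "(\<Sum>n\<in>F. norm (b (n - m))) = (\<Sum>l\<in>(\<lambda>n. n - m) ` F. wt l ^ 0 * norm (b l))"
        by (subst sum.reindex) (auto simp: inj_on_def)
      also have "(\<Sum>n\<in>F. wt (n - m) ^ j * norm (b (n - m))) = (\<Sum>l\<in>(\<lambda>n. n - m) ` F. wt l ^ j * norm (b l))"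
        by (subst sum.reindex) (auto simp: inj_on_def)
      finally have "(\<Sum>n\<in>F. wt n ^ j * norm (b (n - m))) \<le>
          2 ^ j * (wt m ^ j * (\<Sum>l\<in>(\<lambda>n. n - m) ` F. wt l ^ 0 * norm (b l)) + (\<Sum>l\<in>(\<lambda>n. n - m) ` F. wt l ^ j * norm (b l)))" .
      also have "\<dots> \<le> 2 ^ j * (wt m ^ j * wnorm 0 b + wnorm j b)"
        by (intro mult_left_mono add_mono sum_le_wnorm b) (use F in auto)
      finally show ?thesis .
    qed
    have s': "(\<lambda>m. wt n ^ j * (norm (a m) * norm (b (n - m)))) summable_on UNIV" for n
      by (intro summable_on_cmult_right s)
    have "(\<Sum>n\<in>F. wt n ^ j * norm (c n)) \<le> (\<Sum>n\<in>F. wt n ^ j * (\<Sum>\<^sub>\<infinity>m. norm (a m) * norm (b (n - m))))"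
      by (intro sum_mono mult_left_mono c) auto
    also have "\<dots> = (\<Sum>n\<in>F. \<Sum>\<^sub>\<infinity>m. wt n ^ j * (norm (a m) * norm (b (n - m))))"
      by (simp add: infsum_cmult_right')
    also have "\<dots> = (\<Sum>\<^sub>\<infinity>m. \<Sum>n\<in>F. wt n ^ j * (norm (a m) * norm (b (n - m))))"
      by (rule infsumI[symmetric]) (intro has_sum_finite_sum F has_sum_infsum summable_on_cmult_right s)
    also have "\<dots> \<le> (\<Sum>\<^sub>\<infinity>m. 2 ^ j * (wt m ^ j * norm (a m) * wnorm 0 b + norm (a m) * wnorm j b))"
    proof (rule infsum_mono)
      fix m
      have "(\<Sum>n\<in>F. wt n ^ j * (norm (a m) * norm (b (n - m)))) = norm (a m) * (\<Sum>n\<in>F. wt n ^ j * norm (b (n - m)))"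
        by (simp add: sum_distrib_left algebra_simps)
      also have "\<dots> \<le> norm (a m) * (2 ^ j * (wt m ^ j * wnorm 0 b + wnorm j b))"
        by (rule mult_left_mono[OF inner]) simp
      finally show "(\<Sum>n\<in>F. wt n ^ j * (norm (a m) * norm (b (n - m)))) \<le>
          2 ^ j * (wt m ^ j * norm (a m) * wnorm 0 b + norm (a m) * wnorm j b)"
        by (simp add: algebra_simps)
    qed (use rapidD[OF a] rapid_summable[OF a] in
        \<open>auto intro!: summable_on_cmult_right summable_on_add summable_on_cmult_left
          has_sum_imp_summable[OF has_sum_finite_sum[OF F has_sum_infsum[OF s']]]\<close>)
    also have "\<dots> = 2 ^ j * (wnorm j a * wnorm 0 b + wnorm 0 a * wnorm j b)"
      using rapidD[OF a] rapid_summable[OF a]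
      by (subst infsum_cmult_right', subst infsum_add)
        (auto intro!: summable_on_cmult_left simp: wnorm_def[of _ a] infsum_cmult_left')
    finally show ?thesis by (simp add: add.commute)
  qed
  show "rapid c" unfolding rapid_def using wnorm_leI(1)[OF *] by blast
  show "wnorm j c \<le> 2 ^ j * (wnorm 0 a * wnorm j b + wnorm j a * wnorm 0 b)" by (rule wnorm_leI(2)[OF *])
qed

section \<open>Fourier series in a coordinate of the circle\<close>

text \<open>These are the Fourier coefficients of \<open>f\<close> as a function of \<open>X\<close>, after the substitution
  \<open>dX = X' du\<close>.  Inverting \<open>X\<close> is avoided, which matters when \<open>X\<close> depends on time.\<close>

definition fourier_coeff :: "(real \<Rightarrow> real) \<Rightarrow> (real \<Rightarrow> real) \<Rightarrow> (real \<Rightarrow> complex) \<Rightarrow> int \<Rightarrow> complex" where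
  "fourier_coeff X X' f n =
     integral {0..1} (\<lambda>u. f u * cis (- (2 * pi * of_int n * X u)) * of_real (X' u))"

lemma difference_quotient_tendsto:
  assumes "(f has_vector_derivative d) (at x)"
  shows "((\<lambda>y. (f y - f x) /\<^sub>R (y - x)) \<longlongrightarrow> d) (at x)"
proof (rule LIM_zero_cancel, rule tendsto_norm_zero_cancel)
  have "((\<lambda>y. norm (f y - f x - (y - x) *\<^sub>R d) / norm (y - x)) \<longlongrightarrow> 0) (at x)"
    using assms unfolding has_vector_derivative_def has_derivative_iff_norm by simp
  moreover have "\<forall>\<^sub>F y in at x. norm (f y - f x - (y - x) *\<^sub>R d) / norm (y - x) = norm ((f y - f x) /\<^sub>R (y - x) - d)"
    unfolding eventually_at_filter
  proof (rule always_eventually, intro allI impI)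
    fix y assume "y \<noteq> x"
    then have "(f y - f x) /\<^sub>R (y - x) - d = (f y - f x - (y - x) *\<^sub>R d) /\<^sub>R (y - x)"
      by (simp add: scaleR_diff_right)
    then show "norm (f y - f x - (y - x) *\<^sub>R d) / norm (y - x) = norm ((f y - f x) /\<^sub>R (y - x) - d)"
      by (simp add: divide_inverse mult.commute)
  qed
  ultimately show "((\<lambda>y. norm ((f y - f x) /\<^sub>R (y - x) - d)) \<longlongrightarrow> 0) (at x)"
    by (rule Lim_transform_eventually)
qed

text \<open>\<open>X\<close> lifts an orientation preserving diffeomorphism of the circle.\<close>

locale circle_coordinate =
  fixes X X' :: "real \<Rightarrow> real"
  assumes X_deriv: "(X has_real_derivative X' u) (at u)"
    and X'_cont: "continuous_on UNIV X'"
    and X'_pos: "X' u > 0"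
    and X_period: "X (u + 1) = X u + 1"
begin

abbreviation "fc \<equiv> fourier_coeff X X'"
abbreviation "chr n u \<equiv> cis (2 * pi * real_of_int n * X u)"

lemma X_cont: "continuous_on A X"
  using X_deriv by (meson DERIV_continuous continuous_at_imp_continuous_on)

lemma X'_cont': "continuous_on A X'"
  using X'_cont by (rule continuous_on_subset) simp

lemma X_strict_mono: "strict_mono X"
  by (rule strict_monoI) (rule DERIV_pos_imp_increasing, auto intro!: X_deriv X'_pos)

lemma cis_X_derivative:
  "((\<lambda>u. cis (c * X u)) has_vector_derivative (\<i> * of_real (c * X' u)) * cis (c * X u)) (at u)"
proof -
  have "((\<lambda>u. c * X u) has_derivative (\<lambda>h. h * (c * X' u))) (at u)"
    using X_deriv[of u] by (auto intro!: derivative_eq_intros simp: has_field_derivative_def)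
  from has_derivative_cis[OF this] show ?thesis
    unfolding has_vector_derivative_def by (rule has_derivative_eq_rhs) (auto simp: fun_eq_iff scaleR_conv_of_real)
qed

lemma cis_X_cont: "continuous_on A (\<lambda>u. cis (c * X u))"
  by (intro continuous_at_imp_continuous_on ballI) (rule has_vector_derivative_continuous[OF cis_X_derivative])

lemma chr_mult: "chr n u * chr m u = chr (n + m) u"
  by (simp add: cis_mult algebra_simps)

lemma chr_period: "chr n (u + 1) = chr n u"
proof -
  have "2 * pi * of_int n * X (u + 1) = 2 * pi * of_int n * X u + 2 * pi * of_int n"
    unfolding X_period by (simp add: algebra_simps)
  then have "chr n (u + 1) = chr n u * cis (2 * pi * of_int n)"
    by (simp only: cis_mult)
  then show ?thesis by (simp add: cis_multiple_2pi)
qed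

lemma fc_def': "fc f n = integral {0..1} (\<lambda>u. f u * chr (- n) u * of_real (X' u))"
  by (simp add: fourier_coeff_def)

lemma fc_integrand_cont:
  "continuous_on {0..1} f \<Longrightarrow> continuous_on {0..1} (\<lambda>u. f u * chr n u * of_real (X' u))"
  by (intro continuous_intros cis_X_cont X'_cont')

lemma fc_integrable:
  "continuous_on {0..1} f \<Longrightarrow> (\<lambda>u. f u * chr n u * of_real (X' u)) integrable_on {0..1}"
  by (rule integrable_continuous_real[OF fc_integrand_cont])

text \<open>Integration by parts over one period; the weight \<open>X'\<close> turns \<open>f' / X'\<close>, the derivative with
  respect to \<open>X\<close>, into \<open>f'\<close>.\<close>

lemma fc_derivative:
  assumes f: "\<And>u. (f has_vector_derivative f' u) (at u)" and f': "continuous_on {0..1} f'"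
    and per: "f 1 = f 0"
  shows "fc (\<lambda>u. f' u / of_real (X' u)) n = 2 * pi * \<i> * of_int n * fc f n"
proof -
  have fcont: "continuous_on {0..1} f"
    by (meson continuous_at_imp_continuous_on f has_vector_derivative_continuous)
  define G where "G u = f u * chr (- n) u" for u
  have "(G has_vector_derivative f u * ((\<i> * of_real (2 * pi * of_int (- n) * X' u)) * chr (- n) u) + f' u * chr (- n) u) (at u within {0..1})" for u
    unfolding G_def 
    by (rule has_vector_derivative_at_within, rule has_vector_derivative_mult[OF f cis_X_derivative])
  from fundamental_theorem_of_calculus[OF zero_le_one this]
  have "((\<lambda>u. f u * ((\<i> * of_real (2 * pi * of_int (- n) * X' u)) * chr (- n) u) + f' u * chr (- n) u) has_integral G 1 - G 0) {0..1}"
    by simp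
  moreover have "G 1 - G 0 = 0"
    using chr_period[of "- n" 0] per by (simp add: G_def)
  ultimately have 0: "integral {0..1} (\<lambda>u. f u * ((\<i> * of_real (2 * pi * of_int (- n) * X' u)) * chr (- n) u) + f' u * chr (- n) u) = 0"
    by (simp add: integral_unique)
  have i1: "(\<lambda>u. f u * ((\<i> * of_real (2 * pi * of_int (- n) * X' u)) * chr (- n) u)) integrable_on {0..1}"
    by (intro integrable_continuous_real continuous_intros fcont cis_X_cont X'_cont')
  have i2: "(\<lambda>u. f' u * chr (- n) u) integrable_on {0..1}"
    by (intro integrable_continuous_real continuous_intros f' cis_X_cont)
  have "fc (\<lambda>u. f' u / of_real (X' u)) n = integral {0..1} (\<lambda>u. f' u * chr (- n) u)"
    unfolding fc_def' by (rule integral_cong) (use X'_pos in \<open>auto simp: field_simps less_imp_neq[OF X'_pos, symmetric]\<close>)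
  also have "\<dots> = - integral {0..1} (\<lambda>u. f u * ((\<i> * of_real (2 * pi * of_int (- n) * X' u)) * chr (- n) u))"
    using 0 integral_add[OF i1 i2] by (simp add: add_eq_0_iff)
  also have "\<dots> = - integral {0..1} (\<lambda>u. - (2 * pi * \<i> * of_int n) * (f u * chr (- n) u * of_real (X' u)))"
    by (intro arg_cong[of _ _ uminus] integral_cong) (simp add: algebra_simps)
  also have "\<dots> = 2 * pi * \<i> * of_int n * fc f n"
    by (simp add: fc_def' integral_mult_right)
  finally show ?thesis .
qed

lemma fc_add:
  assumes "continuous_on {0..1} f" "continuous_on {0..1} g"
  shows "fc (\<lambda>u. f u + g u) n = fc f n + fc g n"
  unfolding fc_def' using integral_add[OF fc_integrable[OF assms(1), of "- n"] fc_integrable[OF assms(2), of "- n"]]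
  by (simp only: distrib_right)

lemma fc_cmult: "fc (\<lambda>u. c * f u) n = c * fc f n"
proof -
  have "fc (\<lambda>u. c * f u) n = integral {0..1} (\<lambda>u. c * (f u * chr (- n) u * of_real (X' u)))"
    unfolding fc_def' by (simp add: mult.assoc)
  then show ?thesis by (simp add: fc_def' integral_mult_right)
qed

lemma fc_minus: "fc (\<lambda>u. - f u) n = - fc f n"
  using fc_cmult[of "-1" f n] by simp

lemma fc_diff:
  assumes "continuous_on {0..1} f" "continuous_on {0..1} g"
  shows "fc (\<lambda>u. f u - g u) n = fc f n - fc g n"
  using fc_add[of f "\<lambda>u. - g u" n] assms by (simp add: fc_minus continuous_on_minus)

lemma fc_sum:
  assumes "finite F" "\<And>m. m \<in> F \<Longrightarrow> continuous_on {0..1} (f m)"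
  shows "fc (\<lambda>u. \<Sum>m\<in>F. f m u) n = (\<Sum>m\<in>F. fc (f m) n)"
  using assms
proof (induction F rule: finite_induct)
  case empty then show ?case by (simp add: fc_def')
next
  case (insert m F)
  then show ?case using fc_add[of "f m" "\<lambda>u. \<Sum>m\<in>F. f m u" n] by (simp add: continuous_on_sum)
qed

lemma fc_shift: "fc (\<lambda>u. f u * chr m u) n = fc f (n - m)"
  unfolding fc_def' using chr_mult[of m _ "- n"] by (simp add: mult.assoc)

lemma integral_X': "(X' has_integral 1) {0..1}"
proof -
  have "(X' has_integral X 1 - X 0) {0..1}"
    using X_deriv has_real_derivative_iff_has_vector_derivative
    by (intro fundamental_theorem_of_calculus) (auto intro: has_vector_derivative_at_within)
  then show ?thesis using X_period[of 0] by simp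
qed

lemma fc_const: "fc (\<lambda>u. c) n = (if n = 0 then c else 0)"
proof (cases "n = 0")
  case True
  have "((\<lambda>u. of_real (X' u) :: complex) has_integral of_real 1) {0..1}"
    using has_integral_linear[OF integral_X' bounded_linear_of_real] by (simp add: o_def)
  from integral_unique[OF this] show ?thesis using True
    by (simp add: fc_def')
next
  case False
  have "fc (\<lambda>u. 0 / of_real (X' u)) n = 2 * pi * \<i> * of_int n * fc (\<lambda>u. c) n"
    by (rule fc_derivative) auto
  with False show ?thesis by (simp add: fc_def')
qed

lemma fc_norm_le_integral:
  assumes f: "continuous_on {0..1} f"
  shows "norm (fc f n) \<le> integral {0..1} (\<lambda>u. norm (f u) * X' u)"
  unfolding fc_def'
  by (rule integral_norm_bound_integral)
    (use f X'_pos in \<open>auto intro!: integrable_continuous_real continuous_intros X'_cont' X_cont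
       simp: norm_mult less_imp_le\<close>)

lemma fc_norm_le:
  assumes f: "continuous_on {0..1} f" and B: "\<And>u. u \<in> {0..1} \<Longrightarrow> norm (f u) \<le> B"
  shows "norm (fc f n) \<le> B"
proof -
  have "norm (fc f n) \<le> integral {0..1} (\<lambda>u. norm (f u) * X' u)" by (rule fc_norm_le_integral[OF f])
  also have "\<dots> \<le> integral {0..1} (\<lambda>u. B * X' u)"
    by (rule integral_le)
      (use f B X'_pos in \<open>auto intro!: integrable_continuous_real continuous_intros X'_cont' mult_right_mono less_imp_le\<close>)
  also have "\<dots> = B" using integral_unique[OF integral_X'] by (simp add: integral_mult_right)
  finally show ?thesis .
qed

text \<open>The integral of \<open>norm (f - S)\<^sup>2 X'\<close> is nonnegative for the partial sum \<open>S\<close> over \<open>F\<close>; by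
  orthonormality of the characters it is the difference of the two sides.\<close>

lemma bessel:
  assumes f: "continuous_on {0..1} f" and F: "finite F"
  shows "(\<Sum>n\<in>F. (norm (fc f n))\<^sup>2) \<le> integral {0..1} (\<lambda>u. (norm (f u))\<^sup>2 * X' u)"
proof -
  define S where "S u = (\<Sum>n\<in>F. fc f n * chr n u)" for u
  have S_cont: "continuous_on {0..1} S" unfolding S_def by (intro continuous_intros cis_X_cont)
  define J where "J h = fc h 0" for h
  have J: "J h = integral {0..1} (\<lambda>u. h u * of_real (X' u))" for h
    by (simp add: J_def fc_def')
  have fS: "J (\<lambda>u. f u * cnj (S u)) = of_real (\<Sum>n\<in>F. (norm (fc f n))\<^sup>2)"
  proof -
    have "J (\<lambda>u. f u * cnj (S u)) = J (\<lambda>u. \<Sum>n\<in>F. cnj (fc f n) * (f u * chr (- n) u))"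
      unfolding S_def by (simp add: sum_distrib_left cis_cnj algebra_simps)
    also have "\<dots> = (\<Sum>n\<in>F. cnj (fc f n) * J (\<lambda>u. f u * chr (- n) u))"
      unfolding J_def by (subst fc_sum[OF F]) (auto simp: fc_cmult simp del: of_int_minus intro!: continuous_intros f cis_X_cont)
    also have "\<dots> = (\<Sum>n\<in>F. cnj (fc f n) * fc f n)"
      unfolding J_def by (subst fc_shift) simp
    also have "\<dots> = of_real (\<Sum>n\<in>F. (norm (fc f n))\<^sup>2)"
      unfolding of_real_sum complex_norm_square by (simp add: mult.commute)
    finally show ?thesis .
  qed
  have SS: "J (\<lambda>u. S u * cnj (S u)) = of_real (\<Sum>n\<in>F. (norm (fc f n))\<^sup>2)"
  proof -
    have c: "fc S m = (if m \<in> F then fc f m else 0)" for m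
    proof -
      have "fc S m = (\<Sum>n\<in>F. fc f n * fc (\<lambda>u. 1 * chr n u) m)"
        unfolding S_def by (subst fc_sum[OF F]) (auto simp: fc_cmult intro!: continuous_intros cis_X_cont)
      also have "\<dots> = (\<Sum>n\<in>F. fc f n * (if m - n = 0 then 1 else 0))"
        by (simp only: fc_shift fc_const)
      also have "\<dots> = (\<Sum>n\<in>F. if m = n then fc f n else 0)" by (intro sum.cong) auto
      finally show ?thesis using F by simp
    qed
    have "J (\<lambda>u. S u * cnj (S u)) = J (\<lambda>u. \<Sum>n\<in>F. cnj (fc f n) * (S u * chr (- n) u))"
      by (subst (2) S_def) (simp add: sum_distrib_left cis_cnj algebra_simps)
    also have "\<dots> = (\<Sum>n\<in>F. cnj (fc f n) * J (\<lambda>u. S u * chr (- n) u))"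
      unfolding J_def by (subst fc_sum[OF F]) (auto simp: fc_cmult simp del: of_int_minus intro!: continuous_intros S_cont cis_X_cont)
    also have "\<dots> = (\<Sum>n\<in>F. cnj (fc f n) * fc S n)"
      unfolding J_def by (subst fc_shift) simp
    also have "\<dots> = of_real (\<Sum>n\<in>F. (norm (fc f n))\<^sup>2)"
      unfolding of_real_sum complex_norm_square by (simp add: c mult.commute)
    finally show ?thesis .
  qed
  have Sf: "J (\<lambda>u. cnj (f u) * S u) = of_real (\<Sum>n\<in>F. (norm (fc f n))\<^sup>2)"
  proof -
    have "J (\<lambda>u. cnj (f u) * S u) = cnj (J (\<lambda>u. f u * cnj (S u)))"
      unfolding J integral_cnj by simp
    then show ?thesis by (simp add: fS del: of_real_sum)
  qed
  have J_real: "J (\<lambda>u. of_real (h u)) = of_real (integral {0..1} (\<lambda>u. h u * X' u))"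
    if "continuous_on {0..1} h" for h
    unfolding J using integral_linear[OF integrable_continuous_real[OF continuous_on_mult[OF that X'_cont']] bounded_linear_of_real]
    by (simp add: o_def)
  have 0: "0 \<le> integral {0..1} (\<lambda>u. (norm (f u - S u))\<^sup>2 * X' u)" (is "_ \<le> ?I")
    by (rule integral_nonneg) (use X'_pos in \<open>auto intro!: integrable_continuous_real continuous_intros f S_cont X'_cont' mult_nonneg_nonneg less_imp_le[OF X'_pos]\<close>)
  have "complex_of_real ?I = J (\<lambda>u. of_real ((norm (f u - S u))\<^sup>2))"
    by (rule J_real[symmetric]) (intro continuous_intros f S_cont)
  also have "\<dots> = J (\<lambda>u. of_real ((norm (f u))\<^sup>2) - f u * cnj (S u) - (cnj (f u) * S u - S u * cnj (S u)))"
    by (intro arg_cong[of _ _ J] ext) (simp only: complex_norm_square, simp add: algebra_simps)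
  also have "\<dots> = J (\<lambda>u. of_real ((norm (f u))\<^sup>2)) - J (\<lambda>u. f u * cnj (S u)) - (J (\<lambda>u. cnj (f u) * S u) - J (\<lambda>u. S u * cnj (S u)))"
    unfolding J_def by (simp only: fc_diff continuous_on_diff continuous_on_mult continuous_on_cnj f S_cont continuous_on_of_real continuous_on_power continuous_on_norm)
  also have "\<dots> = of_real (integral {0..1} (\<lambda>u. (norm (f u))\<^sup>2 * X' u) - (\<Sum>n\<in>F. (norm (fc f n))\<^sup>2))"
    by (subst J_real) (auto simp: fS SS Sf simp del: of_real_sum intro!: continuous_intros f)
  finally have "?I = integral {0..1} (\<lambda>u. (norm (f u))\<^sup>2 * X' u) - (\<Sum>n\<in>F. (norm (fc f n))\<^sup>2)"
    by (simp only: of_real_eq_iff)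
  with 0 show ?thesis by simp
qed

lemma fc_tendsto_0:
  assumes f: "continuous_on {0..1} f"
  shows "(\<lambda>N. fc f (int N)) \<longlonglongrightarrow> 0" "(\<lambda>N. fc f (- int N)) \<longlonglongrightarrow> 0"
proof -
  have "(\<lambda>N. fc f (s * int N)) \<longlonglongrightarrow> 0" if s: "s \<noteq> 0" for s
  proof -
    let ?I = "integral {0..1} (\<lambda>u. (norm (f u))\<^sup>2 * X' u)"
    have "summable (\<lambda>N. (norm (fc f (s * int N)))\<^sup>2)"
    proof (rule bounded_imp_summable)
      fix N
      have "(\<Sum>k\<le>N. (norm (fc f (s * int k)))\<^sup>2) = (\<Sum>n\<in>(\<lambda>k. s * int k) ` {..N}. (norm (fc f n))\<^sup>2)"
        by (subst sum.reindex) (auto simp: inj_on_def s)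
      also have "\<dots> \<le> ?I" by (rule bessel[OF f]) simp
      finally show "(\<Sum>k\<le>N. (norm (fc f (s * int k)))\<^sup>2) \<le> ?I" .
    qed simp
    then have "(\<lambda>N. (norm (fc f (s * int N)))\<^sup>2) \<longlonglongrightarrow> 0" by (rule summable_LIMSEQ_zero)
    then have "(\<lambda>N. sqrt ((norm (fc f (s * int N)))\<^sup>2)) \<longlonglongrightarrow> sqrt 0" by (rule tendsto_real_sqrt)
    then show ?thesis by (simp add: tendsto_norm_zero_iff)
  qed
  from this[of 1] this[of "-1"] show "(\<lambda>N. fc f (int N)) \<longlonglongrightarrow> 0" "(\<lambda>N. fc f (- int N)) \<longlonglongrightarrow> 0"
    by simp_all
qed

text \<open>Chernoff's argument: division of \<open>f - f(p)\<close> by \<open>e(X - X(p)) - 1\<close>, where \<open>e(y) = cis (2 \<pi> y)\<close>, turns the partial sums at \<open>p\<close> into a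
  telescoping sum, whose two end terms tend to 0 by Bessel's inequality.\<close>

lemma fourier_inversion_limit:
  assumes f: "\<And>u. (f has_vector_derivative f' u) (at u)" and f': "continuous_on UNIV f'"
    and per: "\<And>u. f (u + 1) = f u"
  shows "(\<lambda>N. \<Sum>n\<in>{-int N..int N}. fc f n * chr n p) \<longlonglongrightarrow> f p"
proof -
  have fc0: "continuous_on A f" for A
    by (meson continuous_at_imp_continuous_on f has_vector_derivative_continuous)
  define q where "q = cis (2 * pi * X p)"
  have q: "q \<noteq> 0" "norm q = 1" by (simp_all add: q_def)
  define e where "e u = cis (2 * pi * X u)" for u
  have e': "(e has_vector_derivative 2 * pi * \<i> * X' u * e u) (at u)" for u
    using cis_X_derivative[of "2 * pi" u] unfolding e_def[abs_def] by (simp add: mult_ac)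
  have e_cont: "continuous_on A e" for A unfolding e_def[abs_def] by (rule cis_X_cont)
  have e0: "e u \<noteq> 0" for u by (simp add: e_def)
  have f_int: "f (u + of_int k) = f u" for u k
  proof (induction k rule: int_induct[of _ 0])
    case base then show ?case by simp
  next
    case (step1 i) then show ?case using per[of "u + of_int i"] by (simp add: add.assoc)
  next
    case (step2 i) then show ?case using per[of "u + of_int (i - 1)"] by (simp add: algebra_simps)
  qed
  have X_int: "X (u + of_int k) = X u + of_int k" for u k
  proof (induction k rule: int_induct[of _ 0])
    case base then show ?case by simp
  next
    case (step1 i) then show ?case using X_period[of "u + of_int i"] by (simp add: add.assoc)
  next
    case (step2 i) then show ?case using X_period[of "u + of_int (i - 1)"] by (simp add: algebra_simps)
  qed
  have e_eq: "f u = f p" if "e u = q" for u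
  proof -
    have "cis (2 * pi * X u) = cis (2 * pi * X p)" using that by (simp add: e_def q_def)
    then obtain k :: int where "2 * pi * X u = 2 * pi * X p + 2 * pi * of_int k"
      using complex_eq_iff sin_cos_eq_iff by (metis cis.simps mult.commute)
    then have "X u = X p + of_int k" using pi_neq_zero by (simp add: distrib_left[symmetric] del: distrib_left)
    then have "X u = X (p + of_int k)" by (simp add: X_int)
    then have "u = p + of_int k" using X_strict_mono strict_mono_eq by blast
    then show ?thesis by (simp add: f_int)
  qed
  define g where "g u = (if e u = q then f' u / (2 * pi * \<i> * X' u) else (f u - f p) / (e u / q - 1))" for u
  have g_cont: "continuous_on {0..1} g"
  proof (rule continuous_at_imp_continuous_on, rule ballI)
    fix w :: real
    show "isCont g w"
    proof (cases "e w = q")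
      case False
      have "open (- {u. e u = q})" 
        using continuous_closed_preimage_constant[OF e_cont closed_UNIV, of q] by (simp add: open_closed)
      then have ev: "\<forall>\<^sub>F u in nhds w. e u \<noteq> q" using False by (intro eventually_nhds_in_open[of "- {u. e u = q}", simplified]) auto
      have "isCont (\<lambda>u. (f u - f p) / (e u / q - 1)) w"
        using False q fc0[of UNIV] e_cont[of UNIV] by (intro continuous_intros) (auto simp: continuous_on_eq_continuous_at)
      then show ?thesis
        by (rule isCont_cong[THEN iffD1, rotated]) (use ev in eventually_elim, simp add: g_def)
    next
      case True
      have eq: "((\<lambda>u. (e u - e w) /\<^sub>R (u - w)) \<longlongrightarrow> 2 * pi * \<i> * X' w * e w) (at w)"
        using difference_quotient_tendsto[OF e'[of w]] .
      have fq: "((\<lambda>u. (f u - f w) /\<^sub>R (u - w)) \<longlongrightarrow> f' w) (at w)"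
        using difference_quotient_tendsto[OF f[of w]] .
      have nz: "2 * pi * \<i> * X' w * e w \<noteq> 0" using X'_pos[of w] e0[of w] by simp
      have "((\<lambda>u. ((f u - f w) /\<^sub>R (u - w)) / (((e u - e w) /\<^sub>R (u - w)) / q)) \<longlongrightarrow>
          f' w / ((2 * pi * \<i> * X' w * e w) / q)) (at w)"
        by (intro tendsto_divide fq eq tendsto_const) (use nz q in auto)
      moreover have "\<forall>\<^sub>F u in at w. ((f u - f w) /\<^sub>R (u - w)) / (((e u - e w) /\<^sub>R (u - w)) / q) = g u"
        using tendsto_imp_eventually_ne[OF eq nz]
      proof eventually_elim
        case (elim u)
        then have "e u \<noteq> q" "u \<noteq> w" using True by auto
        have canc: "(r *\<^sub>R A) / ((r *\<^sub>R E) / q) = A / (E / q)" if "r \<noteq> 0" for r :: real and A E :: complex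
          using that by (simp add: scaleR_conv_of_real)
        have "(e u - e w) / q = e u / q - 1" using True q by (simp add: diff_divide_distrib)
        moreover have "inverse (u - w) \<noteq> 0" using \<open>u \<noteq> w\<close> by simp
        ultimately show ?case using \<open>e u \<noteq> q\<close> e_eq[OF True] by (simp add: g_def canc[OF \<open>inverse (u - w) \<noteq> 0\<close>] del: divide_divide_eq_right)
      qed
      ultimately have "(g \<longlongrightarrow> f' w / ((2 * pi * \<i> * X' w * e w) / q)) (at w)"
        by (rule Lim_transform_eventually)
      moreover have "f' w / ((2 * pi * \<i> * X' w * e w) / q) = g w"
        using True q by (simp add: g_def)
      ultimately show ?thesis by (simp add: isCont_def)
    qed
  qed
  have fg: "f u - f p = g u * e u * inverse q - g u" for u
    using e_eq[of u] q by (auto simp: g_def field_simps)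
  have e1: "e u = chr 1 u" for u by (simp add: e_def)
  have rec: "fc f n = (if n = 0 then f p else 0) + inverse q * fc g (n - 1) - fc g n" for n
  proof -
    have "fc (\<lambda>u. f u - f p) n = fc (\<lambda>u. inverse q * (g u * chr 1 u) - g u) n"
      unfolding fg e1 by (simp only: mult_ac)
    also have "\<dots> = inverse q * fc g (n - 1) - fc g n"
      by (subst fc_diff) (auto simp: fc_cmult fc_shift[symmetric] intro!: continuous_intros g_cont X_cont)
    finally show ?thesis
      by (subst (asm) fc_diff) (auto simp: fc_const fc0 algebra_simps)
  qed
  define G where "G n = fc g n * chr n p" for n
  have qc: "inverse q * chr n p = chr (n - 1) p" for n
    using chr_mult[of n p "-1"] by (simp add: q_def cis_inverse[symmetric] mult.commute del: cis_inverse)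
  have step: "fc f n * chr n p = (if n = 0 then f p else 0) + G (n - 1) - G n" for n
  proof -
    have "fc f n * chr n p = (if n = 0 then f p else 0) * chr n p + fc g (n - 1) * (inverse q * chr n p) - fc g n * chr n p"
      unfolding rec[of n] by (simp add: algebra_simps)
    then show ?thesis unfolding qc G_def by simp
  qed
  have tel: "(\<Sum>n\<in>{-int N..int N}. fc f n * chr n p) = f p + G (- int (Suc N)) - G (int N)" for N
  proof (induction N)
    case 0 then show ?case using step[of 0] by simp
  next
    case (Suc N)
    have "{-int (Suc N)..int (Suc N)} = insert (- int (Suc N)) (insert (int (Suc N)) {-int N..int N})" by auto
    then have "(\<Sum>n\<in>{-int (Suc N)..int (Suc N)}. fc f n * chr n p) =
       fc f (- int (Suc N)) * chr (- int (Suc N)) p + (fc f (int (Suc N)) * chr (int (Suc N)) p + (\<Sum>n\<in>{-int N..int N}. fc f n * chr n p))"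
      by (simp del: of_nat_Suc)
    also have "\<dots> = f p + G (- int (Suc (Suc N))) - G (int (Suc N))"
      unfolding Suc.IH unfolding step by simp
    finally show ?case .
  qed
  have nG: "norm (G n) = norm (fc g n)" for n by (simp add: G_def norm_mult)
  have Glim: "(\<lambda>N. G (int N)) \<longlonglongrightarrow> 0" "(\<lambda>N. G (- int N)) \<longlonglongrightarrow> 0"
    by (rule tendsto_norm_zero_cancel, simp only: nG, rule tendsto_norm_zero, rule fc_tendsto_0[OF g_cont])+
  have "(\<lambda>N. f p + G (- int (Suc N)) - G (int N)) \<longlonglongrightarrow> f p + 0 - 0"
    by (intro tendsto_intros Glim LIMSEQ_Suc[OF Glim(2)])
  then show ?thesis by (simp add: tel)
qed

text \<open>The difference of two partial sums is bounded by the corresponding coefficients; then the longer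
  of the two sums tends to \<open>f p\<close>.\<close>

lemma fourier_partial_sum_error:
  assumes f: "\<And>u. (f has_vector_derivative f' u) (at u)" and f': "continuous_on UNIV f'"
    and per: "\<And>u. f (u + 1) = f u" and s: "(\<lambda>n. norm (fc f n)) summable_on UNIV"
  shows "norm (f p - (\<Sum>n\<in>{-int N..int N}. fc f n * chr n p)) \<le>
    (\<Sum>\<^sub>\<infinity>n. norm (fc f n)) - (\<Sum>n\<in>{-int N..int N}. norm (fc f n))"
proof (rule tendsto_upperbound)
  let ?S = "\<lambda>M. \<Sum>n\<in>{-int M..int M}. fc f n * chr n p"
  show "(\<lambda>M. norm (?S M - ?S N)) \<longlonglongrightarrow> norm (f p - ?S N)"
    by (intro tendsto_intros fourier_inversion_limit[OF f f' per])
  show "\<forall>\<^sub>F M in sequentially. norm (?S M - ?S N) \<le>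
      (\<Sum>\<^sub>\<infinity>n. norm (fc f n)) - (\<Sum>n\<in>{-int N..int N}. norm (fc f n))"
    using eventually_ge_at_top[of N]
  proof eventually_elim
    case (elim M)
    have sub: "{-int N..int N} \<subseteq> {-int M..int M}" using elim by auto
    have "?S M - ?S N = (\<Sum>n\<in>{-int M..int M} - {-int N..int N}. fc f n * chr n p)"
      using sub by (simp add: sum_diff)
    also have "norm \<dots> \<le> (\<Sum>n\<in>{-int M..int M} - {-int N..int N}. norm (fc f n))"
      by (rule order_trans[OF norm_sum]) (simp add: norm_mult)
    also have "\<dots> = (\<Sum>n\<in>{-int M..int M}. norm (fc f n)) - (\<Sum>n\<in>{-int N..int N}. norm (fc f n))"
      using sub by (simp add: sum_diff)
    also have "(\<Sum>n\<in>{-int M..int M}. norm (fc f n)) \<le> (\<Sum>\<^sub>\<infinity>n. norm (fc f n))"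
      by (rule finite_sum_le_infsum) (use s in auto)
    finally show ?case by simp
  qed
qed simp

lemma norm_le_wnorm_0:
  assumes f: "\<And>u. (f has_vector_derivative f' u) (at u)" and f': "continuous_on UNIV f'"
    and per: "\<And>u. f (u + 1) = f u" and s: "(\<lambda>n. norm (fc f n)) summable_on UNIV"
  shows "norm (f p) \<le> wnorm 0 (fc f)"
proof -
  have "norm (f p) \<le> norm (f p - (\<Sum>n\<in>{-int 0..int 0}. fc f n * chr n p)) + norm (\<Sum>n\<in>{-int 0..int 0}. fc f n * chr n p)"
    using norm_triangle_sub[of "f p" "\<Sum>n\<in>{-int 0..int 0}. fc f n * chr n p"] by (simp add: add.commute)
  also have "\<dots> \<le> wnorm 0 (fc f)"
    using fourier_partial_sum_error[OF assms, of p 0] by (simp add: wnorm_0)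
  finally show ?thesis .
qed

text \<open>For a trigonometric polynomial in place of \<open>f\<close> the coefficients of the product are given by the
  convolution exactly, and partial sums approximate \<open>f\<close> uniformly.\<close>

lemma fc_mult_bound:
  assumes f: "\<And>u. (f has_vector_derivative f' u) (at u)" and f': "continuous_on UNIV f'"
    and per: "\<And>u. f (u + 1) = f u" and rf: "rapid (fc f)" and rg: "rapid (fc g)"
    and g: "continuous_on {0..1} g"
  shows "norm (fc (\<lambda>u. f u * g u) n) \<le> (\<Sum>\<^sub>\<infinity>m. norm (fc f m) * norm (fc g (n - m)))"
proof (rule field_le_epsilon)
  fix e :: real assume e: "e > 0"
  have fcont: "continuous_on A f" for A
    by (meson continuous_at_imp_continuous_on f has_vector_derivative_continuous)
  obtain B where B: "B > 0" "\<And>u. u \<in> {0..1} \<Longrightarrow> norm (g u) \<le> B"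
  proof -
    have "compact (g ` {0..1})" by (rule compact_continuous_image[OF g]) simp
    then obtain B where "\<forall>y\<in>g ` {0..1}. norm y \<le> B" using compact_imp_bounded bounded_iff by blast
    then show ?thesis by (intro that[of "max B 1"]) (auto simp: le_max_iff_disj)
  qed
  have "e / B > 0" using e B by simp
  obtain F where F: "finite F" "dist (\<Sum>n\<in>F. norm (fc f n)) (\<Sum>\<^sub>\<infinity>n. norm (fc f n)) \<le> e / B"
    using infsum_finite_approximation[OF rapid_summable[OF rf] \<open>e / B > 0\<close>] by blast
  obtain N where N: "F \<subseteq> {-int N..int N}" by (rule finite_int_subset_Icc[OF F(1)])
  let ?I = "{-int N..int N}"
  define P where "P u = (\<Sum>m\<in>?I. fc f m * chr m u)" for u
  have Pcont: "continuous_on A P" for A unfolding P_def[abs_def] by (intro continuous_intros X_cont)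
  have "(\<Sum>n\<in>F. norm (fc f n)) \<le> (\<Sum>n\<in>?I. norm (fc f n))" by (rule sum_mono2) (use N in auto)
  with F(2) have tail: "(\<Sum>\<^sub>\<infinity>n. norm (fc f n)) - (\<Sum>n\<in>?I. norm (fc f n)) \<le> e / B"
    by (simp add: dist_real_def)
  have err: "norm (f u - P u) \<le> e / B" for u
    using fourier_partial_sum_error[OF f f' per rapid_summable[OF rf], of u N] tail unfolding P_def by linarith
  have s: "(\<lambda>m. norm (fc f m) * norm (fc g (n - m))) summable_on UNIV"
    using term_le_wnorm[OF rg, of _ 0] 
    by (intro summable_on_comparison_test[OF summable_on_cmult_left[OF rapid_summable[OF rf], of "wnorm 0 (fc g)"]])
       (auto intro: mult_left_mono)
  have "fc (\<lambda>u. f u * g u) n = fc (\<lambda>u. (f u - P u) * g u + P u * g u) n" by (simp add: algebra_simps)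
  also have "\<dots> = fc (\<lambda>u. (f u - P u) * g u) n + fc (\<lambda>u. P u * g u) n"
    by (intro fc_add continuous_intros fcont g Pcont)
  also have "fc (\<lambda>u. P u * g u) n = fc (\<lambda>u. \<Sum>m\<in>?I. fc f m * (g u * chr m u)) n"
    unfolding P_def sum_distrib_right by (simp only: mult_ac)
  also have "\<dots> = (\<Sum>m\<in>?I. fc f m * fc g (n - m))"
    by (subst fc_sum) (auto simp: fc_cmult fc_shift intro!: continuous_intros g X_cont)
  finally have eq: "fc (\<lambda>u. f u * g u) n = fc (\<lambda>u. (f u - P u) * g u) n + (\<Sum>m\<in>?I. fc f m * fc g (n - m))" .
  have "norm (fc (\<lambda>u. (f u - P u) * g u) n) \<le> e"
  proof (rule fc_norm_le)
    show "continuous_on {0..1} (\<lambda>u. (f u - P u) * g u)" by (intro continuous_intros fcont g Pcont)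
    fix u :: real assume "u \<in> {0..1}"
    then have "norm ((f u - P u) * g u) \<le> e / B * B"
      unfolding norm_mult using err B e by (intro mult_mono) auto
    then show "norm ((f u - P u) * g u) \<le> e" using B by simp
  qed
  moreover have "norm (\<Sum>m\<in>?I. fc f m * fc g (n - m)) \<le> (\<Sum>m\<in>?I. norm (fc f m) * norm (fc g (n - m)))"
    by (rule order_trans[OF norm_sum]) (simp add: norm_mult)
  moreover have "\<dots> \<le> (\<Sum>\<^sub>\<infinity>m. norm (fc f m) * norm (fc g (n - m)))"
    by (rule finite_sum_le_infsum) (use s in auto)
  ultimately show "norm (fc (\<lambda>u. f u * g u) n) \<le> (\<Sum>\<^sub>\<infinity>m. norm (fc f m) * norm (fc g (n - m))) + e"
    unfolding eq using norm_triangle_ineq[of "fc (\<lambda>u. (f u - P u) * g u) n" "\<Sum>m\<in>?I. fc f m * fc g (n - m)"] by linarith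
qed

end

section \<open>The quasilinear operator in the Wiener algebra\<close>

lemma periodic_deriv:
  fixes f f' :: "real \<Rightarrow> 'a::real_normed_vector"
  assumes per: "\<And>u. f (u + 1) = f u + d" and f: "\<And>u. (f has_vector_derivative f' u) (at u)"
  shows "f' (u + 1) = f' u"
proof -
  have "((\<lambda>v. f (v + 1)) has_vector_derivative f' (u + 1)) (at u)"
    using vector_diff_chain_at[OF has_vector_derivative_add[OF has_vector_derivative_id has_vector_derivative_const] f[of "u + 1"]]
    by (simp add: o_def)
  moreover have "((\<lambda>v. f (v + 1)) has_vector_derivative f' u) (at u)"
    using has_vector_derivative_add[OF f[of u] has_vector_derivative_const[of d]] by (simp add: per)
  ultimately show ?thesis by (rule vector_derivative_unique_at)
qed

text \<open>The coordinate may move with the time \<open>t\<close>, which ranges over \<open>S\<close>.\<close>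

locale moving_circle =
  fixes S :: "real set" and x :: "real \<Rightarrow> real \<Rightarrow> real"
  assumes x_smooth: "u_smooth S x"
    and xu_pos: "t \<in> S \<Longrightarrow> partial_u x t u > 0"
    and x_period: "t \<in> S \<Longrightarrow> x t (u + 1) = x t u + 1"
begin

abbreviation "xu \<equiv> partial_u x"

lemma coordinate: "t \<in> S \<Longrightarrow> circle_coordinate (x t) (xu t)"
  using u_smooth_derivative[OF x_smooth] xu_pos x_period
    u_smooth_continuous_slice[OF u_smooth_partial[OF x_smooth]]
  by unfold_locales (auto simp: has_real_derivative_iff_has_vector_derivative)

definition coeff :: "(real \<Rightarrow> real \<Rightarrow> complex) \<Rightarrow> real \<Rightarrow> int \<Rightarrow> complex" where
  "coeff f t = fourier_coeff (x t) (xu t) (f t)"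

definition smooth_periodic :: "(real \<Rightarrow> real \<Rightarrow> complex) \<Rightarrow> bool" where
  "smooth_periodic f \<longleftrightarrow> u_smooth S f \<and> (\<forall>t\<in>S. \<forall>u. f t (u + 1) = f t u)"

text \<open>The derivative with respect to the coordinate \<open>x t\<close>.\<close>

definition D :: "(real \<Rightarrow> real \<Rightarrow> complex) \<Rightarrow> real \<Rightarrow> real \<Rightarrow> complex" where
  "D f t u = partial_u f t u / of_real (xu t u)"

lemma smooth_periodic_period: "smooth_periodic f \<Longrightarrow> t \<in> S \<Longrightarrow> f t (u + 1) = f t u"
  by (simp add: smooth_periodic_def)

lemma smooth_periodic_u_smooth: "smooth_periodic f \<Longrightarrow> u_smooth S f"
  by (simp add: smooth_periodic_def)

lemma smooth_periodic_derivative: "smooth_periodic f \<Longrightarrow> t \<in> S \<Longrightarrow> (f t has_vector_derivative partial_u f t u) (at u)"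
  using smooth_periodic_u_smooth u_smooth_derivative by blast

lemma smooth_periodic_cont: "smooth_periodic f \<Longrightarrow> t \<in> S \<Longrightarrow> continuous_on A (f t)"
  using smooth_periodic_u_smooth u_smooth_continuous_slice by blast

lemma smooth_periodic_cont_partial: "smooth_periodic f \<Longrightarrow> t \<in> S \<Longrightarrow> continuous_on A (partial_u f t)"
  using smooth_periodic_u_smooth u_smooth_partial u_smooth_continuous_slice by blast

lemma smooth_periodic_add: "smooth_periodic f \<Longrightarrow> smooth_periodic g \<Longrightarrow> smooth_periodic (\<lambda>t u. f t u + g t u)"
  by (auto simp: smooth_periodic_def intro: u_smooth_add)

lemma smooth_periodic_minus: "smooth_periodic f \<Longrightarrow> smooth_periodic (\<lambda>t u. - f t u)"
  by (auto simp: smooth_periodic_def intro: u_smooth_minus)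

lemma smooth_periodic_diff: "smooth_periodic f \<Longrightarrow> smooth_periodic g \<Longrightarrow> smooth_periodic (\<lambda>t u. f t u - g t u)"
  by (auto simp: smooth_periodic_def intro: u_smooth_diff)

lemma smooth_periodic_mult: "smooth_periodic f \<Longrightarrow> smooth_periodic g \<Longrightarrow> smooth_periodic (\<lambda>t u. f t u * g t u)"
  by (auto simp: smooth_periodic_def intro: u_smooth_mult)

lemma smooth_periodic_const: "continuous_on S r \<Longrightarrow> smooth_periodic (\<lambda>t u. r t)"
  by (auto simp: smooth_periodic_def intro: u_smooth_const)

lemma smooth_periodic_cong: "smooth_periodic f \<Longrightarrow> (\<And>t u. t \<in> S \<Longrightarrow> g t u = f t u) \<Longrightarrow> smooth_periodic g"
  using u_smooth_cong[of S g f] by (simp add: smooth_periodic_def)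

lemma xu_period: "t \<in> S \<Longrightarrow> xu t (u + 1) = xu t u"
  by (rule periodic_deriv[of "x t" 1]) (auto simp: x_period intro: u_smooth_derivative[OF x_smooth])

lemma smooth_periodic_D:
  assumes "smooth_periodic f" shows "smooth_periodic (D f)"
  unfolding smooth_periodic_def
proof
  show "u_smooth S (D f)"
    unfolding D_def[abs_def] using assms xu_pos
    by (intro u_smooth_divide u_smooth_of_real u_smooth_partial x_smooth smooth_periodic_u_smooth) (auto simp: less_imp_neq[symmetric])
  have "partial_u f t (u + 1) = partial_u f t u" if "t \<in> S" for t u
    by (rule periodic_deriv[of "f t" 0]) (use that assms in \<open>auto simp: smooth_periodic_period intro: smooth_periodic_derivative\<close>)
  then show "\<forall>t\<in>S. \<forall>u. D f t (u + 1) = D f t u" by (simp add: D_def xu_period)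
qed

lemma coeff_D:
  assumes "smooth_periodic f" "t \<in> S"
  shows "coeff (D f) t n = 2 * pi * \<i> * of_int n * coeff f t n"
proof -
  interpret circle_coordinate "x t" "xu t" by (rule coordinate[OF assms(2)])
  have "D f t = (\<lambda>u. partial_u f t u / of_real (xu t u))" by (simp add: D_def fun_eq_iff)
  then show ?thesis unfolding coeff_def
    using fc_derivative[OF smooth_periodic_derivative[OF assms] smooth_periodic_cont_partial[OF assms], of n] smooth_periodic_period[OF assms, of 0] by simp
qed

lemma coeff_add:
  assumes "smooth_periodic f" "smooth_periodic g" "t \<in> S"
  shows "coeff (\<lambda>t u. f t u + g t u) t n = coeff f t n + coeff g t n"
proof -
  interpret circle_coordinate "x t" "xu t" by (rule coordinate[OF assms(3)])
  show ?thesis unfolding coeff_def using fc_add smooth_periodic_cont assms by blast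
qed

lemma coeff_cmult:
  assumes "t \<in> S"
  shows "coeff (\<lambda>t u. r t * f t u) t n = r t * coeff f t n"
proof -
  interpret circle_coordinate "x t" "xu t" by (rule coordinate[OF assms])
  show ?thesis unfolding coeff_def by (rule fc_cmult)
qed

lemma coeff_minus: "t \<in> S \<Longrightarrow> coeff (\<lambda>t u. - f t u) t n = - coeff f t n"
  using coeff_cmult[of t "\<lambda>t. -1" f n] by simp

lemma coeff_diff:
  assumes "smooth_periodic f" "smooth_periodic g" "t \<in> S"
  shows "coeff (\<lambda>t u. f t u - g t u) t n = coeff f t n - coeff g t n"
  using coeff_add[OF assms(1) smooth_periodic_minus[OF assms(2)] assms(3)] coeff_minus[OF assms(3)] by simp

lemma coeff_const:
  assumes "t \<in> S"
  shows "coeff (\<lambda>t u. r t) t n = (if n = 0 then r t else 0)"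
proof -
  interpret circle_coordinate "x t" "xu t" by (rule coordinate[OF assms])
  show ?thesis unfolding coeff_def by (rule fc_const)
qed

lemma coeff_cong: "(\<And>u. f t u = g t u) \<Longrightarrow> coeff f t n = coeff g t n"
  by (simp add: coeff_def fourier_coeff_def)

text \<open>The coefficient of \<open>D f\<close> is \<open>2 \<pi> \<i> n\<close> times that of \<open>f\<close>, and \<open>D\<close> can be iterated \<open>j\<close> times; each
  iterate is bounded on \<open>K\<close> times a period.\<close>

lemma coeff_bounded_on_compact:
  assumes f: "smooth_periodic f" and K: "compact K" "K \<subseteq> S"
  shows "\<exists>C. \<forall>t\<in>K. \<forall>n. wt n ^ j * norm (coeff f t n) \<le> C"
proof -
  have bnd: "\<exists>C. \<forall>t\<in>K. \<forall>n. norm (coeff f t n) \<le> C" if f: "smooth_periodic f" for f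
  proof -
    have "compact ((\<lambda>(t, u). f t u) ` (K \<times> {0..1}))"
      by (rule compact_continuous_image[OF continuous_on_subset[OF u_smooth_continuous[OF smooth_periodic_u_smooth[OF f]]]])
        (use K in \<open>auto intro: compact_Times\<close>)
    then obtain C where C: "\<forall>y\<in>(\<lambda>(t, u). f t u) ` (K \<times> {0..1}). norm y \<le> C"
      using compact_imp_bounded bounded_iff by blast
    have "norm (coeff f t n) \<le> C" if t: "t \<in> K" for t n
    proof -
      interpret circle_coordinate "x t" "xu t" by (rule coordinate) (use t K in auto)
      show ?thesis unfolding coeff_def
        by (rule fc_norm_le[OF smooth_periodic_cont[OF f]]) (use t K C in auto)
    qed
    then show ?thesis by blast
  qed
  have main: "smooth_periodic f \<Longrightarrow> \<exists>C. \<forall>t\<in>K. \<forall>n. wt n ^ j * norm (coeff f t n) \<le> C" for f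
  proof (induction j arbitrary: f)
    case 0 then show ?case using bnd by simp
  next
    case (Suc j)
    obtain C1 where C1: "\<forall>t\<in>K. \<forall>n. wt n ^ j * norm (coeff f t n) \<le> C1" using Suc.IH[OF Suc.prems] by blast
    obtain C2 where C2: "\<forall>t\<in>K. \<forall>n. wt n ^ j * norm (coeff (D f) t n) \<le> C2" using Suc.IH[OF smooth_periodic_D[OF Suc.prems]] by blast
    have "wt n ^ Suc j * norm (coeff f t n) \<le> C1 + C2" if t: "t \<in> K" for t n
    proof -
      have "norm (coeff (D f) t n) = 2 * pi * \<bar>real_of_int n\<bar> * norm (coeff f t n)"
        using t K by (subst coeff_D[OF Suc.prems]) (auto simp: norm_mult)
      moreover have "1 * (\<bar>real_of_int n\<bar> * norm (coeff f t n)) \<le> (2 * pi) * (\<bar>real_of_int n\<bar> * norm (coeff f t n))"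
        using pi_ge_two by (intro mult_right_mono) auto
      ultimately have "\<bar>real_of_int n\<bar> * norm (coeff f t n) \<le> norm (coeff (D f) t n)" by simp
      then have "wt n ^ j * (\<bar>real_of_int n\<bar> * norm (coeff f t n)) \<le> wt n ^ j * norm (coeff (D f) t n)"
        by (intro mult_left_mono) auto
      also have "\<dots> \<le> C2" using C2 t by blast
      finally have "wt n ^ j * (\<bar>real_of_int n\<bar> * norm (coeff f t n)) \<le> C2" .
      moreover have "wt n ^ j * norm (coeff f t n) \<le> C1" using C1 t by blast
      ultimately show ?thesis by (simp add: algebra_simps)
    qed
    then show ?case by blast
  qed
  show ?thesis by (rule main[OF f])
qed

lemma coeff_rapid:
  assumes "smooth_periodic f" "t \<in> S" shows "rapid (coeff f t)"
  by (rule rapidI) (use coeff_bounded_on_compact[OF assms(1), of "{t}"] assms(2) in auto)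

lemma norm_le_wnorm_coeff:
  assumes "smooth_periodic f" "t \<in> S" shows "norm (f t u) \<le> wnorm 0 (coeff f t)"
proof -
  interpret circle_coordinate "x t" "xu t" by (rule coordinate[OF assms(2)])
  show ?thesis unfolding coeff_def
    by (rule norm_le_wnorm_0[OF smooth_periodic_derivative[OF assms] smooth_periodic_cont_partial[OF assms] smooth_periodic_period[OF assms]])
      (use rapid_summable[OF coeff_rapid[OF assms]] in \<open>simp add: coeff_def\<close>)
qed

text \<open>The product of two functions has the convolution of their coefficients.\<close>

lemma wnorm_mult:
  assumes "smooth_periodic f" "smooth_periodic g" "t \<in> S"
  shows "wnorm j (coeff (\<lambda>t u. f t u * g t u) t) \<le>
    2 ^ j * (wnorm 0 (coeff f t) * wnorm j (coeff g t) + wnorm j (coeff f t) * wnorm 0 (coeff g t))"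
proof (rule wnorm_convolution(2)[OF coeff_rapid[OF assms(1,3)] coeff_rapid[OF assms(2,3)]])
  interpret circle_coordinate "x t" "xu t" by (rule coordinate[OF assms(3)])
  fix n
  show "norm (coeff (\<lambda>t u. f t u * g t u) t n) \<le> (\<Sum>\<^sub>\<infinity>m. norm (coeff f t m) * norm (coeff g t (n - m)))"
    unfolding coeff_def
    using coeff_rapid[OF assms(1,3)] coeff_rapid[OF assms(2,3)]
    by (intro fc_mult_bound[OF smooth_periodic_derivative[OF assms(1,3)] smooth_periodic_cont_partial[OF assms(1,3)] smooth_periodic_period[OF assms(1,3)]])
      (auto simp: coeff_def intro: smooth_periodic_cont assms)
qed

lemma sup_norm_D_power:
  assumes "smooth_periodic f" "t \<in> S"
  shows "norm ((D ^^ m) f t u) \<le> (2 * pi) ^ m * wnorm m (coeff f t)"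
proof -
  have n: "smooth_periodic ((D ^^ m) f)" for m using assms(1) by (induction m) (auto intro: smooth_periodic_D)
  have c: "coeff ((D ^^ m) f) t k = (2 * pi * \<i> * of_int k) ^ m * coeff f t k" for m k
    by (induction m) (auto simp: coeff_D[OF n assms(2)])
  have "norm ((D ^^ m) f t u) \<le> wnorm 0 (coeff ((D ^^ m) f) t)"
    by (rule norm_le_wnorm_coeff[OF n assms(2)])
  also have "\<dots> \<le> (2 * pi) ^ m * wnorm (0 + m) (coeff f t)"
  proof (rule wnorm_compare(2)[OF coeff_rapid[OF assms]])
    fix k
    have "norm (coeff ((D ^^ m) f) t k) = (2 * pi) ^ m * \<bar>real_of_int k\<bar> ^ m * norm (coeff f t k)"
      by (simp add: c norm_mult norm_power power_mult_distrib)
    also have "\<dots> \<le> (2 * pi) ^ m * wt k ^ m * norm (coeff f t k)"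
      by (intro mult_right_mono mult_left_mono power_mono) auto
    finally show "norm (coeff ((D ^^ m) f) t k) \<le> (2 * pi) ^ m * wt k ^ m * norm (coeff f t k)" .
  qed
  finally show ?thesis by simp
qed

end

locale multiple_moving_circle = moving_circle +
  fixes \<omega> :: nat
  assumes \<omega>_pos: "\<omega> \<ge> 1"
begin

text \<open>The eigenvalues of the operator \<open>A\<close> below.\<close>

definition \<mu> :: "int \<Rightarrow> real" where "\<mu> n = 1 - (of_int n / of_nat \<omega>)\<^sup>2"

text \<open>With \<open>\<theta> = 2 \<pi> \<omega> x\<close> this is the operator \<open>1 + d\<^sup>2/d\<theta>\<^sup>2\<close>.\<close>

definition A :: "(real \<Rightarrow> real \<Rightarrow> complex) \<Rightarrow> real \<Rightarrow> real \<Rightarrow> complex" where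
  "A f t u = f t u + of_real (1 / (2 * pi * of_nat \<omega>)\<^sup>2) * D (D f) t u"

lemma abs_\<mu>_le: "\<bar>\<mu> n\<bar> \<le> wt n ^ 2"
proof -
  have "\<bar>real_of_int n / real \<omega>\<bar> \<le> \<bar>real_of_int n\<bar> / 1"
    unfolding abs_divide using \<omega>_pos by (intro divide_left_mono) (auto intro: mult_pos_pos)
  then have "(real_of_int n / real \<omega>)\<^sup>2 \<le> (\<bar>real_of_int n\<bar>)\<^sup>2"
    by (metis abs_ge_zero div_by_1 power2_abs power_mono)
  moreover have "wt n ^ 2 = 1 + 2 * \<bar>real_of_int n\<bar> + (\<bar>real_of_int n\<bar>)\<^sup>2"
    by (simp add: power2_eq_square algebra_simps)
  ultimately show ?thesis unfolding \<mu>_def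
    using zero_le_power2[of "real_of_int n / real \<omega>"] abs_ge_zero[of "real_of_int n"]
      zero_le_power2[of "\<bar>real_of_int n\<bar>"]
    by (intro abs_leI) linarith+
qed

lemma smooth_periodic_A: "smooth_periodic f \<Longrightarrow> smooth_periodic (A f)"
  unfolding A_def[abs_def] by (intro smooth_periodic_add smooth_periodic_mult smooth_periodic_const smooth_periodic_D) auto

lemma coeff_A:
  assumes "smooth_periodic f" "t \<in> S"
  shows "coeff (A f) t n = of_real (\<mu> n) * coeff f t n"
proof -
  define c where "c = complex_of_real (1 / (2 * pi * of_nat \<omega>)\<^sup>2)"
  have "coeff (A f) t n = coeff (\<lambda>t u. f t u + c * D (D f) t u) t n"
    by (rule coeff_cong) (simp add: A_def c_def)
  also have "\<dots> = coeff f t n + c * coeff (D (D f)) t n"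
    using coeff_add[OF assms(1) smooth_periodic_mult[OF smooth_periodic_const smooth_periodic_D[OF smooth_periodic_D[OF assms(1)]]] assms(2), of "\<lambda>t. c"]
      coeff_cmult[OF assms(2), of "\<lambda>t. c"] by simp
  also have "coeff (D (D f)) t n = (2 * pi * \<i> * of_int n) * ((2 * pi * \<i> * of_int n) * coeff f t n)"
    by (simp add: coeff_D[OF smooth_periodic_D[OF assms(1)] assms(2)] coeff_D[OF assms])
  also have "coeff f t n + c * \<dots> = of_real (\<mu> n) * coeff f t n"
    using \<omega>_pos by (simp add: c_def \<mu>_def field_simps power2_eq_square)
  finally show ?thesis .
qed

lemma wnorm_A:
  assumes "smooth_periodic f" "t \<in> S"
  shows "wnorm j (coeff (A f) t) \<le> wnorm (j + 2) (coeff f t)"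
proof -
  have "wnorm j (coeff (A f) t) \<le> 1 * wnorm (j + 2) (coeff f t)"
    by (rule wnorm_compare(2)[OF coeff_rapid[OF assms]])
      (auto simp: coeff_A[OF assms] norm_mult intro!: mult_right_mono abs_\<mu>_le)
  then show ?thesis by simp
qed

text \<open>Of the \<open>j + 4\<close> derivatives in the norm of \<open>b A s\<close> some may fall on \<open>b\<close> and some on \<open>s\<close>; the
  interpolation inequality reduces these mixed terms to the two extreme ones.\<close>

lemma wnorm_mult_A:
  assumes b: "smooth_periodic b" and s: "smooth_periodic s" and t: "t \<in> S"
  shows "wnorm (j + 2) (coeff (\<lambda>t u. b t u * A s t u) t) \<le> 2 ^ (j + 4) *
    (2 * wnorm 0 (coeff b t) * wnorm (j + 4) (coeff s t) + wnorm (j + 4) (coeff b t) * wnorm 0 (coeff s t))"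
proof -
  have "wnorm (j + 2) (coeff (\<lambda>t u. b t u * A s t u) t) \<le> 2 ^ (j + 2) *
     (wnorm 0 (coeff b t) * wnorm (j + 2) (coeff (A s) t) + wnorm (j + 2) (coeff b t) * wnorm 0 (coeff (A s) t))"
    by (rule wnorm_mult[OF b smooth_periodic_A[OF s] t])
  also have "\<dots> \<le> 2 ^ (j + 4) * (wnorm 0 (coeff b t) * wnorm (j + 4) (coeff s t) + wnorm (j + 2) (coeff b t) * wnorm 2 (coeff s t))"
    using wnorm_A[OF s t, of "j + 2"] wnorm_A[OF s t, of 0]
    by (intro mult_mono add_mono mult_left_mono wnorm_nonneg power_increasing add_nonneg_nonneg mult_nonneg_nonneg)
      (auto simp: eval_nat_numeral)
  also have "wnorm (j + 2) (coeff b t) * wnorm 2 (coeff s t) \<le>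
      wnorm 0 (coeff b t) * wnorm (j + 4) (coeff s t) + wnorm (j + 4) (coeff b t) * wnorm 0 (coeff s t)"
    using wnorm_interpolation[OF coeff_rapid[OF b t] coeff_rapid[OF s t], of "j + 2" 2] by (simp add: eval_nat_numeral)
  finally show ?thesis by (simp add: algebra_simps)
qed

text \<open>For \<open>1 + b = R \<kappa>\<close> this is \<open>R\<^sup>3 \<kappa> A(\<kappa>\<^sup>2)\<close>, which is \<open>- 2 R\<^sup>3\<close> times the normal velocity.\<close>

definition H :: "(real \<Rightarrow> real \<Rightarrow> complex) \<Rightarrow> real \<Rightarrow> real \<Rightarrow> complex" where
  "H b t u = (1 + b t u) * A (\<lambda>t u. (1 + b t u)\<^sup>2) t u"

text \<open>If \<open>1 + g\<close> is the reciprocal of \<open>1 + b\<close>, then the coefficients of \<open>H b\<close> to first order in \<open>g\<close> are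
  those of \<open>1 - (1 + 2 \<mu>) g\<close>; this is the remainder.\<close>

definition nonlinear_part :: "(real \<Rightarrow> real \<Rightarrow> complex) \<Rightarrow> (real \<Rightarrow> real \<Rightarrow> complex) \<Rightarrow> real \<Rightarrow> int \<Rightarrow> complex" where
  "nonlinear_part g b t n = coeff (H b) t n - (if n = 0 then 1 else 0) + (1 + 2 * \<mu> n) * coeff g t n"

lemma D_add:
  assumes "smooth_periodic f" "smooth_periodic g" "t \<in> S"
  shows "D (\<lambda>t u. f t u + g t u) t u = D f t u + D g t u"
proof -
  have "partial_u (\<lambda>t u. f t u + g t u) t u = partial_u f t u + partial_u g t u"
    by (rule partial_u_eqI) (intro has_vector_derivative_add smooth_periodic_derivative assms)
  then show ?thesis by (simp add: D_def add_divide_distrib)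
qed

lemma D_cong: "(\<And>u. f t u = g t u) \<Longrightarrow> D f t u = D g t u"
proof -
  assume "\<And>u. f t u = g t u"
  then have "f t = g t" by blast
  then show ?thesis by (simp add: D_def partial_u_def)
qed

lemma D_cmult:
  assumes "smooth_periodic f" "t \<in> S"
  shows "D (\<lambda>t u. c * f t u) t u = c * D f t u"
proof -
  have "partial_u (\<lambda>t u. c * f t u) t u = c * partial_u f t u"
    by (rule partial_u_eqI) (intro has_vector_derivative_mult_right smooth_periodic_derivative assms)
  then show ?thesis by (simp add: D_def)
qed

lemma D_const: "D (\<lambda>t u. c t) t u = 0"
proof -
  have "partial_u (\<lambda>t u. c t) t u = 0" by (rule partial_u_eqI) (rule has_vector_derivative_const)
  then show ?thesis by (simp add: D_def)
qed

lemma A_add: 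
  assumes "smooth_periodic f" "smooth_periodic g" "t \<in> S"
  shows "A (\<lambda>t u. f t u + g t u) t u = A f t u + A g t u"
proof -
  have "D (D (\<lambda>t u. f t u + g t u)) t u = D (\<lambda>t u. D f t u + D g t u) t u"
    by (rule D_cong) (rule D_add[OF assms])
  then show ?thesis using D_add[OF smooth_periodic_D[OF assms(1)] smooth_periodic_D[OF assms(2)] assms(3)]
    by (simp add: A_def algebra_simps add_divide_distrib)
qed

lemma A_cmult: 
  assumes "smooth_periodic f" "t \<in> S"
  shows "A (\<lambda>t u. c * f t u) t u = c * A f t u"
proof -
  have "D (D (\<lambda>t u. c * f t u)) t u = D (\<lambda>t u. c * D f t u) t u"
    by (rule D_cong) (rule D_cmult[OF assms])
  then show ?thesis using D_cmult[OF smooth_periodic_D[OF assms(1)] assms(2)]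
    by (simp add: A_def algebra_simps)
qed

lemma A_one: "t \<in> S \<Longrightarrow> A (\<lambda>t u. 1) t u = 1"
proof -
  have "D (D (\<lambda>t u. 1)) t u = D (\<lambda>t u. 0) t u" by (rule D_cong) (rule D_const)
  then show ?thesis by (simp add: A_def D_const)
qed

lemma A_cong: "(\<And>u. f t u = g t u) \<Longrightarrow> A f t u = A g t u"
proof -
  assume *: "\<And>u. f t u = g t u"
  have "D (D f) t u = D (D g) t u" by (rule D_cong, rule D_cong, rule *)
  then show ?thesis by (simp add: A_def *)
qed

lemma A_square:
  assumes b: "smooth_periodic b" and t: "t \<in> S"
  shows "A (\<lambda>t u. (1 + b t u)\<^sup>2) t u = 1 + 2 * A b t u + A (\<lambda>t u. b t u * b t u) t u"
proof -
  have one: "smooth_periodic (\<lambda>t u. 1)" by (rule smooth_periodic_const) simp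
  have "(\<lambda>t u. (1 + b t u)\<^sup>2) = (\<lambda>t u. (1 + 2 * b t u) + b t u * b t u)"
    by (auto simp: fun_eq_iff power2_eq_square algebra_simps)
  then show ?thesis
    using A_add[OF smooth_periodic_add[OF one smooth_periodic_mult[OF smooth_periodic_const b, of "\<lambda>t. 2"]] smooth_periodic_mult[OF b b] t, of u]
      A_add[OF one smooth_periodic_mult[OF smooth_periodic_const b, of "\<lambda>t. 2"] t, of u] A_cmult[OF b t, of 2 u] A_one[OF t, of u]
    by simp
qed

text \<open>Expand \<open>H b\<close>: the constant 1 has no coefficient at \<open>n \<noteq> 0\<close>, and all other terms contain \<open>b\<close>
  and at most two derivatives.  A bound that is linear in \<open>b\<close> is enough for the drift of the
  centre, where \<open>\<mu> n = 0\<close> and the estimate of \<open>\<mu> n\<close> times the nonlinear part says nothing.\<close>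

lemma coeff_H_bound:
  assumes b: "smooth_periodic b" and t: "t \<in> S" and n: "n \<noteq> 0" and small: "wnorm 0 (coeff b t) \<le> 1 / 2"
  shows "norm (coeff (H b) t n) \<le> 13 * wnorm 2 (coeff b t)"
proof -
  let ?bb = "\<lambda>t u. b t u * b t u"
  let ?E = "\<lambda>t u. A b t u + (A b t u + A ?bb t u)"
  let ?B = "\<lambda>j. wnorm j (coeff b t)"
  have one: "smooth_periodic (\<lambda>t u. 1)" by (rule smooth_periodic_const) simp
  note nA = smooth_periodic_A[OF b] and nAb = smooth_periodic_A[OF smooth_periodic_mult[OF b b]]
  have nE: "smooth_periodic ?E" by (intro smooth_periodic_add nA nAb)
  have add: "wnorm 0 (coeff (\<lambda>t u. f t u + g t u) t) \<le> wnorm 0 (coeff f t) + wnorm 0 (coeff g t)"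
    if "smooth_periodic f" "smooth_periodic g" for f g
    by (rule wnorm_add(2)[OF coeff_rapid[OF that(1) t] coeff_rapid[OF that(2) t]])
      (simp add: coeff_add[OF that t] norm_triangle_ineq)
  have mono: "?B 0 \<le> ?B 2" by (rule wnorm_mono_exponent[OF coeff_rapid[OF b t]]) simp
  have B2: "0 \<le> ?B 2" by (rule wnorm_nonneg)
  have BB: "?B 0 * ?B 2 \<le> 1 / 2 * ?B 2" by (rule mult_right_mono[OF small B2])
  have A1: "wnorm 0 (coeff (A b) t) \<le> ?B 2" using wnorm_A[OF b t, of 0] by (simp add: numeral_2_eq_2)
  have "wnorm 0 (coeff (A ?bb) t) \<le> wnorm 2 (coeff ?bb t)"
    using wnorm_A[OF smooth_periodic_mult[OF b b] t, of 0] by (simp add: numeral_2_eq_2)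
  also have "\<dots> \<le> 4 * (?B 0 * ?B 2 + ?B 2 * ?B 0)" using wnorm_mult[OF b b t, of 2] by simp
  finally have A2: "wnorm 0 (coeff (A ?bb) t) \<le> 4 * ?B 2" using BB by (simp add: mult.commute)
  have E: "wnorm 0 (coeff ?E t) \<le> 6 * ?B 2"
    using add[OF nA smooth_periodic_add[OF nA nAb]] add[OF nA nAb] A1 A2 by linarith
  have bE: "wnorm 0 (coeff (\<lambda>t u. b t u * ?E t u) t) \<le> 6 * ?B 2"
  proof -
    have "wnorm 0 (coeff (\<lambda>t u. b t u * ?E t u) t) \<le> ?B 0 * wnorm 0 (coeff ?E t) + ?B 0 * wnorm 0 (coeff ?E t)"
      using wnorm_mult[OF b nE t, of 0] by simp
    also have "?B 0 * wnorm 0 (coeff ?E t) \<le> 1 / 2 * (6 * ?B 2)"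
      by (rule mult_mono[OF small E]) (auto simp: wnorm_nonneg)
    finally show ?thesis by simp
  qed
  let ?f = "\<lambda>t u. b t u + (?E t u + b t u * ?E t u)"
  have nf: "smooth_periodic ?f" by (intro smooth_periodic_add smooth_periodic_mult b nE)
  have "coeff (H b) t n = coeff (\<lambda>t u. 1 + ?f t u) t n"
    by (rule coeff_cong) (simp add: H_def A_square[OF b t] algebra_simps)
  also have "\<dots> = coeff ?f t n"
    using coeff_add[OF one nf t, of n] coeff_const[OF t, of "\<lambda>t. 1" n] n by simp
  finally have eq: "coeff (H b) t n = coeff ?f t n" .
  have "norm (coeff ?f t n) \<le> wnorm 0 (coeff ?f t)"
    using term_le_wnorm[OF coeff_rapid[OF nf t], of n 0] by simp
  also have "\<dots> \<le> 13 * ?B 2"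
    using add[OF b smooth_periodic_add[OF nE smooth_periodic_mult[OF b nE]]] add[OF nE smooth_periodic_mult[OF b nE]] E bE mono by linarith
  finally show ?thesis unfolding eq .
qed

text \<open>The relation between \<open>b\<close> and \<open>g\<close> reads \<open>b = - g - g b\<close>.\<close>

lemma coeff_reciprocal:
  assumes g: "smooth_periodic g" and b: "smooth_periodic b" and t: "t \<in> S"
    and inv: "\<And>t u. t \<in> S \<Longrightarrow> (1 + b t u) * (1 + g t u) = 1"
  shows "coeff b t n = - coeff g t n - coeff (\<lambda>t u. g t u * b t u) t n"
proof -
  have "coeff b t n = coeff (\<lambda>t u. - g t u - g t u * b t u) t n"
  proof (rule coeff_cong)
    fix u show "b t u = - g t u - g t u * b t u"
      using inv[OF t, of u] by (simp add: algebra_simps add_eq_0_iff2)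
  qed
  also have "\<dots> = - coeff g t n - coeff (\<lambda>t u. g t u * b t u) t n"
    using coeff_diff[OF smooth_periodic_minus[OF g] smooth_periodic_mult[OF g b] t] coeff_minus[OF t] by simp
  finally show ?thesis .
qed

text \<open>Insert \<open>b = - g - g b\<close> into the terms of \<open>H b\<close> that are linear in \<open>b\<close>.\<close>

lemma nonlinear_part_eq:
  assumes g: "smooth_periodic g" and b: "smooth_periodic b" and t: "t \<in> S"
    and inv: "\<And>t u. t \<in> S \<Longrightarrow> (1 + b t u) * (1 + g t u) = 1"
  shows "nonlinear_part g b t n =
    - (1 + 2 * \<mu> n) * coeff (\<lambda>t u. g t u * b t u) t n + \<mu> n * coeff (\<lambda>t u. b t u * b t u) t n
    + 2 * coeff (\<lambda>t u. b t u * A b t u) t n + coeff (\<lambda>t u. b t u * A (\<lambda>t u. b t u * b t u) t u) t n"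
proof -
  let ?bb = "\<lambda>t u. b t u * b t u"
  note nb = smooth_periodic_mult[OF b b] and nA = smooth_periodic_A[OF b] 
  note nAb = smooth_periodic_A[OF nb]
  have one: "smooth_periodic (\<lambda>t u. 1)" by (rule smooth_periodic_const) simp
  note sq = A_square[OF b t]
  have "coeff (H b) t n = coeff (\<lambda>t u. (1 + b t u) + (2 * A b t u + (A ?bb t u + (2 * (b t u * A b t u) + b t u * A ?bb t u)))) t n"
    by (rule coeff_cong) (simp add: H_def sq algebra_simps)
  also have "\<dots> = (if n = 0 then 1 else 0) + coeff b t n + 2 * (\<mu> n * coeff b t n) + \<mu> n * coeff ?bb t n
     + 2 * coeff (\<lambda>t u. b t u * A b t u) t n + coeff (\<lambda>t u. b t u * A ?bb t u) t n"
    using b t one nb nA nAb smooth_periodic_const[of "\<lambda>t. 2::complex"] coeff_const[OF t, of "\<lambda>t. 1" n]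
    by (simp add: coeff_add smooth_periodic_add smooth_periodic_mult coeff_cmult coeff_A)
  finally have 1: "coeff (H b) t n = (if n = 0 then 1 else 0) + (1 + 2 * \<mu> n) * coeff b t n + \<mu> n * coeff ?bb t n
     + 2 * coeff (\<lambda>t u. b t u * A b t u) t n + coeff (\<lambda>t u. b t u * A ?bb t u) t n"
    by (simp add: algebra_simps)
  have 2: "coeff b t n = - coeff g t n - coeff (\<lambda>t u. g t u * b t u) t n"
    by (rule coeff_reciprocal[OF g b t inv])
  show ?thesis unfolding nonlinear_part_def 1 2 by (simp add: algebra_simps)
qed

text \<open>In \<open>b = - g - g b\<close> the product is absorbed on the left when \<open>g\<close> is small.  This replaces a
  power series for the reciprocal.\<close>

lemma reciprocal_wnorm:
  assumes g: "smooth_periodic g" and b: "smooth_periodic b" and t: "t \<in> S"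
    and inv: "\<And>t u. t \<in> S \<Longrightarrow> (1 + b t u) * (1 + g t u) = 1"
    and small: "2 ^ j * wnorm 0 (coeff g t) \<le> 1 / 4"
  shows "wnorm 0 (coeff b t) \<le> 2 * wnorm 0 (coeff g t)" "wnorm j (coeff b t) \<le> 2 * wnorm j (coeff g t)"
proof -
  let ?G = "\<lambda>j. wnorm j (coeff g t)" and ?B = "\<lambda>j. wnorm j (coeff b t)"
  have "1 * ?G 0 \<le> 2 ^ j * ?G 0" by (rule mult_right_mono) (auto simp: wnorm_nonneg)
  with small have G0: "?G 0 \<le> 1 / 4" by simp
  have eq: "coeff b t n = - coeff g t n - coeff (\<lambda>t u. g t u * b t u) t n" for n
    by (rule coeff_reciprocal[OF g b t inv])
  have est: "?B i \<le> ?G i + 2 ^ i * (?G 0 * ?B i + ?G i * ?B 0)" for i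
  proof -
    have "?B i \<le> ?G i + wnorm i (coeff (\<lambda>t u. g t u * b t u) t)"
      by (rule wnorm_add(2)[OF coeff_rapid[OF g t] coeff_rapid[OF smooth_periodic_mult[OF g b] t]])
        (subst eq, rule order_trans[OF norm_triangle_ineq4], simp)
    also note wnorm_mult[OF g b t, of i]
    finally show ?thesis by simp
  qed
  have "?G 0 * ?B 0 \<le> 1 / 4 * ?B 0" by (rule mult_right_mono[OF G0 wnorm_nonneg])
  with est[of 0] show B0: "?B 0 \<le> 2 * ?G 0" unfolding power_0 mult_1_left by linarith
  have "2 ^ j * ?G 0 * ?B j \<le> 1 / 4 * ?B j" by (rule mult_right_mono[OF small wnorm_nonneg])
  moreover have "2 ^ j * (?G j * ?B 0) \<le> 1 / 2 * ?G j"
  proof -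
    have "2 ^ j * ?B 0 \<le> 2 ^ j * (2 * ?G 0)" by (rule mult_left_mono[OF B0]) simp
    also have "\<dots> \<le> 1 / 2" using small by simp
    finally have "(2 ^ j * ?B 0) * ?G j \<le> 1 / 2 * ?G j" by (rule mult_right_mono[OF _ wnorm_nonneg])
    then show ?thesis by (simp add: mult_ac)
  qed
  ultimately show "?B j \<le> 2 * ?G j" using est[of j] by (simp add: algebra_simps)
qed

text \<open>Every term of the nonlinear part is a product of at least two factors, with at most two
  derivatives, and the factor \<open>\<mu> n\<close> contributes two more.  By the product estimates all \<open>j + 4\<close>
  weights fall on a single factor, and the others are measured in \<open>wnorm 0\<close>.\<close>

lemma nonlinear_estimate:
  assumes g: "smooth_periodic g" and b: "smooth_periodic b" and t: "t \<in> S"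
    and inv: "\<And>t u. t \<in> S \<Longrightarrow> (1 + b t u) * (1 + g t u) = 1"
    and small: "2 ^ (j + 4) * wnorm 0 (coeff g t) \<le> 1 / 4"
  shows "rapid (\<lambda>n. \<mu> n * nonlinear_part g b t n)"
    and "wnorm j (\<lambda>n. \<mu> n * nonlinear_part g b t n) \<le>
      60 * 4 ^ (j + 4) * wnorm 0 (coeff g t) * wnorm (j + 4) (coeff g t)"
proof -
  define P :: real where "P = 2 ^ (j + 4)"
  let ?bb = "\<lambda>t u. b t u * b t u"
  define G0 GM B0 BM where "G0 = wnorm 0 (coeff g t)" "GM = wnorm (j + 4) (coeff g t)"
    "B0 = wnorm 0 (coeff b t)" "BM = wnorm (j + 4) (coeff b t)"
  note defs = this
  have P: "P \<ge> 1" by (simp add: P_def)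
  have nn: "G0 \<ge> 0" "GM \<ge> 0" "B0 \<ge> 0" "BM \<ge> 0" by (simp_all add: defs wnorm_nonneg)
  have B0: "B0 \<le> 2 * G0" and BM: "BM \<le> 2 * GM"
    using reciprocal_wnorm[OF g b t inv small] by (simp_all add: defs)
  have sm: "P * G0 \<le> 1 / 4" using small by (simp add: P_def defs)
  have "1 * G0 \<le> P * G0" by (rule mult_right_mono) (use P nn in auto)
  with sm have G0: "G0 \<le> 1 / 4" by simp
  define E where "E = G0 * GM"
  have E: "E \<ge> 0" using nn by (simp add: E_def)
  have BB: "B0 * BM \<le> 4 * E"
    using mult_mono[OF B0 BM] nn by (simp add: E_def)
  have GB: "G0 * BM \<le> 2 * E" using mult_left_mono[OF BM nn(1)] by (simp add: E_def)
  have GB': "GM * B0 \<le> 2 * E" using mult_left_mono[OF B0 nn(2)] by (simp add: E_def mult_ac)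
  define q1 q2 q3 q4 where "q1 = coeff (\<lambda>t u. g t u * b t u) t" "q2 = coeff ?bb t"
    "q3 = coeff (\<lambda>t u. b t u * A b t u) t" "q4 = coeff (\<lambda>t u. b t u * A ?bb t u) t"
  note qdefs = this
  have r: "rapid q1" "rapid q2" "rapid q3" "rapid q4"
    unfolding qdefs by (intro coeff_rapid[OF _ t] smooth_periodic_mult smooth_periodic_A g b)+
  have n1: "wnorm (j + 4) q1 \<le> P * (4 * E)"
  proof -
    have "wnorm (j + 4) q1 \<le> P * (G0 * BM + GM * B0)"
      using wnorm_mult[OF g b t, of "j + 4"] by (simp add: qdefs P_def defs)
    also have "\<dots> \<le> P * (4 * E)" by (rule mult_left_mono) (use GB GB' P in auto)
    finally show ?thesis .
  qed
  have n2: "wnorm (j + 4) q2 \<le> P * (8 * E)"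
  proof -
    have "wnorm (j + 4) q2 \<le> P * (B0 * BM + BM * B0)"
      using wnorm_mult[OF b b t, of "j + 4"] by (simp add: qdefs P_def defs)
    also have "\<dots> \<le> P * (8 * E)" by (rule mult_left_mono) (use BB P in \<open>auto simp: mult.commute\<close>)
    finally show ?thesis .
  qed
  have n20: "wnorm 0 q2 \<le> B0"
  proof -
    have "wnorm 0 q2 \<le> B0 * B0 + B0 * B0"
      using wnorm_mult[OF b b t, of 0] by (simp add: qdefs defs)
    also have "B0 * B0 \<le> 1 / 2 * B0" by (rule mult_right_mono) (use B0 G0 nn in auto)
    finally show ?thesis by simp
  qed
  have n3: "wnorm (j + 2) q3 \<le> P * (12 * E)"
  proof -
    have "wnorm (j + 2) q3 \<le> P * (2 * B0 * BM + BM * B0)"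
      using wnorm_mult_A[OF b b t, of j] by (simp add: qdefs P_def defs)
    also have "\<dots> \<le> P * (12 * E)" by (rule mult_left_mono) (use BB P in \<open>auto simp: mult_ac\<close>)
    finally show ?thesis .
  qed
  have n4: "wnorm (j + 2) q4 \<le> P * (P * (8 * E) + 4 * E)"
  proof -
    have "wnorm (j + 2) q4 \<le> P * (2 * B0 * wnorm (j + 4) q2 + BM * wnorm 0 q2)"
      using wnorm_mult_A[OF b smooth_periodic_mult[OF b b] t, of j] by (simp add: qdefs P_def defs)
    also have "\<dots> \<le> P * (1 * (P * (8 * E)) + BM * B0)"
      by (intro mult_left_mono add_mono mult_mono n2 n20) (use B0 G0 nn P wnorm_nonneg in auto)
    also have "\<dots> \<le> P * (P * (8 * E) + 4 * E)" by (rule mult_left_mono) (use BB P in \<open>auto simp: mult_ac\<close>)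
    finally show ?thesis .
  qed
  have w1: "1 \<le> wt n ^ 2" for n by (rule one_le_power) simp
  define p1 p2 p3 p4 where "p1 = (\<lambda>n. of_real (\<mu> n * (1 + 2 * \<mu> n)) * q1 n)" "p2 = (\<lambda>n. of_real (\<mu> n * \<mu> n) * q2 n)"
    "p3 = (\<lambda>n. of_real (2 * \<mu> n) * q3 n)" "p4 = (\<lambda>n. of_real (\<mu> n) * q4 n)"
  note pdefs = this
  have m1: "\<bar>\<mu> n * (1 + 2 * \<mu> n)\<bar> \<le> 3 * wt n ^ 4" for n
  proof -
    have "\<bar>\<mu> n * (1 + 2 * \<mu> n)\<bar> \<le> wt n ^ 2 * (3 * wt n ^ 2)"
      unfolding abs_mult
    proof (intro mult_mono)
      show "\<bar>1 + 2 * \<mu> n\<bar> \<le> 3 * wt n ^ 2" using abs_\<mu>_le[of n] w1[of n] by linarith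
    qed (use abs_\<mu>_le[of n] in auto)
    then show ?thesis by (simp add: power_add[symmetric] mult_ac)
  qed
  have m2: "\<bar>\<mu> n * \<mu> n\<bar> \<le> 1 * wt n ^ 4" for n
  proof -
    have "\<bar>\<mu> n * \<mu> n\<bar> \<le> wt n ^ 2 * wt n ^ 2"
      unfolding abs_mult using abs_\<mu>_le[of n] by (intro mult_mono) auto
    then show ?thesis by (simp add: power_add[symmetric])
  qed
  have c1: "norm (p1 n) \<le> 3 * wt n ^ 4 * norm (q1 n)" for n
    unfolding pdefs norm_mult norm_of_real by (rule mult_right_mono[OF m1]) simp
  have c2: "norm (p2 n) \<le> 1 * wt n ^ 4 * norm (q2 n)" for n
    unfolding pdefs norm_mult norm_of_real by (rule mult_right_mono[OF m2]) simp
  have c3: "norm (p3 n) \<le> 2 * wt n ^ 2 * norm (q3 n)" for n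
    unfolding pdefs norm_mult norm_of_real by (rule mult_right_mono) (use abs_\<mu>_le[of n] in \<open>auto simp: abs_mult\<close>)
  have c4: "norm (p4 n) \<le> 1 * wt n ^ 2 * norm (q4 n)" for n
    unfolding pdefs norm_mult norm_of_real by (rule mult_right_mono) (use abs_\<mu>_le[of n] in auto)
  note rp = wnorm_compare(1)[OF r(1) c1] wnorm_compare(1)[OF r(2) c2] wnorm_compare(1)[OF r(3) c3] wnorm_compare(1)[OF r(4) c4]
  have sum12: "rapid (\<lambda>n. p2 n - p1 n)" "wnorm j (\<lambda>n. p2 n - p1 n) \<le> wnorm j p2 + wnorm j p1"
    by (rule wnorm_add[OF rp(2,1)], rule norm_triangle_ineq4)+
  have sum34: "rapid (\<lambda>n. p3 n + p4 n)" "wnorm j (\<lambda>n. p3 n + p4 n) \<le> wnorm j p3 + wnorm j p4"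
    by (rule wnorm_add[OF rp(3,4)], rule norm_triangle_ineq)+
  have eq: "(\<lambda>n. \<mu> n * nonlinear_part g b t n) = (\<lambda>n. (p2 n - p1 n) + (p3 n + p4 n))"
    by (auto simp: fun_eq_iff nonlinear_part_eq[OF g b t inv] pdefs qdefs algebra_simps)
  have total: "rapid (\<lambda>n. (p2 n - p1 n) + (p3 n + p4 n))" 
     "wnorm j (\<lambda>n. (p2 n - p1 n) + (p3 n + p4 n)) \<le> wnorm j (\<lambda>n. p2 n - p1 n) + wnorm j (\<lambda>n. p3 n + p4 n)"
    by (rule wnorm_add[OF sum12(1) sum34(1)], rule norm_triangle_ineq)+
  show "rapid (\<lambda>n. \<mu> n * nonlinear_part g b t n)" unfolding eq by (rule total)
  have "wnorm j (\<lambda>n. \<mu> n * nonlinear_part g b t n) \<le> wnorm j p2 + wnorm j p1 + (wnorm j p3 + wnorm j p4)"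
    unfolding eq using total(2) sum12(2) sum34(2) by linarith
  also have "\<dots> \<le> 1 * wnorm (j + 4) q2 + 3 * wnorm (j + 4) q1 + (2 * wnorm (j + 2) q3 + 1 * wnorm (j + 2) q4)"
    by (intro add_mono wnorm_compare(2) r c1 c2 c3 c4)
  also have "\<dots> \<le> P * (8 * E) + 3 * (P * (4 * E)) + (2 * (P * (12 * E)) + P * (P * (8 * E) + 4 * E))"
    using n1 n2 n3 n4 by linarith
  also have "\<dots> = 48 * (P * E) + 8 * (P * P * E)" by (simp add: algebra_simps)
  also have "\<dots> \<le> 60 * (P * P * E)"
  proof -
    have "1 * (P * E) \<le> P * (P * E)" by (rule mult_right_mono) (use P E in auto)
    then have "P * E \<le> P * P * E" by (simp add: mult.assoc)
    moreover have "P * P * E \<ge> 0" using P E by simp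
    ultimately show ?thesis by linarith
  qed
  also have "P * P = 4 ^ (j + 4)" by (simp add: P_def power_mult_distrib[symmetric])
  finally show "wnorm j (\<lambda>n. \<mu> n * nonlinear_part g b t n) \<le>
      60 * 4 ^ (j + 4) * wnorm 0 (coeff g t) * wnorm (j + 4) (coeff g t)"
    by (simp add: E_def defs mult.assoc)
qed

end

section \<open>Decay of solutions of weighted linear systems\<close>

text \<open>The modulus of \<open>a\<close> need not be differentiable where \<open>a\<close> vanishes; \<open>sqrt (norm a ^ 2 + \<delta>\<^sup>2)\<close>
  is, and costs the term \<open>q \<delta>\<close>.\<close>

lemma smoothed_norm_derivative:
  fixes a :: "real \<Rightarrow> complex"
  assumes a: "(a has_vector_derivative c *\<^sub>R (- q *\<^sub>R a t + e)) (at t within T)"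
    and c: "c \<ge> 0" and q: "q \<ge> 0" and \<delta>: "\<delta> > 0"
  obtains d where "((\<lambda>t. sqrt ((norm (a t))\<^sup>2 + \<delta>\<^sup>2)) has_real_derivative d) (at t within T)"
    "d \<le> c * (- q * sqrt ((norm (a t))\<^sup>2 + \<delta>\<^sup>2) + q * \<delta> + norm e)"
proof -
  define s where "s = sqrt ((norm (a t))\<^sup>2 + \<delta>\<^sup>2)"
  have pos: "(norm (a t))\<^sup>2 + \<delta>\<^sup>2 > 0" using \<delta> by (simp add: add_nonneg_pos)
  have s: "s \<ge> \<delta>" "s \<ge> norm (a t)" "s > 0" "s * s = (norm (a t))\<^sup>2 + \<delta>\<^sup>2"
    using \<delta> pos by (auto simp: s_def real_sqrt_gt_zero intro!: real_le_rsqrt)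
  define d where "d = (a t \<bullet> (c *\<^sub>R (- q *\<^sub>R a t + e))) / s"
  have "((\<lambda>t. a t \<bullet> a t) has_vector_derivative a t \<bullet> (c *\<^sub>R (- q *\<^sub>R a t + e)) + (c *\<^sub>R (- q *\<^sub>R a t + e)) \<bullet> a t) (at t within T)"
    by (rule bounded_bilinear.has_vector_derivative[OF bounded_bilinear_inner a a])
  then have "((\<lambda>t. (norm (a t))\<^sup>2) has_real_derivative 2 * (a t \<bullet> (c *\<^sub>R (- q *\<^sub>R a t + e)))) (at t within T)"
    by (simp add: has_real_derivative_iff_has_vector_derivative power2_norm_eq_inner inner_commute)
  then have "((\<lambda>t. (norm (a t))\<^sup>2 + \<delta>\<^sup>2) has_real_derivative 2 * (a t \<bullet> (c *\<^sub>R (- q *\<^sub>R a t + e)))) (at t within T)"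
    using DERIV_add[OF _ DERIV_const] by fastforce
  from DERIV_chain2[OF DERIV_real_sqrt[OF pos] this]
  have 1: "((\<lambda>t. sqrt ((norm (a t))\<^sup>2 + \<delta>\<^sup>2)) has_real_derivative d) (at t within T)"
    by (simp add: d_def s_def field_simps)
  have "a t \<bullet> (- q *\<^sub>R a t + e) \<le> - q * (norm (a t))\<^sup>2 + norm (a t) * norm e"
    using norm_cauchy_schwarz[of "a t" e] by (simp add: inner_add_right inner_diff_right power2_norm_eq_inner)
  also have "\<dots> \<le> - q * (s * s - \<delta> * \<delta>) + s * norm e"
    using s by (intro add_mono mult_right_mono) (auto simp: power2_eq_square)
  also have "- q * (s * s - \<delta> * \<delta>) \<le> - q * s * s + q * \<delta> * s"
  proof -
    have "\<delta> * \<delta> \<le> \<delta> * s" by (rule mult_left_mono) (use s \<delta> in auto)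
    from mult_left_mono[OF this q] show ?thesis by (simp add: algebra_simps)
  qed
  finally have "a t \<bullet> (- q *\<^sub>R a t + e) \<le> (- q * s + q * \<delta> + norm e) * s" by (simp add: algebra_simps)
  from mult_left_mono[OF this c] have "c * (a t \<bullet> (- q *\<^sub>R a t + e)) \<le> (c * (- q * s + q * \<delta> + norm e)) * s" by simp
  then have "d \<le> c * (- q * s + q * \<delta> + norm e)"
    unfolding d_def using s(3) by (simp add: pos_divide_le_eq)
  with 1 show ?thesis using that unfolding s_def by blast
qed

text \<open>Consider \<open>R powr \<kappa>\<close> times a finite part of \<open>wnorm j (a t)\<close>.  In its derivative the dissipation
  produces \<open>- \<kappa>\<close> times the corresponding part of \<open>wnorm (j + 4) (a t)\<close>.  One half of this
  compensates the growth of \<open>R powr \<kappa>\<close>, whose logarithmic derivative is \<open>\<kappa> / (2 R\<^sup>4)\<close>.  The other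
  half compensates the forcing up to the part of \<open>wnorm (j + 4) (a t)\<close> that the finite sum misses,
  which is small uniformly in \<open>t\<close>.  Working with finite sums avoids differentiating a series.\<close>

lemma weighted_decay:
  fixes a e :: "real \<Rightarrow> int \<Rightarrow> complex" and q :: "int \<Rightarrow> real" and R :: "real \<Rightarrow> real"
  assumes t12: "t1 < t2" and \<kappa>: "\<kappa> > 0"
    and R_pos: "\<And>t. t \<in> {t1..t2} \<Longrightarrow> R t > 0"
    and R': "\<And>t. t \<in> {t1..t2} \<Longrightarrow> (R has_real_derivative 1 / (2 * R t ^ 3)) (at t within {t1..t2})"
    and a': "\<And>t n. t \<in> {t1..t2} \<Longrightarrow> ((\<lambda>r. a r n) has_vector_derivative
        (1 / R t ^ 4) *\<^sub>R (- q n *\<^sub>R a t n + e t n)) (at t within {t1..t2})"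
    and q: "\<And>n. q n \<ge> \<kappa> * wt n ^ 4"
    and C: "\<And>t n. t \<in> {t1..t2} \<Longrightarrow> wt n ^ (j + 6) * norm (a t n) \<le> C"
    and ra: "\<And>t. t \<in> {t1..t2} \<Longrightarrow> rapid (a t)"
    and re: "\<And>t. t \<in> {t1..t2} \<Longrightarrow> rapid (e t)"
    and e: "\<And>t. t \<in> {t1..t2} \<Longrightarrow> wnorm j (e t) \<le> \<kappa> / 2 * wnorm (j + 4) (a t)"
  shows "wnorm j (a t2) * R t2 powr \<kappa> \<le> wnorm j (a t1) * R t1 powr \<kappa>"
proof -
  have R_cont: "continuous_on {t1..t2} R"
    by (meson DERIV_continuous_on R')
  obtain M where M: "M > 0" "\<And>t. t \<in> {t1..t2} \<Longrightarrow> R t powr \<kappa> * (1 / R t ^ 4) \<le> M"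
  proof -
    have "compact ((\<lambda>t. R t powr \<kappa> * (1 / R t ^ 4)) ` {t1..t2})"
      by (intro compact_continuous_image continuous_intros R_cont) (use R_pos in \<open>auto simp: less_imp_neq[symmetric] dest: less_imp_neq\<close>)
    then obtain M where "\<forall>y\<in>(\<lambda>t. R t powr \<kappa> * (1 / R t ^ 4)) ` {t1..t2}. norm y \<le> M"
      using compact_imp_bounded bounded_iff by blast
    then show ?thesis by (intro that[of "max M 1"]) (fastforce simp: le_max_iff_disj)+
  qed
  have fin: "(\<Sum>n\<in>F. wt n ^ j * norm (a t2 n)) * R t2 powr \<kappa> \<le> wnorm j (a t1) * R t1 powr \<kappa>"
    if F: "finite F" for F
  proof (rule field_le_epsilon)
    fix \<epsilon> :: real assume \<epsilon>: "\<epsilon> > 0"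
    define \<eta> where "\<eta> = \<epsilon> / (2 * M * (t2 - t1))"
    have \<eta>: "\<eta> > 0" using \<epsilon> M t12 by (simp add: \<eta>_def)
    have "\<eta> / \<kappa> > 0" using \<eta> \<kappa> by simp
    have C': "wt n ^ (j + 4 + 2) * norm (a t n) \<le> C" if "t \<in> {t1..t2}" for t n
    proof -
      have "j + 4 + 2 = j + 6" by simp
      then show ?thesis using C[OF that, of n] by (simp only:)
    qed
    obtain N0 where N0: "\<And>t. t \<in> {t1..t2} \<Longrightarrow> wnorm (j + 4) (a t) \<le> (\<Sum>n\<in>{-int N0..int N0}. wt n ^ (j + 4) * norm (a t n)) + \<eta> / \<kappa>"
      using uniform_tail[of "{t1..t2}" "j + 4" a C, OF C' \<open>\<eta> / \<kappa> > 0\<close>] by blast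
    define I where "I = F \<union> {-int N0..int N0}"
    have I: "finite I" using F by (simp add: I_def)
    define Q where "Q = (\<Sum>n\<in>I. wt n ^ j * q n)"
    define W where "W = (\<Sum>n\<in>I. wt n ^ j)"
    have q0: "q n > 0" for n by (rule less_le_trans[OF _ q]) (use \<kappa> in simp)
    have QW: "Q \<ge> 0" "W \<ge> 0" unfolding Q_def W_def using q0 by (auto intro!: sum_nonneg mult_nonneg_nonneg simp: less_imp_le)
    \<comment> \<open>small against the dissipation and against the initial value\<close>
    define \<delta> where "\<delta> = min (\<eta> / (2 * (Q + 1))) (\<epsilon> / (2 * (W + 1) * (R t1 powr \<kappa>)))"
    have R1: "R t1 powr \<kappa> > 0" using R_pos[of t1] t12 by simp
    have \<delta>: "\<delta> > 0" "\<delta> * Q \<le> \<eta> / 2" "\<delta> * W * R t1 powr \<kappa> \<le> \<epsilon> / 2"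
    proof -
      show "\<delta> > 0" using \<eta> \<epsilon> QW R1 by (simp add: \<delta>_def)
      have "\<delta> * Q \<le> \<eta> / (2 * (Q + 1)) * (Q + 1)"
        using QW \<eta> by (intro mult_mono) (auto simp: \<delta>_def)
      also have "\<dots> = \<eta> / 2" using QW by (simp add: divide_simps)
      finally show "\<delta> * Q \<le> \<eta> / 2" .
      have "\<delta> * W * R t1 powr \<kappa> \<le> (\<epsilon> / (2 * (W + 1) * (R t1 powr \<kappa>))) * (W + 1) * R t1 powr \<kappa>"
        using QW \<epsilon> R1 by (intro mult_mono) (auto simp: \<delta>_def)
      also have "\<dots> = \<epsilon> / 2" using QW R1 by (simp add: divide_simps)
      finally show "\<delta> * W * R t1 powr \<kappa> \<le> \<epsilon> / 2" .
    qed
    define s where "s n t = sqrt ((norm (a t n))\<^sup>2 + \<delta>\<^sup>2)" for n t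
    have s_ge: "s n t \<ge> norm (a t n)" for n t by (simp add: s_def real_le_rsqrt)
    have s_le: "s n t \<le> norm (a t n) + \<delta>" for n t
      unfolding s_def using sqrt_add_le_add_sqrt[of "(norm (a t n))\<^sup>2" "\<delta>\<^sup>2"] \<delta>(1) by simp
    define dprop where "dprop n t d \<longleftrightarrow> (s n has_real_derivative d) (at t within {t1..t2}) \<and>
         d \<le> (1 / R t ^ 4) * (- q n * s n t + q n * \<delta> + norm (e t n))" for n t d
    define d where "d n t = (SOME d. dprop n t d)" for n t
    have dprop: "dprop n t (d n t)" if t: "t \<in> {t1..t2}" for n t
      unfolding d_def
    proof (rule someI_ex)
      have "1 / R t ^ 4 \<ge> 0" using R_pos[OF t] by simp
      from smoothed_norm_derivative[OF a'[OF t, of n] this less_imp_le[OF q0] \<delta>(1)]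
      show "\<exists>d. dprop n t d" unfolding dprop_def s_def[abs_def] by blast
    qed
    have d: "(s n has_real_derivative d n t) (at t within {t1..t2})"
      "d n t \<le> (1 / R t ^ 4) * (- q n * s n t + q n * \<delta> + norm (e t n))" if "t \<in> {t1..t2}" for n t
      using dprop[OF that, of n] unfolding dprop_def by blast+
    define \<Phi> where "\<Phi> t = (\<Sum>n\<in>I. wt n ^ j * s n t) * R t powr \<kappa>" for t
    define \<Phi>' where "\<Phi>' t = (\<Sum>n\<in>I. wt n ^ j * d n t) * R t powr \<kappa> + (\<Sum>n\<in>I. wt n ^ j * s n t) * (\<kappa> / 2 * (1 / R t ^ 4) * R t powr \<kappa>)" for t
    have \<Phi>_deriv: "(\<Phi> has_real_derivative \<Phi>' t) (at t within {t1..t2})" if t: "t \<in> {t1..t2}" for t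
    proof -
      have 1: "((\<lambda>t. R t powr \<kappa>) has_real_derivative \<kappa> / 2 * (1 / R t ^ 4) * R t powr \<kappa>) (at t within {t1..t2})"
      proof -
        have "\<kappa> * R t powr (\<kappa> - 1) * (1 / (2 * R t ^ 3)) = \<kappa> / 2 * (1 / R t ^ 4) * R t powr \<kappa>"
          using R_pos[OF t] by (simp add: powr_diff field_simps eval_nat_numeral)
        with DERIV_chain2[OF has_real_derivative_powr[OF R_pos[OF t], of \<kappa>] R'[OF t]] show ?thesis by simp
      qed
      have 2: "((\<lambda>t. \<Sum>n\<in>I. wt n ^ j * s n t) has_real_derivative (\<Sum>n\<in>I. wt n ^ j * d n t)) (at t within {t1..t2})"
        by (intro DERIV_sum DERIV_cmult d t)
      show ?thesis unfolding \<Phi>_def[abs_def] \<Phi>'_def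
        using DERIV_mult[OF 2 1] by (simp add: mult_ac add.commute)
    qed
    have \<Phi>'_le: "\<Phi>' t \<le> M * \<eta>" if t: "t \<in> {t1..t2}" for t
    proof -
      define c where "c = 1 / R t ^ 4"
      have c: "c > 0" using R_pos[OF t] by (simp add: c_def)
      have "(\<Sum>n\<in>I. wt n ^ j * d n t) + \<kappa> / 2 * c * (\<Sum>n\<in>I. wt n ^ j * s n t) =
          (\<Sum>n\<in>I. wt n ^ j * d n t + \<kappa> / 2 * c * (wt n ^ j * s n t))"
        by (simp add: sum.distrib sum_distrib_left)
      also have "\<dots> \<le> (\<Sum>n\<in>I. c * (\<delta> * (wt n ^ j * q n) + wt n ^ j * norm (e t n) - \<kappa> / 2 * (wt n ^ (j + 4) * norm (a t n))))"
      proof (rule sum_mono)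
        fix n
        have w: "1 \<le> wt n ^ 4" by (rule one_le_power) simp
        have "\<kappa> / 2 * 1 \<le> \<kappa> / 2 * wt n ^ 4" by (rule mult_left_mono[OF w]) (use \<kappa> in simp)
        then have ge: "q n - \<kappa> / 2 \<ge> \<kappa> / 2 * wt n ^ 4" using q[of n] by simp
        have "0 \<le> \<kappa> / 2 * wt n ^ 4" using \<kappa> by simp
        then have ge0: "0 \<le> q n - \<kappa> / 2" using ge by linarith
        have "\<kappa> / 2 * wt n ^ 4 * norm (a t n) \<le> (q n - \<kappa> / 2) * s n t"
          by (rule mult_mono[OF ge s_ge ge0]) simp
        then have "(- q n * s n t + q n * \<delta> + norm (e t n)) + \<kappa> / 2 * s n t \<le>
            \<delta> * q n + norm (e t n) - \<kappa> / 2 * wt n ^ 4 * norm (a t n)"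
          by (simp add: algebra_simps)
        from mult_left_mono[OF this, of c] c d(2)[OF t, of n]
        have "d n t + \<kappa> / 2 * c * s n t \<le> c * (\<delta> * q n + norm (e t n) - \<kappa> / 2 * wt n ^ 4 * norm (a t n))"
          unfolding c_def[symmetric] by (simp add: algebra_simps)
        from mult_left_mono[OF this, of "wt n ^ j"]
        show "wt n ^ j * d n t + \<kappa> / 2 * c * (wt n ^ j * s n t) \<le>
            c * (\<delta> * (wt n ^ j * q n) + wt n ^ j * norm (e t n) - \<kappa> / 2 * (wt n ^ (j + 4) * norm (a t n)))"
          unfolding power_add by (simp only: zero_le_power) (simp add: ring_distribs mult_ac)
      qed
      also have "\<dots> = c * (\<delta> * Q + (\<Sum>n\<in>I. wt n ^ j * norm (e t n)) - \<kappa> / 2 * (\<Sum>n\<in>I. wt n ^ (j + 4) * norm (a t n)))"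
        by (simp only: sum_distrib_left[symmetric] sum.distrib sum_subtractf Q_def)
      also have "\<dots> \<le> c * \<eta>"
      proof (rule mult_left_mono)
        have "(\<Sum>n\<in>{-int N0..int N0}. wt n ^ (j + 4) * norm (a t n)) \<le> (\<Sum>n\<in>I. wt n ^ (j + 4) * norm (a t n))"
          by (rule sum_mono2) (use I in \<open>auto simp: I_def\<close>)
        with N0[OF t] have "wnorm (j + 4) (a t) - \<eta> / \<kappa> \<le> (\<Sum>n\<in>I. wt n ^ (j + 4) * norm (a t n))" by linarith
        from mult_left_mono[OF this, of "\<kappa> / 2"] \<kappa>
        have "\<kappa> / 2 * wnorm (j + 4) (a t) - \<eta> / 2 \<le> \<kappa> / 2 * (\<Sum>n\<in>I. wt n ^ (j + 4) * norm (a t n))"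
          by (simp add: right_diff_distrib)
        moreover have "(\<Sum>n\<in>I. wt n ^ j * norm (e t n)) \<le> wnorm j (e t)" by (rule sum_le_wnorm[OF re[OF t] I])
        ultimately show "\<delta> * Q + (\<Sum>n\<in>I. wt n ^ j * norm (e t n)) - \<kappa> / 2 * (\<Sum>n\<in>I. wt n ^ (j + 4) * norm (a t n)) \<le> \<eta>"
          using e[OF t] \<delta>(2) by linarith
      qed (use c in simp)
      finally have "(\<Sum>n\<in>I. wt n ^ j * d n t) + \<kappa> / 2 * c * (\<Sum>n\<in>I. wt n ^ j * s n t) \<le> c * \<eta>" .
      from mult_left_mono[OF this, of "R t powr \<kappa>"]
      have "\<Phi>' t \<le> (R t powr \<kappa> * c) * \<eta>" unfolding \<Phi>'_def c_def[symmetric] by (simp add: algebra_simps)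
      also have "\<dots> \<le> M * \<eta>" using M(2)[OF t] \<eta> by (intro mult_right_mono) (auto simp: c_def)
      finally show ?thesis .
    qed
    obtain \<xi> where \<xi>: "\<xi> \<in> {t1<..<t2}" "\<Phi> t2 - \<Phi> t1 = (t2 - t1) * \<Phi>' \<xi>"
      using mvt_simple[OF t12, of \<Phi> "\<lambda>t h. h * \<Phi>' t"] \<Phi>_deriv by (auto simp: has_field_derivative_def mult_commute_abs)
    have "(t2 - t1) * \<Phi>' \<xi> \<le> (t2 - t1) * (M * \<eta>)"
      by (rule mult_left_mono[OF \<Phi>'_le]) (use \<xi> t12 in auto)
    also have "\<dots> = \<epsilon> / 2" using M t12 by (simp add: \<eta>_def divide_simps)
    finally have \<Phi>2: "\<Phi> t2 \<le> \<Phi> t1 + \<epsilon> / 2" using \<xi> by simp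
    have "(\<Sum>n\<in>F. wt n ^ j * norm (a t2 n)) \<le> (\<Sum>n\<in>I. wt n ^ j * norm (a t2 n))"
      by (rule sum_mono2) (use I in \<open>auto simp: I_def\<close>)
    also have "\<dots> \<le> (\<Sum>n\<in>I. wt n ^ j * s n t2)" by (intro sum_mono mult_left_mono s_ge) auto
    finally have "(\<Sum>n\<in>F. wt n ^ j * norm (a t2 n)) * R t2 powr \<kappa> \<le> \<Phi> t2"
      unfolding \<Phi>_def by (rule mult_right_mono) simp
    also note \<Phi>2
    also have "\<Phi> t1 \<le> (wnorm j (a t1) + \<delta> * W) * R t1 powr \<kappa>"
      unfolding \<Phi>_def
    proof (rule mult_right_mono)
      have "(\<Sum>n\<in>I. wt n ^ j * s n t1) \<le> (\<Sum>n\<in>I. wt n ^ j * (norm (a t1 n) + \<delta>))"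
        by (intro sum_mono mult_left_mono s_le) auto
      also have "\<dots> = (\<Sum>n\<in>I. wt n ^ j * norm (a t1 n)) + \<delta> * W"
        by (simp only: W_def sum_distrib_left sum.distrib distrib_left mult.commute[of \<delta>])
      also have "(\<Sum>n\<in>I. wt n ^ j * norm (a t1 n)) \<le> wnorm j (a t1)"
        by (rule sum_le_wnorm[OF ra I]) (use t12 in auto)
      finally show "(\<Sum>n\<in>I. wt n ^ j * s n t1) \<le> wnorm j (a t1) + \<delta> * W" by simp
    qed simp
    finally show "(\<Sum>n\<in>F. wt n ^ j * norm (a t2 n)) * R t2 powr \<kappa> \<le> wnorm j (a t1) * R t1 powr \<kappa> + \<epsilon>"
      using \<delta>(3) by (simp add: distrib_right)
  qed
  have R2: "R t2 powr \<kappa> > 0" using R_pos[of t2] t12 by simp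
  have "wnorm j (a t2) \<le> wnorm j (a t1) * R t1 powr \<kappa> / R t2 powr \<kappa>"
    by (rule wnorm_leI) (use fin R2 in \<open>auto simp: pos_le_divide_eq\<close>)
  then show ?thesis using R2 by (simp add: pos_le_divide_eq)
qed

section \<open>The flow in terms of speed and tangent angle\<close>

lemma not_bot_at_within_atLeast: "(t::real) \<ge> 0 \<Longrightarrow> at t within {0..} \<noteq> bot"
proof -
  assume "t \<ge> 0"
  then have "t islimpt {t..t + 1}" by (intro islimpt_Icc[THEN iffD2]) auto
  then have "t islimpt {0..}" by (rule islimpt_subset) (use \<open>t \<ge> 0\<close> in auto)
  then show ?thesis by (simp add: trivial_limit_within)
qed

lemma smooth_family_derivatives:
  assumes "smooth_family f" "g \<in> mixed_partials f" "t \<ge> 0"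
  shows "(g t has_vector_derivative partial_u g t u) (at u)"
    and "((\<lambda>r. g r u) has_vector_derivative partial_t g t u) (at t within {0..})"
  using assms unfolding smooth_family_def partial_u_def partial_t_def
  by (simp_all add: vector_derivative_works[symmetric])

lemma smooth_family_continuous:
  assumes "smooth_family f" "g \<in> mixed_partials f"
  shows "continuous_on ({0..} \<times> UNIV) (\<lambda>(t, u). g t u)"
  using assms by (simp add: smooth_family_def)

lemma continuous_slice:
  assumes "continuous_on (T \<times> UNIV) (\<lambda>(t, u). g t u)" "t \<in> T"
  shows "continuous_on A (g t)"
proof -
  have "continuous_on A (\<lambda>u. (t, u))" by (intro continuous_intros)
  from continuous_on_compose2[OF assms(1) this] show ?thesis using assms(2) by auto
qed

text \<open>Differentiate \<open>g r w - g r a = \<integral> partial_u g r\<close> under the integral sign in \<open>r\<close> and then in \<open>w\<close>.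
  This covers the one-sided time derivative at \<open>t = 0\<close>.\<close>

lemma mixed_partials_commute:
  fixes f :: "real \<Rightarrow> real \<Rightarrow> 'a::banach"
  assumes f: "smooth_family f" and g: "g \<in> mixed_partials f" and t: "t \<ge> 0"
  shows "(partial_t g t has_vector_derivative partial_t (partial_u g) t u) (at u)"
proof -
  define a where "a = u - 1"
  note gu = mixed_partials.step_u[OF g] and gt = mixed_partials.step_t[OF g]
  note gut = mixed_partials.step_t[OF gu]
  note c = smooth_family_continuous[OF f]
  have int: "((\<lambda>y. partial_u g r y) has_integral g r w - g r a) {a..w}" if "r \<ge> 0" "a \<le> w" for r w
    by (rule fundamental_theorem_of_calculus[OF that(2)])
      (rule has_vector_derivative_at_within, rule smooth_family_derivatives[OF f g that(1)])
  have eq: "partial_t g t w - partial_t g t a = integral {a..w} (partial_t (partial_u g) t)" if w: "a \<le> w" for w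
  proof (rule vector_derivative_unique_within[OF not_bot_at_within_atLeast[OF t]])
    have "((\<lambda>r. integral (cbox a w) (partial_u g r)) has_vector_derivative integral (cbox a w) (partial_t (partial_u g) t)) (at t within {0..})"
    proof (rule leibniz_rule_vector_derivative)
      show "((\<lambda>r. partial_u g r y) has_vector_derivative partial_t (partial_u g) r y) (at r within {0..})" 
        if "r \<in> {0..}" for r y
        by (rule smooth_family_derivatives(2)[OF f gu]) (use that in simp)
      show "partial_u g r integrable_on cbox a w" if "r \<in> {0..}" for r
        using int[of r w] w that by (auto simp: integrable_on_def)
      show "continuous_on ({0..} \<times> cbox a w) (\<lambda>(r, y). partial_t (partial_u g) r y)"
        by (rule continuous_on_subset[OF c[OF gut]]) auto
    qed (use t in auto)
    then show "((\<lambda>r. integral {a..w} (partial_u g r)) has_vector_derivative integral {a..w} (partial_t (partial_u g) t)) (at t within {0..})"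
      by simp
    show "((\<lambda>r. integral {a..w} (partial_u g r)) has_vector_derivative partial_t g t w - partial_t g t a) (at t within {0..})"
    proof (rule has_vector_derivative_transform[of t "{0..}"])
      show "((\<lambda>r. g r w - g r a) has_vector_derivative partial_t g t w - partial_t g t a) (at t within {0..})"
        by (intro has_vector_derivative_diff smooth_family_derivatives[OF f g t])
      show "integral {a..w} (partial_u g r) = g r w - g r a" if "r \<in> {0..}" for r
        using int[of r w] w that by (auto intro: integral_unique)
    qed (use t in simp)
  qed
  have "((\<lambda>w. integral {a..w} (partial_t (partial_u g) t)) has_vector_derivative partial_t (partial_u g) t u) (at u within {a..u + 1})"
    by (rule integral_has_vector_derivative[OF continuous_slice[OF c[OF gut]]]) (use t in \<open>auto simp: a_def\<close>)
  moreover have "at u within {a..u + 1} = at u" by (rule at_within_Icc_at) (auto simp: a_def)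
  ultimately have "((\<lambda>w. integral {a..w} (partial_t (partial_u g) t)) has_vector_derivative partial_t (partial_u g) t u) (at u)" by simp
  from has_vector_derivative_add[OF this has_vector_derivative_const[of "partial_t g t a"]]
  have "((\<lambda>w. integral {a..w} (partial_t (partial_u g) t) + partial_t g t a) has_vector_derivative partial_t (partial_u g) t u) (at u)" by simp
  then show ?thesis
  proof (rule has_vector_derivative_transform_within[of _ _ _ _ 1])
    fix w assume "dist w u < 1"
    then have "a \<le> w" by (auto simp: a_def dist_real_def)
    from eq[OF this] show "integral {a..w} (partial_t (partial_u g) t) + partial_t g t a = partial_t g t w"
      by (simp add: algebra_simps)
  qed auto
qed

text \<open>Near \<open>x\<close> the continuous logarithm is \<open>L x + Ln (P y / P x)\<close>, with the principal branch at 1.\<close>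

lemma continuous_log_derivative:
  fixes L P :: "real \<Rightarrow> complex"
  assumes L: "continuous (at x within T) L" and exp: "\<And>y. y \<in> T \<Longrightarrow> P y = exp (L y)" and x: "x \<in> T"
    and P: "(P has_vector_derivative P') (at x within T)"
  shows "(L has_vector_derivative P' / P x) (at x within T)"
proof -
  have Px: "P x \<noteq> 0" using exp[OF x] by simp
  have 1: "((\<lambda>y. P y / P x) has_vector_derivative P' / P x) (at x within T)"
    using has_vector_derivative_mult_left[OF P, of "1 / P x"] by simp
  have 2: "(Ln has_field_derivative 1) (at (P x / P x) within (\<lambda>y. P y / P x) ` T)"
    using Px has_field_derivative_Ln[of 1] by (auto intro: has_field_derivative_at_within)
  have "((\<lambda>y. L x + Ln (P y / P x)) has_vector_derivative P' / P x) (at x within T)"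
    using has_vector_derivative_add[OF has_vector_derivative_const field_vector_diff_chain_within[OF 1 2]]
    by (simp add: o_def)
  moreover obtain d where d: "d > 0" "\<And>y. y \<in> T \<Longrightarrow> dist y x < d \<Longrightarrow> dist (L y) (L x) < 1"
    using L unfolding continuous_within_eps_delta by (metis zero_less_one)
  have "L x + Ln (P y / P x) = L y" if "y \<in> T" "dist y x < d" for y
  proof -
    have "P y / P x = exp (L y - L x)" using exp[OF x] exp[OF that(1)] by (simp add: exp_diff)
    moreover have "\<bar>Im (L y - L x)\<bar> < 1"
      using d(2)[OF that] abs_Im_le_cmod[of "L y - L x"] by (simp add: dist_norm)
    then have "Ln (exp (L y - L x)) = L y - L x"
      using pi_ge_two by (intro Ln_exp) linarith+
    ultimately show ?thesis by simp
  qed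
  ultimately show ?thesis using d(1) x
    by (auto intro: has_vector_derivative_transform_within)
qed

definition plane :: "complex \<Rightarrow> real^2" where "plane w = vector [Re w, Im w]"

definition of_plane :: "real^2 \<Rightarrow> complex" where "of_plane w = Complex (w $ 1) (w $ 2)"

lemma plane_of_plane [simp]: "plane (of_plane w) = w"
  by (simp add: plane_def of_plane_def vec_eq_iff forall_2)

lemma of_plane_plane [simp]: "of_plane (plane w) = w"
  by (simp add: plane_def of_plane_def)

lemma inner_plane: "plane a \<bullet> plane b = a \<bullet> b"
  by (simp add: plane_def inner_vec_def sum_2 inner_complex_def)

lemma norm_plane: "norm (plane a) = norm a"
  by (simp add: norm_eq_sqrt_inner inner_plane)

lemma norm_of_plane: "norm (of_plane a) = norm a"
  using norm_plane[of "of_plane a"] by simp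

lemma bounded_linear_plane: "bounded_linear plane"
proof (rule bounded_linear_intro[where K = 1])
  show "plane (a + b) = plane a + plane b" "plane (r *\<^sub>R a) = r *\<^sub>R plane a" for a b r
    by (simp_all add: plane_def vec_eq_iff forall_2)
qed (simp add: norm_plane)

lemma bounded_linear_of_plane: "bounded_linear of_plane"
proof (rule bounded_linear_intro[where K = 1])
  show "of_plane (a + b) = of_plane a + of_plane b" "of_plane (r *\<^sub>R a) = r *\<^sub>R of_plane a" for a b r
    by (simp_all add: of_plane_def complex_eq_iff)
qed (simp add: norm_of_plane)

lemma rot90_plane: "rot90 (plane a) = plane (\<i> * a)"
  by (simp add: rot90_def plane_def)

definition angle_curvature :: "(real \<Rightarrow> real \<Rightarrow> real) \<Rightarrow> (real \<Rightarrow> real \<Rightarrow> real) \<Rightarrow> real \<Rightarrow> real \<Rightarrow> real" where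
  "angle_curvature \<theta> v t u = partial_u \<theta> t u / v t u"

text \<open>This is \<open>- (k\<^sub>s\<^sub>s + k\<^sup>3 / 2)\<close> for a curve with tangent angle \<open>\<theta>\<close> and speed \<open>v\<close>.\<close>

definition normal_velocity :: "(real \<Rightarrow> real \<Rightarrow> real) \<Rightarrow> (real \<Rightarrow> real \<Rightarrow> real) \<Rightarrow> real \<Rightarrow> real \<Rightarrow> real" where
  "normal_velocity \<theta> v t u =
     - (partial_u (\<lambda>t u. partial_u (angle_curvature \<theta> v) t u / v t u) t u / v t u + 1 / 2 * angle_curvature \<theta> v t u ^ 3)"

text \<open>The flow in complex notation.  The unit tangent is \<open>cis \<theta>\<close>, the unit normal \<open>\<i> * cis \<theta>\<close>, and \<open>m\<close>
  is the turning number.\<close>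

locale tangent_angle_flow =
  fixes z :: "real \<Rightarrow> real \<Rightarrow> complex" and \<theta> v :: "real \<Rightarrow> real \<Rightarrow> real" and m :: int
  assumes z_smooth: "u_smooth {0..} z" and \<theta>_smooth: "u_smooth {0..} \<theta>" and v_smooth: "u_smooth {0..} v"
    and v_pos: "t \<ge> 0 \<Longrightarrow> v t u > 0"
    and z_u: "t \<ge> 0 \<Longrightarrow> (z t has_vector_derivative v t u * cis (\<theta> t u)) (at u)"
    and z_t: "t \<ge> 0 \<Longrightarrow> ((\<lambda>r. z r u) has_vector_derivative \<i> * normal_velocity \<theta> v t u * cis (\<theta> t u)) (at t within {0..})"
    and \<theta>_t: "t \<ge> 0 \<Longrightarrow> ((\<lambda>r. \<theta> r u) has_vector_derivative partial_u (normal_velocity \<theta> v) t u / v t u) (at t within {0..})"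
    and v_t: "t \<ge> 0 \<Longrightarrow> ((\<lambda>r. v r u) has_vector_derivative - normal_velocity \<theta> v t u * partial_u \<theta> t u) (at t within {0..})"
    and \<theta>_ut: "t \<ge> 0 \<Longrightarrow> ((\<lambda>r. partial_u \<theta> r u) has_vector_derivative
        partial_u (\<lambda>t u. partial_u (normal_velocity \<theta> v) t u / v t u) t u) (at t within {0..})"
    and z_period: "t \<ge> 0 \<Longrightarrow> z t (u + 1) = z t u"
    and \<theta>_period: "t \<ge> 0 \<Longrightarrow> \<theta> t (u + 1) = \<theta> t u + 2 * pi * m"

lemma u_smooth_angle_curvature:
  assumes "u_smooth T \<theta>" "u_smooth T v" "\<And>t u. t \<in> T \<Longrightarrow> v t u > 0"
  shows "u_smooth T (angle_curvature \<theta> v)" "u_smooth T (normal_velocity \<theta> v)"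
proof -
  show k: "u_smooth T (angle_curvature \<theta> v)" unfolding angle_curvature_def[abs_def]
    by (intro u_smooth_divide u_smooth_partial assms) (use assms(3) in \<open>auto simp: less_imp_neq[symmetric]\<close>)
  show "u_smooth T (normal_velocity \<theta> v)" unfolding normal_velocity_def[abs_def]
    by (intro u_smooth_divide u_smooth_minus u_smooth_add u_smooth_mult u_smooth_power u_smooth_const u_smooth_partial k assms continuous_intros)
      (use assms(3) in \<open>auto simp: less_imp_neq[symmetric]\<close>)
qed

text \<open>The velocity \<open>\<gamma>\<^sub>u\<close> is a nonvanishing function on the contractible set of all \<open>(t, u)\<close> with
  \<open>t \<ge> 0\<close> and so has a continuous logarithm, with real part \<open>ln v\<close> and imaginary part \<open>\<theta>\<close>.  Its
  derivatives are logarithmic derivatives of \<open>\<gamma>\<^sub>u\<close>; writing \<open>\<gamma>\<^sub>u\<^sub>t\<close> as the \<open>u\<close>-derivative of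
  \<open>F \<i> cis \<theta>\<close> gives the evolution of \<open>v\<close> and \<open>\<theta>\<close>.  The increment of \<open>\<theta>\<close> over a period is a
  continuous function with values in the multiples of \<open>2 \<pi>\<close>, hence constant.\<close>

lemma free_elastic_flow_tangent_angle:
  assumes flow: "free_elastic_flow \<gamma>0 \<gamma>"
  obtains z \<theta> v m where "tangent_angle_flow z \<theta> v m"
    "\<And>t u. t \<ge> 0 \<Longrightarrow> \<gamma> t u = plane (z t u)"
    "\<And>t u. t \<ge> 0 \<Longrightarrow> speed (\<gamma> t) u = v t u"
    "\<And>t u. t \<ge> 0 \<Longrightarrow> curvature (\<gamma> t) u = angle_curvature \<theta> v t u"
proof -
  have sf: "smooth_family \<gamma>" and imm: "\<And>t. t \<ge> 0 \<Longrightarrow> immersed_curve (\<gamma> t)"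
    and eq: "\<And>t u. t \<ge> 0 \<Longrightarrow> partial_t \<gamma> t u = - ((arc_deriv (\<gamma> t) (arc_deriv (\<gamma> t) (curvature (\<gamma> t))) u
            + 1 / 2 * curvature (\<gamma> t) u ^ 3) *\<^sub>R unit_normal (\<gamma> t) u)"
    using flow by (auto simp: free_elastic_flow_def)
  note g0 = mixed_partials.base[of \<gamma>]
  note g1 = mixed_partials.step_u[OF g0]
  note g2 = mixed_partials.step_u[OF g1]
  interpret op: bounded_linear of_plane by (rule bounded_linear_of_plane)
  interpret pl: bounded_linear plane by (rule bounded_linear_plane)
  define z where "z t u = of_plane (\<gamma> t u)" for t u
  define p where "p t u = of_plane (partial_u \<gamma> t u)" for t u
  define pu where "pu t u = of_plane (partial_u (partial_u \<gamma>) t u)" for t u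
  define zt where "zt t u = of_plane (partial_t \<gamma> t u)" for t u
  define pt where "pt t u = of_plane (partial_t (partial_u \<gamma>) t u)" for t u
  define put where "put t u = of_plane (partial_t (partial_u (partial_u \<gamma>)) t u)" for t u
  have z_smooth: "u_smooth {0..} z" unfolding z_def[abs_def]
    by (rule u_smooth_linear[OF bounded_linear_of_plane smooth_family_imp_u_smooth[OF sf]])
  have p_smooth: "u_smooth {0..} p" unfolding p_def[abs_def]
    by (rule u_smooth_linear[OF bounded_linear_of_plane u_smooth_partial[OF smooth_family_imp_u_smooth[OF sf]]])
  have pu_smooth: "u_smooth {0..} pu" unfolding pu_def[abs_def]
    by (rule u_smooth_linear[OF bounded_linear_of_plane u_smooth_partial[OF u_smooth_partial[OF smooth_family_imp_u_smooth[OF sf]]]])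
  have zu: "(z t has_vector_derivative p t u) (at u)" if "t \<ge> 0" for t u
    unfolding z_def[abs_def] p_def by (rule op.has_vector_derivative[OF smooth_family_derivatives(1)[OF sf g0 that]])
  have zt: "((\<lambda>r. z r u) has_vector_derivative zt t u) (at t within {0..})" if "t \<ge> 0" for t u
    unfolding z_def[abs_def] zt_def by (rule op.has_vector_derivative[OF smooth_family_derivatives(2)[OF sf g0 that]])
  have pu: "(p t has_vector_derivative pu t u) (at u)" if "t \<ge> 0" for t u
    unfolding p_def[abs_def] pu_def by (rule op.has_vector_derivative[OF smooth_family_derivatives(1)[OF sf g1 that]])
  have pt: "((\<lambda>r. p r u) has_vector_derivative pt t u) (at t within {0..})" if "t \<ge> 0" for t u
    unfolding p_def[abs_def] pt_def by (rule op.has_vector_derivative[OF smooth_family_derivatives(2)[OF sf g1 that]])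
  have put: "((\<lambda>r. pu r u) has_vector_derivative put t u) (at t within {0..})" if "t \<ge> 0" for t u
    unfolding pu_def[abs_def] put_def by (rule op.has_vector_derivative[OF smooth_family_derivatives(2)[OF sf g2 that]])
  have ztu: "(zt t has_vector_derivative pt t u) (at u)" if "t \<ge> 0" for t u
    unfolding zt_def[abs_def] pt_def by (rule op.has_vector_derivative[OF mixed_partials_commute[OF sf g0 that]])
  have ptu: "(pt t has_vector_derivative put t u) (at u)" if "t \<ge> 0" for t u
    unfolding pt_def[abs_def] put_def by (rule op.has_vector_derivative[OF mixed_partials_commute[OF sf g1 that]])
  have p0: "p t u \<noteq> 0" if "t \<ge> 0" for t u
    using imm[OF that] norm_of_plane[of "partial_u \<gamma> t u"] unfolding p_def immersed_curve_def partial_u_def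
    by (metis norm_eq_zero)
  have "contractible ({0 :: real..} \<times> (UNIV :: real set))"
    by (intro convex_imp_contractible convex_Times) auto
  then obtain l where l: "continuous_on ({0..} \<times> UNIV) l" "\<And>x. x \<in> {0..} \<times> UNIV \<Longrightarrow> (\<lambda>(t, u). p t u) x = exp (l x)"
    by (rule continuous_logarithm_on_contractible[OF u_smooth_continuous[OF p_smooth]]) (use p0 in auto)
  define \<theta> where "\<theta> t u = Im (l (t, u))" for t u
  define v where "v t u = exp (Re (l (t, u)))" for t u
  have pexp: "p t u = exp (l (t, u))" if "t \<ge> 0" for t u using l(2)[of "(t, u)"] that by simp
  have pv: "p t u = v t u * cis (\<theta> t u)" if "t \<ge> 0" for t u
    using pexp[OF that, of u] by (simp add: v_def \<theta>_def exp_eq_polar)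
  have l_slice_u: "continuous (at u) (\<lambda>u. l (t, u))" if "t \<ge> 0" for t u
  proof -
    have "continuous_on UNIV (\<lambda>u. l (t, u))"
      by (rule continuous_on_compose2[OF l(1)]) (use that in \<open>auto intro!: continuous_intros\<close>)
    then show ?thesis by (simp add: continuous_on_eq_continuous_at)
  qed
  have l_slice_t: "continuous (at t within {0..}) (\<lambda>r. l (r, u))" if "t \<ge> 0" for t u
  proof -
    have "continuous_on {0..} (\<lambda>r. l (r, u))"
      by (rule continuous_on_compose2[OF l(1)]) (auto intro!: continuous_intros)
    then show ?thesis using that by (simp add: continuous_on_eq_continuous_within)
  qed
  have lu: "((\<lambda>u. l (t, u)) has_vector_derivative pu t u / p t u) (at u)" if "t \<ge> 0" for t u
    by (rule continuous_log_derivative[of u UNIV _ "p t", simplified]) (auto intro: l_slice_u pu pexp that)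
  have lt: "((\<lambda>r. l (r, u)) has_vector_derivative pt t u / p t u) (at t within {0..})" if "t \<ge> 0" for t u
    by (rule continuous_log_derivative[of t "{0..}" _ "\<lambda>r. p r u"]) (auto intro: l_slice_t pt pexp that)
  have \<theta>u: "(\<theta> t has_vector_derivative Im (pu t u / p t u)) (at u)" if "t \<ge> 0" for t u
    unfolding \<theta>_def[abs_def] by (rule bounded_linear.has_vector_derivative[OF bounded_linear_Im lu[OF that]])
  have \<theta>t: "((\<lambda>r. \<theta> r u) has_vector_derivative Im (pt t u / p t u)) (at t within {0..})" if "t \<ge> 0" for t u
    unfolding \<theta>_def[abs_def] by (rule bounded_linear.has_vector_derivative[OF bounded_linear_Im lt[OF that]])
  have vu: "(v t has_vector_derivative v t u * Re (pu t u / p t u)) (at u)" if "t \<ge> 0" for t u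
  proof -
    have "((\<lambda>u. Re (l (t, u))) has_real_derivative Re (pu t u / p t u)) (at u)"
      using bounded_linear.has_vector_derivative[OF bounded_linear_Re lu[OF that]] by (simp add: has_real_derivative_iff_has_vector_derivative)
    from DERIV_chain2[OF DERIV_exp this] show ?thesis
      unfolding v_def[abs_def] by (simp add: has_real_derivative_iff_has_vector_derivative)
  qed
  have vt: "((\<lambda>r. v r u) has_vector_derivative v t u * Re (pt t u / p t u)) (at t within {0..})" if "t \<ge> 0" for t u
  proof -
    have "((\<lambda>r. Re (l (r, u))) has_real_derivative Re (pt t u / p t u)) (at t within {0..})"
      using bounded_linear.has_vector_derivative[OF bounded_linear_Re lt[OF that]] by (simp add: has_real_derivative_iff_has_vector_derivative)
    from DERIV_chain2[OF DERIV_exp this] show ?thesis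
      unfolding v_def[abs_def] by (simp add: has_real_derivative_iff_has_vector_derivative)
  qed
  have q_smooth: "u_smooth {0..} (\<lambda>t u. pu t u / p t u)"
    by (rule u_smooth_divide[OF pu_smooth p_smooth]) (use p0 in auto)
  have v_pos: "v t u > 0" for t u by (simp add: v_def)
  have \<theta>_smooth: "u_smooth {0..} \<theta>"
  proof (rule u_smoothI)
    show "continuous_on ({0..} \<times> UNIV) (\<lambda>(t, u). \<theta> t u)"
      using l(1) unfolding \<theta>_def by (auto simp: case_prod_unfold intro: continuous_intros)
    show "u_smooth {0..} (\<lambda>t u. Im (pu t u / p t u))" by (rule u_smooth_linear[OF bounded_linear_Im q_smooth])
  qed (use \<theta>u in auto)
  have v_smooth: "u_smooth {0..} v"
  proof (rule u_smooth_linear_ode)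
    show "continuous_on ({0..} \<times> UNIV) (\<lambda>(t, u). v t u)"
      using l(1) unfolding v_def by (auto simp: case_prod_unfold intro!: continuous_intros)
    show "u_smooth {0..} (\<lambda>t u. Re (pu t u / p t u))" by (rule u_smooth_linear[OF bounded_linear_Re q_smooth])
  qed (use vu in auto)
  define k where "k = angle_curvature \<theta> v"
  define F where "F = normal_velocity \<theta> v"
  have kF_smooth: "u_smooth {0..} k" "u_smooth {0..} F"
    unfolding k_def F_def by (intro u_smooth_angle_curvature \<theta>_smooth v_smooth v_pos)+
  have \<gamma>z: "\<gamma> t u = plane (z t u)" for t u by (simp add: z_def)
  have speed: "speed (\<gamma> t) u = v t u" if "t \<ge> 0" for t u
  proof -
    have "speed (\<gamma> t) u = norm (p t u)" by (simp add: speed_def p_def norm_of_plane partial_u_def)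
    then show ?thesis using v_pos[of t u] by (simp add: pv[OF that] norm_mult)
  qed
  have tangent: "arc_deriv (\<gamma> t) (\<gamma> t) u = plane (cis (\<theta> t u))" if "t \<ge> 0" for t u
  proof -
    have "vector_derivative (\<gamma> t) (at u) = plane (p t u)" by (simp add: p_def partial_u_def)
    also have "\<dots> = plane (v t u *\<^sub>R cis (\<theta> t u))" by (simp add: pv[OF that] scaleR_conv_of_real)
    finally show ?thesis using v_pos[of t u] by (simp add: arc_deriv_def speed[OF that] pl.scaleR)
  qed
  have normal: "unit_normal (\<gamma> t) u = plane (\<i> * cis (\<theta> t u))" if "t \<ge> 0" for t u
    by (simp add: unit_normal_def unit_tangent_def tangent[OF that] rot90_plane)
  have cis_u: "((\<lambda>u. cis (\<theta> t u)) has_vector_derivative partial_u \<theta> t u *\<^sub>R (\<i> * cis (\<theta> t u))) (at u)" if "t \<ge> 0" for t u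
    using has_derivative_cis[OF u_smooth_derivative[OF \<theta>_smooth, of t u, unfolded has_vector_derivative_def]] that
    by (simp add: has_vector_derivative_def)
  have curv: "curvature (\<gamma> t) u = k t u" if "t \<ge> 0" for t u
  proof -
    have "arc_deriv (\<gamma> t) (\<gamma> t) = (\<lambda>u. plane (cis (\<theta> t u)))" using tangent[OF that] by blast
    then have "vector_derivative (arc_deriv (\<gamma> t) (\<gamma> t)) (at u) = plane (partial_u \<theta> t u *\<^sub>R (\<i> * cis (\<theta> t u)))"
      using vector_derivative_at[OF pl.has_vector_derivative[OF cis_u[OF that]]] by simp
    then have "curvature (\<gamma> t) u = (1 / v t u) * (partial_u \<theta> t u * ((\<i> * cis (\<theta> t u)) \<bullet> (\<i> * cis (\<theta> t u))))"
      by (simp add: curvature_def normal[OF that] arc_deriv_def[of _ "arc_deriv _ _"] speed[OF that] pl.scaleR inner_plane)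
    moreover have "(\<i> * cis (\<theta> t u)) \<bullet> (\<i> * cis (\<theta> t u)) = 1"
      unfolding power2_norm_eq_inner[symmetric] by (simp add: norm_mult)
    ultimately show ?thesis by (simp add: k_def angle_curvature_def)
  qed
  have arc: "arc_deriv (\<gamma> t) (f t) u = partial_u f t u / v t u" if "t \<ge> 0" for t u and f :: "real \<Rightarrow> real \<Rightarrow> real"
    by (simp add: arc_deriv_def speed[OF that] partial_u_def)
  have ztF: "zt t u = \<i> * F t u * cis (\<theta> t u)" if "t \<ge> 0" for t u
  proof -
    have c: "curvature (\<gamma> t) = k t" using curv[OF that] by blast
    have "arc_deriv (\<gamma> t) (k t) = (\<lambda>u. partial_u k t u / v t u)" using arc[OF that, of k] by blast
    then have "arc_deriv (\<gamma> t) (arc_deriv (\<gamma> t) (curvature (\<gamma> t))) u = partial_u (\<lambda>t u. partial_u k t u / v t u) t u / v t u"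
      using arc[OF that, of "\<lambda>t u. partial_u k t u / v t u" u] c by simp
    then have "partial_t \<gamma> t u = F t u *\<^sub>R plane (\<i> * cis (\<theta> t u))"
      using eq[OF that, of u] by (simp add: c normal[OF that] F_def normal_velocity_def k_def[symmetric] del: minus_add_distrib)
    then have "zt t u = F t u *\<^sub>R (\<i> * cis (\<theta> t u))" by (simp add: zt_def op.scaleR)
    then show ?thesis by (simp add: scaleR_conv_of_real mult_ac)
  qed
  have ptF: "pt t u / p t u = (\<i> * partial_u F t u - F t u * partial_u \<theta> t u) / v t u" if "t \<ge> 0" for t u
  proof -
    have t: "t \<in> {0..}" using that by simp
    have "((\<lambda>u. (\<i> * F t u) * cis (\<theta> t u)) has_vector_derivative
        (\<i> * F t u) * (partial_u \<theta> t u *\<^sub>R (\<i> * cis (\<theta> t u))) + (\<i> * partial_u F t u) * cis (\<theta> t u)) (at u)"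
      by (intro has_vector_derivative_mult cis_u that has_vector_derivative_mult_right has_vector_derivative_of_real
          has_real_derivative_iff_has_vector_derivative[THEN iffD2, OF u_smooth_derivative[OF kF_smooth(2) t]])
    moreover have "zt t = (\<lambda>u. (\<i> * F t u) * cis (\<theta> t u))" using ztF[OF that] by blast
    ultimately have "pt t u = (\<i> * F t u) * (partial_u \<theta> t u *\<^sub>R (\<i> * cis (\<theta> t u))) + (\<i> * partial_u F t u) * cis (\<theta> t u)"
      using ztu[OF that, of u] vector_derivative_unique_at by metis
    also have "\<dots> = (\<i> * partial_u F t u - F t u * partial_u \<theta> t u) * cis (\<theta> t u)"
      by (simp add: scaleR_conv_of_real algebra_simps)
    finally show ?thesis by (simp add: pv[OF that])
  qed
  have Im_pt: "Im (pt t u / p t u) = partial_u F t u / v t u" if "t \<ge> 0" for t u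
    by (simp add: ptF[OF that])
  have Re_pt: "v t u * Re (pt t u / p t u) = - F t u * partial_u \<theta> t u" if "t \<ge> 0" for t u
    using v_pos[of t u] by (simp add: ptF[OF that])
  have \<theta>u_eq: "partial_u \<theta> t u = Im (pu t u / p t u)" if "t \<ge> 0" for t u
    by (rule partial_u_eqI, rule \<theta>u[OF that])
  have \<theta>ut: "((\<lambda>r. partial_u \<theta> r u) has_vector_derivative partial_u (\<lambda>t u. partial_u F t u / v t u) t u) (at t within {0..})"
    if t: "t \<ge> 0" for t u
  proof -
    have quot: "((\<lambda>r. f r / g r) has_vector_derivative (f' * g x - f x * g') / (g x * g x)) (at x within T)"
      if f: "(f has_vector_derivative f') (at x within T)" and g: "(g has_vector_derivative g') (at x within T)" and g0: "g x \<noteq> 0"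
      for f g :: "real \<Rightarrow> complex" and f' g' x T
    proof -
      have "((\<lambda>r. inverse (g r)) has_vector_derivative - (inverse (g x) * g' * inverse (g x))) (at x within T)"
        using Deriv.has_derivative_inverse[OF g0 g[unfolded has_vector_derivative_def]]
        unfolding has_vector_derivative_def by simp
      from has_vector_derivative_mult[OF f this] show ?thesis
        using g0 by (simp add: field_simps)
    qed
    have "((\<lambda>r. Im (pu r u / p r u)) has_vector_derivative Im ((put t u * p t u - pu t u * pt t u) / (p t u * p t u))) (at t within {0..})"
      by (rule bounded_linear.has_vector_derivative[OF bounded_linear_Im quot]) (use put pt p0 t in auto)
    then have 1: "((\<lambda>r. partial_u \<theta> r u) has_vector_derivative Im ((put t u * p t u - pu t u * pt t u) / (p t u * p t u))) (at t within {0..})"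
      by (rule has_vector_derivative_transform[rotated 2]) (use t \<theta>u_eq in auto)
    have "((\<lambda>u. Im (pt t u / p t u)) has_vector_derivative Im ((put t u * p t u - pt t u * pu t u) / (p t u * p t u))) (at u)"
      by (rule bounded_linear.has_vector_derivative[OF bounded_linear_Im quot]) (use ptu pu p0 t in auto)
    then have "((\<lambda>u. partial_u F t u / v t u) has_vector_derivative Im ((put t u * p t u - pt t u * pu t u) / (p t u * p t u))) (at u)"
      by (simp only: Im_pt[OF t])
    then have "partial_u (\<lambda>t u. partial_u F t u / v t u) t u = Im ((put t u * p t u - pt t u * pu t u) / (p t u * p t u))"
      by (simp add: partial_u_def vector_derivative_at)
    with 1 show ?thesis by (simp add: mult.commute)
  qed
  have z_period: "z t (u + 1) = z t u" if "t \<ge> 0" for t u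
    using imm[OF that] by (simp add: z_def immersed_curve_def)
  have p_period: "p t (u + 1) = p t u" if "t \<ge> 0" for t u
    by (rule periodic_deriv[of "z t" 0]) (auto simp: z_period that intro: zu)
  obtain m :: int where m: "\<And>t u. t \<ge> 0 \<Longrightarrow> \<theta> t (u + 1) - \<theta> t u = 2 * pi * m"
  proof -
    define h where "h x = (\<theta> (fst x) (snd x + 1) - \<theta> (fst x) (snd x)) / (2 * pi)" for x
    have hint: "\<exists>n::int. h x = of_int n" if x0: "x \<in> {0..} \<times> UNIV" for x
    proof -
      obtain t u where x: "x = (t, u)" "t \<ge> 0" using x0 by (cases x) auto
      have "exp (l (t, u + 1)) = exp (l (t, u))" using p_period[of t u] pexp x(2) by metis
      then obtain n :: int where "l (t, u + 1) = l (t, u) + (of_int (2 * n) * pi) * \<i>" unfolding exp_eq by blast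
      then have "h x = of_int n" by (simp add: h_def x \<theta>_def)
      then show ?thesis by blast
    qed
    have "h constant_on {0..} \<times> UNIV"
    proof (rule continuous_discrete_range_constant)
      show "connected ({0 :: real..} \<times> (UNIV :: real set))" by (intro convex_connected convex_Times) auto
      have c: "continuous_on ({0..} \<times> UNIV) (\<lambda>x. \<theta> (fst x) (snd x))"
        using u_smooth_continuous[OF \<theta>_smooth] by (simp add: case_prod_unfold)
      have "continuous_on ({0..} \<times> UNIV) (\<lambda>x. \<theta> (fst x) (snd x + 1))"
        by (rule continuous_on_compose2[OF c, of _ "\<lambda>x. (fst x, snd x + 1)", simplified]) (auto intro!: continuous_intros)
      then show "continuous_on ({0..} \<times> UNIV) h" unfolding h_def
        by (intro continuous_intros c) auto
      fix x :: "real \<times> real" assume x: "x \<in> {0..} \<times> UNIV"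
      show "\<exists>e>0. \<forall>y. y \<in> {0..} \<times> UNIV \<and> h y \<noteq> h x \<longrightarrow> e \<le> norm (h y - h x)"
      proof (intro exI[of _ 1] conjI allI impI)
        fix y assume y: "y \<in> {0..} \<times> UNIV \<and> h y \<noteq> h x"
        then obtain a b :: int where ab: "h x = of_int a" "h y = of_int b" using hint x by blast
        with y have "1 \<le> \<bar>b - a\<bar>" by auto
        then have "(1::real) \<le> of_int \<bar>b - a\<bar>" by (simp only: of_int_1_le_iff)
        with ab show "1 \<le> norm (h y - h x)" by simp
      qed simp
    qed
    then obtain c where c: "\<And>x. x \<in> {0..} \<times> UNIV \<Longrightarrow> h x = c" unfolding constant_on_def by blast
    obtain n :: int where "h (0, 0) = of_int n" using hint[of "(0,0)"] by auto
    then have "c = of_int n" using c[of "(0,0)"] by simp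
    then have "\<theta> t (u + 1) - \<theta> t u = 2 * pi * n" if "t \<ge> 0" for t u
      using c[of "(t, u)"] that by (simp add: h_def field_simps)
    then show ?thesis using that by blast
  qed
  have "tangent_angle_flow z \<theta> v m"
  proof
    fix t u :: real assume t: "t \<ge> 0"
    show "(z t has_vector_derivative v t u * cis (\<theta> t u)) (at u)" using zu[OF t, of u] pv[OF t] by simp
    show "((\<lambda>r. z r u) has_vector_derivative \<i> * normal_velocity \<theta> v t u * cis (\<theta> t u)) (at t within {0..})"
      using zt[OF t, of u] ztF[OF t, of u] by (simp add: F_def)
    show "((\<lambda>r. \<theta> r u) has_vector_derivative partial_u (normal_velocity \<theta> v) t u / v t u) (at t within {0..})"
      using \<theta>t[OF t, of u] Im_pt[OF t, of u] by (simp add: F_def)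
    show "((\<lambda>r. v r u) has_vector_derivative - normal_velocity \<theta> v t u * partial_u \<theta> t u) (at t within {0..})"
      using vt[OF t, of u] Re_pt[OF t, of u] by (simp add: F_def)
    show "((\<lambda>r. partial_u \<theta> r u) has_vector_derivative
        partial_u (\<lambda>t u. partial_u (normal_velocity \<theta> v) t u / v t u) t u) (at t within {0..})"
      using \<theta>ut[OF t, of u] by (simp add: F_def)
    show "z t (u + 1) = z t u" by (rule z_period[OF t])
    show "\<theta> t (u + 1) = \<theta> t u + 2 * pi * m" using m[OF t, of u] by simp
  qed (use z_smooth \<theta>_smooth v_smooth v_pos in auto)
  then show ?thesis using \<gamma>z speed curv unfolding k_def by (rule that)
qed

section \<open>Evolution of the Fourier coefficients\<close>

text \<open>The sign \<open>\<sigma>\<close> of the turning number allows for both orientations.\<close>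

locale winding_flow = tangent_angle_flow z \<theta> v "\<sigma> * int \<omega>"
  for z \<theta> v and \<sigma> :: int and \<omega> :: nat +
  assumes \<omega>_ge_1: "\<omega> \<ge> 1" and \<sigma>_cases: "\<sigma> = 1 \<or> \<sigma> = - 1"
begin

abbreviation F :: "real \<Rightarrow> real \<Rightarrow> real" where "F \<equiv> normal_velocity \<theta> v"

text \<open>The curvature with the sign for which it is positive on a circle of either orientation.\<close>

definition \<kappa> :: "real \<Rightarrow> real \<Rightarrow> real" where "\<kappa> t u = \<sigma> * angle_curvature \<theta> v t u"

text \<open>The tangent angle, normalised to increase by 1 over one period for either orientation.\<close>

definition x :: "real \<Rightarrow> real \<Rightarrow> real" where "x t u = \<sigma> * \<theta> t u / (2 * pi * \<omega>)"

definition L :: "real \<Rightarrow> real" where "L t = integral {0..1} (v t)"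

text \<open>The mean of the radius of curvature with respect to the tangent angle.\<close>

definition R0 :: real where "R0 = L 0 / (2 * pi * \<omega>)"

text \<open>The radius of the circle that starts with radius \<open>R0\<close> and moves by the flow.\<close>

definition R :: "real \<Rightarrow> real" where "R t = (2 * t + R0 ^ 4) powr (1 / 4)"

definition rho :: "real \<Rightarrow> real \<Rightarrow> complex" where "rho t u = of_real (1 / \<kappa> t u)"

text \<open>The relative deviation of the radius of curvature from \<open>R\<close>.\<close>

definition g :: "real \<Rightarrow> real \<Rightarrow> complex" where "g t u = of_real (1 / (\<kappa> t u * R t) - 1)"

text \<open>The relative deviation of the curvature from \<open>1 / R\<close>.\<close>

definition b :: "real \<Rightarrow> real \<Rightarrow> complex" where "b t u = of_real (\<kappa> t u * R t - 1)"

text \<open>The decay rates \<open>\<mu>\<^sub>n\<^sup>2 + \<mu>\<^sub>n / 2 + 1 / 2\<close> of the linearised equation, in units of \<open>R\<^sup>-\<^sup>4\<close>.\<close>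

definition q :: "int \<Rightarrow> real" where
  "q n = (1 - (n / \<omega>)\<^sup>2)\<^sup>2 + (1 - (n / \<omega>)\<^sup>2) / 2 + 1 / 2"

lemma \<sigma>_sq: "real_of_int \<sigma> * real_of_int \<sigma> = 1"
  using \<sigma>_cases by auto

lemma \<sigma>_sq': "real_of_int \<sigma> * (real_of_int \<sigma> * a) = a"
  using \<sigma>_cases by auto

lemma curvature_velocity_smooth: "u_smooth {0..} (angle_curvature \<theta> v)" "u_smooth {0..} F"
  by (intro u_smooth_angle_curvature \<theta>_smooth v_smooth v_pos; simp)+

lemma \<theta>_eq: "\<theta> t u = \<sigma> * (2 * pi * \<omega> * x t u)"
  using \<omega>_ge_1 \<sigma>_cases by (auto simp: x_def)

lemma L_pos: "t \<ge> 0 \<Longrightarrow> L t > 0"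
proof -
  assume t: "t \<ge> 0"
  have c: "continuous_on {0..1} (v t)" by (rule u_smooth_continuous_slice[OF v_smooth]) (use t in simp)
  obtain w where w: "w \<in> {0..1}" "\<And>u. u \<in> {0..1} \<Longrightarrow> v t w \<le> v t u"
    using continuous_attains_inf[of "{0..1::real}" "v t"] c by auto
  have "integral {0..1} (\<lambda>u::real. v t w) \<le> L t"
    unfolding L_def by (rule integral_le) (use w c in \<open>auto intro: integrable_continuous_real\<close>)
  then show "L t > 0" using v_pos[OF t, of w] by simp
qed

lemma R0_pos: "R0 > 0"
  using L_pos[of 0] \<omega>_ge_1 by (simp add: R0_def)

lemma R4_pos: "t \<ge> 0 \<Longrightarrow> 2 * t + R0 ^ 4 > 0"
  using R0_pos by (intro add_nonneg_pos) auto

lemma R_pos: "t \<ge> 0 \<Longrightarrow> R t > 0"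
  using R4_pos[of t] by (simp add: R_def)

lemma R_0: "R 0 = R0"
  using R0_pos by (simp add: R_def powr_numeral[symmetric] powr_powr del: powr_numeral)

lemma R_deriv: 
  assumes t: "t \<ge> 0"
  shows "(R has_real_derivative 1 / (2 * R t ^ 3)) (at t within T)"
proof -
  note p = R4_pos[OF t]
  have "((\<lambda>t. 2 * t + R0 ^ 4) has_real_derivative 2) (at t within T)"
    by (auto intro!: derivative_eq_intros)
  from DERIV_chain2[OF has_real_derivative_powr[OF p, of "1 / 4"] this]
  have "(R has_real_derivative 1 / 4 * (2 * t + R0 ^ 4) powr (1 / 4 - 1) * 2) (at t within T)"
    unfolding R_def[abs_def] .
  moreover have "R t ^ 3 = (2 * t + R0 ^ 4) powr (3 / 4)"
    using p by (simp add: R_def powr_numeral[symmetric] powr_powr del: powr_numeral)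
  then have "1 / (2 * R t ^ 3) = 1 / 4 * (2 * t + R0 ^ 4) powr (1 / 4 - 1) * 2"
    using p by (simp add: powr_minus_divide)
  ultimately show ?thesis by (simp only:)
qed

lemma R_cont: "continuous_on {0..} R"
  by (rule DERIV_continuous_on[OF R_deriv]) simp

lemma R_at_top: "filterlim R at_top at_top"
  unfolding filterlim_at_top_ge[where c = 0]
proof (intro allI impI)
  fix Z :: real assume Z: "0 \<le> Z"
  show "\<forall>\<^sub>F t in at_top. Z \<le> R t"
    using eventually_ge_at_top[of "Z ^ 4"]
  proof eventually_elim
    case (elim t)
    have "Z = (Z ^ 4) powr (1 / 4)"
      using Z by (cases "Z = 0") (simp_all add: powr_numeral[symmetric] powr_powr del: powr_numeral)
    also have "\<dots> \<le> R t"
      unfolding R_def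
    proof (rule powr_mono2)
      show "Z ^ 4 \<le> 2 * t + R0 ^ 4"
        using elim zero_le_power[OF Z, of 4] zero_le_power[OF less_imp_le[OF R0_pos], of 4] by linarith
    qed (use Z in auto)
    finally show ?case .
  qed
qed

lemma v_period: "t \<ge> 0 \<Longrightarrow> v t (u + 1) = v t u"
proof -
  assume t: "t \<ge> 0"
  have "v t (u + 1) * cis (\<theta> t (u + 1)) = v t u * cis (\<theta> t u)"
    by (rule periodic_deriv[of "z t" 0]) (use t z_period z_u in auto)
  then have "norm (v t (u + 1) * cis (\<theta> t (u + 1))) = norm (v t u * cis (\<theta> t u))" by simp
  then show ?thesis using v_pos[OF t, of u] v_pos[OF t, of "u + 1"] by (simp add: norm_mult)
qed

lemma \<kappa>_period: "t \<ge> 0 \<Longrightarrow> \<kappa> t (u + 1) = \<kappa> t u"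
proof -
  assume t: "t \<ge> 0"
  have "partial_u \<theta> t (u + 1) = partial_u \<theta> t u"
    by (rule periodic_deriv[of "\<theta> t" "2 * pi * (\<sigma> * int \<omega>)"])
      (use t \<theta>_period u_smooth_derivative[OF \<theta>_smooth] in auto)
  then show ?thesis using v_period[OF t] by (simp add: \<kappa>_def angle_curvature_def)
qed

lemma \<kappa>_smooth: "u_smooth {0..} \<kappa>"
  unfolding \<kappa>_def[abs_def] by (intro u_smooth_mult u_smooth_const curvature_velocity_smooth) auto

lemma \<theta>_u_eq: "t \<ge> 0 \<Longrightarrow> partial_u \<theta> t u = \<sigma> * \<kappa> t u * v t u"
  using v_pos[of t u] \<sigma>_cases by (auto simp: \<kappa>_def angle_curvature_def)

lemma x_derivative:
  assumes t: "t \<ge> 0"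
  shows "(x t has_vector_derivative \<kappa> t u * v t u / (2 * pi * \<omega>)) (at u)"
proof -
  have "((\<lambda>u. (\<sigma> / (2 * pi * \<omega>)) * \<theta> t u) has_vector_derivative (\<sigma> / (2 * pi * \<omega>)) * partial_u \<theta> t u) (at u)"
    by (intro has_vector_derivative_mult_right u_smooth_derivative[OF \<theta>_smooth]) (use t in simp)
  then show ?thesis by (simp add: x_def[abs_def] \<theta>_u_eq[OF t] \<sigma>_sq' mult.assoc)
qed

lemma x_u_eq: "t \<ge> 0 \<Longrightarrow> partial_u x t u = \<kappa> t u * v t u / (2 * pi * \<omega>)"
  by (rule partial_u_eqI, rule x_derivative)

lemma coordinate_smooth: "u_smooth {0..} x"
  unfolding x_def[abs_def] times_divide_eq_left[symmetric]
  by (intro u_smooth_divide u_smooth_mult u_smooth_const \<theta>_smooth continuous_intros) (use \<omega>_ge_1 in auto)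

lemma coordinate_period:
  assumes "t \<ge> 0"
  shows "x t (u + 1) = x t u + 1"
  unfolding x_def \<theta>_period[OF assms] using \<omega>_ge_1 \<sigma>_cases by (auto simp: field_simps)

lemma cont_slices:
  assumes "u_smooth {0..} f" "t \<ge> 0"
  shows "continuous_on A (f t)"
  by (rule u_smooth_continuous_slice[OF assms(1)]) (use assms(2) in simp)

context
  fixes S :: "real set"
  assumes S: "S \<subseteq> {0..}" and pos: "\<And>t u. t \<in> S \<Longrightarrow> \<kappa> t u > 0"
begin

lemma circle: "multiple_moving_circle S x \<omega>"
proof
  show "u_smooth S x" by (rule u_smooth_subset[OF coordinate_smooth S])
  fix t u assume t: "t \<in> S"
  then have t0: "t \<ge> 0" using S by auto
  show "partial_u x t u > 0" using pos[OF t, of u] v_pos[OF t0, of u] \<omega>_ge_1 by (simp add: x_u_eq[OF t0])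
  show "x t (u + 1) = x t u + 1" by (rule coordinate_period[OF t0])
qed (use \<omega>_ge_1 in simp)

interpretation M: multiple_moving_circle S x \<omega> by (rule circle)

lemma time_nonneg: "t \<in> S \<Longrightarrow> t \<ge> 0" using S by auto

lemma smooth_periodic_of_real:
  assumes "u_smooth {0..} f" "\<And>t u. t \<ge> 0 \<Longrightarrow> f t (u + 1) = f t u"
  shows "M.smooth_periodic (\<lambda>t u. of_real (f t u))"
  unfolding M.smooth_periodic_def using assms time_nonneg by (auto intro!: u_smooth_of_real u_smooth_subset[OF assms(1) S])

lemma smooth_periodic_\<kappa>: "M.smooth_periodic (\<lambda>t u. of_real (\<kappa> t u))"
  by (rule smooth_periodic_of_real[OF \<kappa>_smooth \<kappa>_period])

lemma R_cont_S: "continuous_on S R"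
  by (rule continuous_on_subset[OF R_cont S])

lemma smooth_periodic_b: "M.smooth_periodic b"
  unfolding b_def[abs_def] of_real_diff of_real_mult
  by (intro M.smooth_periodic_diff M.smooth_periodic_mult smooth_periodic_\<kappa> M.smooth_periodic_const continuous_intros R_cont_S)

lemma smooth_periodic_inverse: "M.smooth_periodic f \<Longrightarrow> (\<And>t u. t \<in> S \<Longrightarrow> f t u \<noteq> 0) \<Longrightarrow> M.smooth_periodic (\<lambda>t u. inverse (f t u))"
  unfolding M.smooth_periodic_def by (auto intro: u_smooth_inverse)

lemma smooth_periodic_rho: "M.smooth_periodic rho"
proof -
  have "M.smooth_periodic (\<lambda>t u. inverse (of_real (\<kappa> t u)))"
    by (rule smooth_periodic_inverse[OF smooth_periodic_\<kappa>]) (use pos in \<open>auto simp: less_imp_neq[symmetric]\<close>)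
  then show ?thesis by (simp add: rho_def[abs_def] inverse_eq_divide)
qed

lemma g_rho: "g t u = rho t u * of_real (1 / R t) + of_real (-1)"
  by (simp add: g_def rho_def)

lemma smooth_periodic_g: "M.smooth_periodic g"
  unfolding g_rho[abs_def]
  by (intro M.smooth_periodic_add M.smooth_periodic_mult smooth_periodic_rho M.smooth_periodic_const continuous_intros R_cont_S)
    (use R_pos time_nonneg in \<open>auto simp: less_imp_neq[symmetric]\<close>)

lemma reciprocal: "t \<in> S \<Longrightarrow> (1 + b t u) * (1 + g t u) = 1"
  using pos[of t u] R_pos[OF time_nonneg, of t] by (simp add: b_def g_def field_simps flip: of_real_mult of_real_add)

lemma D_of_real:
  assumes f: "u_smooth {0..} f" and t: "t \<in> S"
  shows "M.D (\<lambda>t u. of_real (f t u)) t u = of_real (2 * pi * \<omega> * partial_u f t u / (\<kappa> t u * v t u))"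
proof -
  have "partial_u (\<lambda>t u. complex_of_real (f t u)) t u = of_real (partial_u f t u)"
  proof (rule partial_u_eqI, rule has_vector_derivative_of_real, rule has_real_derivative_iff_has_vector_derivative[THEN iffD2])
    show "(f t has_vector_derivative partial_u f t u) (at u)"
      by (rule u_smooth_derivative[OF f]) (use time_nonneg[OF t] in simp)
  qed
  then show ?thesis by (simp add: M.D_def x_u_eq[OF time_nonneg[OF t]])
qed

text \<open>As \<open>d/d\<theta> = \<kappa>\<^sup>-\<^sup>1 d/ds\<close> up to the sign \<open>\<sigma>\<close>, the second derivative of \<open>\<kappa>\<^sup>2\<close> with respect to \<open>\<theta>\<close> is
  \<open>2 \<kappa>\<^sub>s\<^sub>s / \<kappa>\<close>.\<close>

lemma velocity_eq:
  assumes t: "t \<in> S"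
  shows "of_real (\<sigma> * F t u) = - (1 / 2) * (of_real (\<kappa> t u) * M.A (\<lambda>t u. (of_real (\<kappa> t u))\<^sup>2) t u)"
proof -
  note t0 = time_nonneg[OF t]
  have k: "u_smooth {0..} \<kappa>" by (rule \<kappa>_smooth)
  have v: "u_smooth {0..} (\<lambda>t u. partial_u \<kappa> t u / v t u)"
    by (intro u_smooth_divide u_smooth_partial k v_smooth) (use v_pos in \<open>auto simp: less_imp_neq[symmetric]\<close>)
  have k2: "u_smooth {0..} (\<lambda>t u. (\<kappa> t u)\<^sup>2)" by (rule u_smooth_power[OF k])
  have d1: "M.D (\<lambda>t u. of_real ((\<kappa> t u)\<^sup>2)) t w = of_real (4 * pi * \<omega> * (partial_u \<kappa> t w / v t w))" for w
  proof -
    have "((\<lambda>u. (\<kappa> t u)\<^sup>2) has_real_derivative 2 * \<kappa> t w * partial_u \<kappa> t w) (at w)"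
      using u_smooth_derivative[OF k, of t w] t0
      by (auto intro!: derivative_eq_intros simp: has_real_derivative_iff_has_vector_derivative[symmetric])
    then have "partial_u (\<lambda>t u. (\<kappa> t u)\<^sup>2) t w = 2 * \<kappa> t w * partial_u \<kappa> t w"
      by (intro partial_u_eqI) (simp add: has_real_derivative_iff_has_vector_derivative)
    then show ?thesis unfolding D_of_real[OF k2 t] using pos[OF t, of w] by simp
  qed
  have k4: "u_smooth {0..} (\<lambda>t u. 4 * pi * \<omega> * (partial_u \<kappa> t u / v t u))"
    by (intro u_smooth_mult u_smooth_const v) auto
  have "partial_u (\<lambda>t u. 4 * pi * \<omega> * (partial_u \<kappa> t u / v t u)) t u = 4 * pi * \<omega> * partial_u (\<lambda>t u. partial_u \<kappa> t u / v t u) t u"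
    by (rule partial_u_eqI, rule has_vector_derivative_mult_right, rule u_smooth_derivative[OF v]) (use t0 in simp)
  then have d2: "M.D (M.D (\<lambda>t u. of_real ((\<kappa> t u)\<^sup>2))) t u =
      of_real (8 * pi\<^sup>2 * \<omega>\<^sup>2 * partial_u (\<lambda>t u. partial_u \<kappa> t u / v t u) t u / (\<kappa> t u * v t u))"
    unfolding M.D_cong[of "M.D (\<lambda>t u. of_real ((\<kappa> t u)\<^sup>2))" t "\<lambda>t u. of_real (4 * pi * \<omega> * (partial_u \<kappa> t u / v t u))", OF d1]
    by (simp only: D_of_real[OF k4 t]) (simp add: power2_eq_square)
  have ks: "partial_u (\<lambda>t u. partial_u \<kappa> t u / v t u) t u = \<sigma> * partial_u (\<lambda>t u. partial_u (angle_curvature \<theta> v) t u / v t u) t u"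
  proof -
    have "partial_u \<kappa> t w = \<sigma> * partial_u (angle_curvature \<theta> v) t w" for w
      unfolding \<kappa>_def[abs_def]
      by (rule partial_u_eqI, rule has_vector_derivative_mult_right, rule u_smooth_derivative[OF curvature_velocity_smooth(1)]) (use t0 in simp)
    then have "((\<lambda>u. partial_u \<kappa> t u / v t u) has_vector_derivative
        \<sigma> * partial_u (\<lambda>t u. partial_u (angle_curvature \<theta> v) t u / v t u) t u) (at u)"
    proof -
      assume *: "\<And>w. partial_u \<kappa> t w = \<sigma> * partial_u (angle_curvature \<theta> v) t w"
      have "u_smooth {0..} (\<lambda>t u. partial_u (angle_curvature \<theta> v) t u / v t u)"
        by (intro u_smooth_divide u_smooth_partial curvature_velocity_smooth v_smooth) (use v_pos in \<open>auto simp: less_imp_neq[symmetric]\<close>)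
      from has_vector_derivative_mult_right[OF u_smooth_derivative[OF this, of t u], of "real_of_int \<sigma>"] t0
      show ?thesis by (simp add: *)
    qed
    then show ?thesis by (intro partial_u_eqI)
  qed
  have "M.A (\<lambda>t u. (of_real (\<kappa> t u))\<^sup>2) t u = of_real ((\<kappa> t u)\<^sup>2 +
      2 * partial_u (\<lambda>t u. partial_u \<kappa> t u / v t u) t u / (\<kappa> t u * v t u))"
    using d2 \<omega>_ge_1 by (simp add: M.A_def field_simps power2_eq_square)
  then have "- (1 / 2) * (of_real (\<kappa> t u) * M.A (\<lambda>t u. (of_real (\<kappa> t u))\<^sup>2) t u) =
      complex_of_real (- (1 / 2) * (\<kappa> t u * ((\<kappa> t u)\<^sup>2 + 2 * partial_u (\<lambda>t u. partial_u \<kappa> t u / v t u) t u / (\<kappa> t u * v t u))))"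
    by simp
  also have "- (1 / 2) * (\<kappa> t u * ((\<kappa> t u)\<^sup>2 + 2 * partial_u (\<lambda>t u. partial_u \<kappa> t u / v t u) t u / (\<kappa> t u * v t u))) = \<sigma> * F t u"
  proof -
    have "- (1 / 2) * (\<kappa> t u * ((\<kappa> t u)\<^sup>2 + 2 * partial_u (\<lambda>t u. partial_u \<kappa> t u / v t u) t u / (\<kappa> t u * v t u))) =
      - (partial_u (\<lambda>t u. partial_u \<kappa> t u / v t u) t u / v t u + 1 / 2 * \<kappa> t u ^ 3)"
      using pos[OF t, of u] by (simp add: field_simps power3_eq_cube power2_eq_square)
    also have "\<dots> = \<sigma> * F t u"
      using \<sigma>_cases unfolding ks normal_velocity_def by (auto simp: \<kappa>_def)
    finally show ?thesis .
  qed
  finally show ?thesis by simp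
qed

text \<open>The operator \<open>\<kappa> A(\<kappa>\<^sup>2)\<close> is homogeneous of degree 3.\<close>

lemma velocity_H:
  assumes t: "t \<in> S"
  shows "of_real (\<sigma> * F t u) = - (1 / 2) * of_real (1 / R t ^ 3) * M.H b t u"
proof -
  have R: "R t > 0" by (rule R_pos[OF time_nonneg[OF t]])
  have k: "1 + b t w = of_real (R t) * of_real (\<kappa> t w)" for w by (simp add: b_def)
  have n: "M.smooth_periodic (\<lambda>t u. (of_real (\<kappa> t u))\<^sup>2)" unfolding power2_eq_square by (intro M.smooth_periodic_mult smooth_periodic_\<kappa>)
  have "M.A (\<lambda>t u. (1 + b t u)\<^sup>2) t u = M.A (\<lambda>t' u. (of_real (R t))\<^sup>2 * (of_real (\<kappa> t' u))\<^sup>2) t u"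
    by (rule M.A_cong) (simp add: k power_mult_distrib)
  also have "\<dots> = (of_real (R t))\<^sup>2 * M.A (\<lambda>t u. (of_real (\<kappa> t u))\<^sup>2) t u" by (rule M.A_cmult[OF n t])
  finally have "M.H b t u = of_real (R t ^ 3) * (of_real (\<kappa> t u) * M.A (\<lambda>t u. (of_real (\<kappa> t u))\<^sup>2) t u)"
    by (simp add: M.H_def k power3_eq_cube power2_eq_square)
  then show ?thesis unfolding velocity_eq[OF t] using R by simp
qed

lemma smooth_periodic_F: "M.smooth_periodic (\<lambda>t u. of_real (F t u))"
proof -
  have "M.smooth_periodic (\<lambda>t u. of_int \<sigma> * (- (1 / 2) * (of_real (\<kappa> t u) * M.A (\<lambda>t u. (of_real (\<kappa> t u))\<^sup>2) t u)))"
    unfolding power2_eq_square by (intro M.smooth_periodic_mult M.smooth_periodic_A smooth_periodic_\<kappa> M.smooth_periodic_const continuous_intros)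
  then show ?thesis
  proof (rule M.smooth_periodic_cong)
    fix t u assume t: "t \<in> S"
    have "complex_of_real (F t u) = of_int \<sigma> * of_real (\<sigma> * F t u)" using \<sigma>_cases by auto
    then show "of_real (F t u) = of_int \<sigma> * (- (1 / 2) * (of_real (\<kappa> t u) * M.A (\<lambda>t u. (of_real (\<kappa> t u))\<^sup>2) t u))"
      by (simp only: velocity_eq[OF t])
  qed
qed

lemma coeff_F:
  assumes t: "t \<in> S"
  shows "\<sigma> * M.coeff (\<lambda>t u. of_real (F t u)) t n = - (1 / 2) * of_real (1 / R t ^ 3) * M.coeff (M.H b) t n"
proof -
  have "\<sigma> * M.coeff (\<lambda>t u. of_real (F t u)) t n = M.coeff (\<lambda>t u. \<sigma> * of_real (F t u)) t n"
    using M.coeff_cmult[OF t, of "\<lambda>t. of_int \<sigma>"] by simp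
  also have "\<dots> = M.coeff (\<lambda>t u. (- (1 / 2) * of_real (1 / R t ^ 3)) * M.H b t u) t n"
    using velocity_H[OF t] by (intro M.coeff_cong) simp
  also have "\<dots> = - (1 / 2) * of_real (1 / R t ^ 3) * M.coeff (M.H b) t n"
    by (rule M.coeff_cmult[OF t])
  finally show ?thesis .
qed

lemma coeff_rho_eq:
  assumes t: "t \<in> S"
  shows "M.coeff rho t n = integral {0..1} (\<lambda>u. of_real (v t u / (2 * pi * \<omega>)) * cis (- (2 * pi * n * x t u)))"
  unfolding M.coeff_def fourier_coeff_def
  by (rule integral_cong) (use pos[OF t] in \<open>simp add: rho_def x_u_eq[OF time_nonneg[OF t]] less_imp_neq[symmetric] field_simps\<close>)

lemma coeff_rho_0:
  assumes t: "t \<in> S"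
  shows "M.coeff rho t 0 = of_real (L t) / of_real (2 * pi * \<omega>)"
proof -
  have "M.coeff rho t 0 = integral {0..1} (\<lambda>u. of_real (v t u)) / of_real (2 * pi * \<omega>)"
    by (simp add: coeff_rho_eq[OF t])
  also have "integral {0..1} (\<lambda>u. complex_of_real (v t u)) = of_real (L t)"
    unfolding L_def using integral_linear[OF integrable_continuous_real[OF cont_slices[OF v_smooth time_nonneg[OF t]]] bounded_linear_of_real, of 0 1]
    by (simp add: o_def)
  finally show ?thesis .
qed

lemma x_t: "t \<ge> 0 \<Longrightarrow> ((\<lambda>r. x r u) has_vector_derivative \<sigma> / (2 * pi * \<omega>) * (partial_u F t u / v t u)) (at t within {0..})"
  using has_vector_derivative_mult_right[OF \<theta>_t, of t "\<sigma> / (2 * pi * \<omega>)" u] by (simp add: x_def[abs_def])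

lemma cis_x_t:
  assumes t: "t \<ge> 0"
  shows "((\<lambda>r. cis (c * x r u)) has_vector_derivative
    (c * (\<sigma> / (2 * pi * \<omega>) * (partial_u F t u / v t u))) *\<^sub>R (\<i> * cis (c * x t u))) (at t within {0..})"
  using has_derivative_cis[OF has_vector_derivative_mult_right[OF x_t[OF t], of c u, unfolded has_vector_derivative_def]]
  by (simp add: has_vector_derivative_def)

text \<open>Since \<open>\<rho> d\<theta> = ds\<close>, the coefficient of \<open>\<rho>\<close> is the integral of a function of the tangent angle
  against arc length.  Its time derivative needs only \<open>v\<^sub>t = - F \<theta>\<^sub>u\<close> and \<open>v \<theta>\<^sub>t = F\<^sub>u\<close>, and an
  integration by parts turns \<open>F\<^sub>u\<close> into the factor \<open>n\<^sup>2\<close>.\<close>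

lemma coeff_rho_derivative:
  assumes t: "t \<in> S"
  shows "((\<lambda>r. M.coeff rho r n) has_vector_derivative - \<sigma> * of_real (M.\<mu> n) * M.coeff (\<lambda>t u. of_real (F t u)) t n) (at t within S)"
proof -
  note t0 = time_nonneg[OF t]
  define W where "W r u = of_real (v r u / (2 * pi * \<omega>)) * cis (- (2 * pi * n * x r u))" for r u
  define W' where "W' r u = complex_of_real (v r u / (2 * pi * \<omega>)) *
      (((- (2 * pi * n)) * (\<sigma> / (2 * pi * \<omega>) * (partial_u F r u / v r u))) *\<^sub>R (\<i> * cis ((- (2 * pi * n)) * x r u))) +
      of_real (1 / (2 * pi * \<omega>) * (- F r u * partial_u \<theta> r u)) * cis ((- (2 * pi * n)) * x r u)" for r u
  have Weq: "W r u = of_real (1 / (2 * pi * \<omega>) * v r u) * cis ((- (2 * pi * n)) * x r u)" for r u by (simp add: W_def)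
  have vc: "continuous_on ({0..} \<times> UNIV) (\<lambda>y. f (fst y) (snd y))" if "u_smooth {0..} f" for f :: "real \<Rightarrow> real \<Rightarrow> real"
    using u_smooth_continuous[OF that] by (simp add: case_prod_unfold)
  have Wd: "((\<lambda>r. W r u) has_vector_derivative W' r u) (at r within {0..})" if r: "r \<ge> 0" for r u
  proof -
    have "((\<lambda>r. complex_of_real (1 / (2 * pi * \<omega>) * v r u)) has_vector_derivative of_real (1 / (2 * pi * \<omega>) * (- F r u * partial_u \<theta> r u))) (at r within {0..})"
      by (rule bounded_linear.has_vector_derivative[OF bounded_linear_of_real has_vector_derivative_mult_right[OF v_t[OF r]]])
    from has_vector_derivative_mult[OF this cis_x_t[OF r, of "- (2 * pi * n)" u]]
    show ?thesis unfolding Weq[abs_def] W'_def by simp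
  qed
  have "((\<lambda>r. integral (cbox 0 1) (W r)) has_vector_derivative integral (cbox 0 1) (W' t)) (at t within {0..})"
  proof (rule leibniz_rule_vector_derivative[OF Wd])
    show "W r integrable_on cbox 0 1" if "r \<in> {0..}" for r
    proof -
      have "continuous_on {0..1} (W r)" unfolding W_def
        using that by (intro continuous_intros cont_slices[OF v_smooth] cont_slices[OF coordinate_smooth]) (use \<omega>_ge_1 in auto)
      then show ?thesis by (simp add: integrable_continuous_real)
    qed
    have "continuous_on ({0..} \<times> UNIV) (\<lambda>y. W' (fst y) (snd y))" unfolding W'_def
      by (intro continuous_intros vc v_smooth coordinate_smooth u_smooth_partial curvature_velocity_smooth \<theta>_smooth)
        (use v_pos \<omega>_ge_1 in \<open>auto simp: less_imp_neq[symmetric]\<close>)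
    then have "continuous_on ({0..} \<times> UNIV) (\<lambda>(r, u). W' r u)" by (simp add: case_prod_unfold)
    then show "continuous_on ({0..} \<times> cbox 0 1) (\<lambda>(r, u). W' r u)" by (rule continuous_on_subset) auto
  qed (use t0 in auto)
  then have "((\<lambda>r. integral {0..1} (W r)) has_vector_derivative integral {0..1} (W' t)) (at t within {0..})" by simp
  then have "((\<lambda>r. integral {0..1} (W r)) has_vector_derivative integral {0..1} (W' t)) (at t within S)"
    by (rule has_vector_derivative_within_subset[OF _ S])
  then have d: "((\<lambda>r. M.coeff rho r n) has_vector_derivative integral {0..1} (W' t)) (at t within S)"
    by (rule has_vector_derivative_transform[OF t, rotated]) (simp only: coeff_rho_eq W_def[abs_def])
  let ?Fc = "\<lambda>t u. complex_of_real (F t u)"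
  have "integral {0..1} (W' t) = M.coeff (\<lambda>t u. - \<sigma> * ?Fc t u + (- (\<i> * n * \<sigma> / (2 * pi * \<omega>\<^sup>2))) * M.D ?Fc t u) t n"
    unfolding M.coeff_def fourier_coeff_def
  proof (rule integral_cong)
    fix u
    have xu: "partial_u x t u = \<kappa> t u * v t u / (2 * pi * \<omega>)" by (rule x_u_eq[OF t0])
    define c where "c = cis (- (2 * pi * n * x t u))"
    have c1: "cis ((- (2 * pi * n)) * x t u) = c" by (simp add: c_def)
    have "W' t u = (- (\<i> * n * \<sigma> / (2 * pi * \<omega>\<^sup>2)) * partial_u F t u - \<sigma> * F t u * (\<kappa> t u * v t u / (2 * pi * \<omega>))) * c"
      unfolding W'_def c1 \<theta>_u_eq[OF t0] scaleR_conv_of_real using v_pos[OF t0, of u] \<omega>_ge_1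
      by (simp add: field_simps power2_eq_square)
    also have "\<dots> = (- \<sigma> * ?Fc t u + (- (\<i> * n * \<sigma> / (2 * pi * \<omega>\<^sup>2))) * M.D ?Fc t u) * c * of_real (partial_u x t u)"
      unfolding D_of_real[OF curvature_velocity_smooth(2) t] xu using v_pos[OF t0, of u] pos[OF t, of u] \<omega>_ge_1
      by (simp add: field_simps)
    finally show "W' t u = (- \<sigma> * ?Fc t u + (- (\<i> * n * \<sigma> / (2 * pi * \<omega>\<^sup>2))) * M.D ?Fc t u) *
        cis (- (2 * pi * n * x t u)) * of_real (partial_u x t u)" unfolding c_def .
  qed
  also have "\<dots> = M.coeff (\<lambda>t u. - \<sigma> * ?Fc t u) t n + M.coeff (\<lambda>t u. (- (\<i> * n * \<sigma> / (2 * pi * \<omega>\<^sup>2))) * M.D ?Fc t u) t n"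
    by (intro M.coeff_add t M.smooth_periodic_mult M.smooth_periodic_const M.smooth_periodic_D smooth_periodic_F continuous_intros)
  also have "\<dots> = - \<sigma> * M.coeff ?Fc t n + (- (\<i> * n * \<sigma> / (2 * pi * \<omega>\<^sup>2))) * (2 * pi * \<i> * n * M.coeff ?Fc t n)"
    using M.coeff_cmult[OF t, of "\<lambda>t. of_int (- \<sigma>)"] M.coeff_cmult[OF t, of "\<lambda>t. - (\<i> * n * \<sigma> / (2 * pi * \<omega>\<^sup>2))"]
    by (simp only: M.coeff_D[OF smooth_periodic_F t])
  also have "\<dots> = - \<sigma> * of_real (M.\<mu> n) * M.coeff ?Fc t n"
    using \<omega>_ge_1 by (simp add: M.\<mu>_def field_simps power2_eq_square)
  finally show ?thesis using d by simp
qed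

lemma coeff_g_eq: "t \<in> S \<Longrightarrow> M.coeff g t n = M.coeff rho t n / R t - (if n = 0 then 1 else 0)"
proof -
  assume t: "t \<in> S"
  have "M.smooth_periodic (\<lambda>t u. of_real (1 / R t) * rho t u)"
    by (intro M.smooth_periodic_mult smooth_periodic_rho M.smooth_periodic_const continuous_intros R_cont_S) (use R_pos time_nonneg in \<open>auto simp: less_imp_neq[symmetric]\<close>)
  note n = this
  have "M.coeff g t n = M.coeff (\<lambda>t u. of_real (1 / R t) * rho t u - 1) t n"
    by (rule M.coeff_cong) (simp add: g_rho)
  also have "\<dots> = M.coeff (\<lambda>t u. of_real (1 / R t) * rho t u) t n - M.coeff (\<lambda>t u. 1) t n"
    by (rule M.coeff_diff[OF n M.smooth_periodic_const t]) simp
  also have "\<dots> = of_real (1 / R t) * M.coeff rho t n - (if n = 0 then 1 else 0)"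
    using M.coeff_cmult[OF t, of "\<lambda>t. of_real (1 / R t)" rho n] M.coeff_const[OF t, of "\<lambda>t. 1" n] by simp
  finally show ?thesis by simp
qed

text \<open>The derivative of \<open>\<rho>\<close>, expressed through \<open>H\<close> and split into its linear and nonlinear parts,
  together with \<open>R' = 1 / (2 R\<^sup>3)\<close>.  The growth of \<open>R\<close> contributes the summand \<open>1 / 2\<close> of \<open>q n\<close>,
  and its effect on the mode 0 cancels the constant part of \<open>H\<close>.\<close>

lemma coeff_g_derivative:
  assumes t: "t \<in> S"
  shows "((\<lambda>r. M.coeff g r n) has_vector_derivative
    (1 / R t ^ 4) *\<^sub>R (- q n *\<^sub>R M.coeff g t n + of_real (M.\<mu> n) * M.nonlinear_part g b t n / 2)) (at t within S)"
proof -
  note t0 = time_nonneg[OF t]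
  have R: "R t > 0" by (rule R_pos[OF t0])
  let ?m = "complex_of_real (M.\<mu> n)"
  let ?\<delta> = "(if n = 0 then 1 else 0) :: complex"
  have d1: "((\<lambda>r. M.coeff rho r n) has_vector_derivative ?m / 2 * of_real (1 / R t ^ 3) * M.coeff (M.H b) t n) (at t within S)"
  proof -
    have "- \<sigma> * ?m * M.coeff (\<lambda>t u. of_real (F t u)) t n = - ?m * (\<sigma> * M.coeff (\<lambda>t u. of_real (F t u)) t n)" by simp
    also have "\<dots> = ?m / 2 * of_real (1 / R t ^ 3) * M.coeff (M.H b) t n" unfolding coeff_F[OF t] by simp
    finally show ?thesis using coeff_rho_derivative[OF t, of n] by simp
  qed
  have d2: "((\<lambda>r. complex_of_real (1 / R r)) has_vector_derivative of_real (- (1 / (2 * R t ^ 5)))) (at t within S)"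
  proof (rule has_vector_derivative_of_real)
    show "((\<lambda>r. 1 / R r) has_real_derivative - (1 / (2 * R t ^ 5))) (at t within S)"
      using R by (auto intro!: derivative_eq_intros R_deriv t0 simp: field_simps eval_nat_numeral)
  qed
  have d3: "((\<lambda>r. M.coeff rho r n * of_real (1 / R r) - ?\<delta>) has_vector_derivative
     (M.coeff rho t n * of_real (- (1 / (2 * R t ^ 5))) + ?m / 2 * of_real (1 / R t ^ 3) * M.coeff (M.H b) t n * of_real (1 / R t)) - 0) (at t within S)"
    by (intro has_vector_derivative_diff has_vector_derivative_mult d1 d2 has_vector_derivative_const)
  have d4: "((\<lambda>r. M.coeff g r n) has_vector_derivative
     (M.coeff rho t n * of_real (- (1 / (2 * R t ^ 5))) + ?m / 2 * of_real (1 / R t ^ 3) * M.coeff (M.H b) t n * of_real (1 / R t)) - 0) (at t within S)"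
    by (rule has_vector_derivative_transform[OF t _ d3]) (simp add: coeff_g_eq)
  have "M.coeff rho t n = R t * (M.coeff g t n + ?\<delta>)"
    using R by (simp add: coeff_g_eq[OF t])
  moreover have "M.coeff (M.H b) t n = M.nonlinear_part g b t n + ?\<delta> - (1 + 2 * ?m) * M.coeff g t n"
    by (simp add: M.nonlinear_part_def)
  moreover have "?m * ?\<delta> = ?\<delta>" by (simp add: M.\<mu>_def)
  ultimately have "(M.coeff rho t n * of_real (- (1 / (2 * R t ^ 5))) + ?m / 2 * of_real (1 / R t ^ 3) * M.coeff (M.H b) t n * of_real (1 / R t)) - 0
     = (1 / R t ^ 4) *\<^sub>R (- q n *\<^sub>R M.coeff g t n + ?m * M.nonlinear_part g b t n / 2)"
  proof -
    assume r: "M.coeff rho t n = R t * (M.coeff g t n + ?\<delta>)"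
      and h: "M.coeff (M.H b) t n = M.nonlinear_part g b t n + ?\<delta> - (1 + 2 * ?m) * M.coeff g t n"
      and \<delta>: "?m * ?\<delta> = ?\<delta>"
    define a N D where "a = M.coeff g t n" "N = M.nonlinear_part g b t n" "D = ?\<delta>"
    note defs = this
    have "complex_of_real (R t) * (a + D) * of_real (- (1 / (2 * R t ^ 5))) = of_real (1 / R t ^ 4) * (- (a + D) / 2)"
      using R by (simp add: field_simps eval_nat_numeral)
    moreover have "?m / 2 * of_real (1 / R t ^ 3) * (N + D - (1 + 2 * ?m) * a) * of_real (1 / R t) =
       of_real (1 / R t ^ 4) * ((?m * N + ?m * D - ?m * (1 + 2 * ?m) * a) / 2)"
      using R by (simp add: field_simps eval_nat_numeral)
    ultimately have "complex_of_real (R t) * (a + D) * of_real (- (1 / (2 * R t ^ 5))) + ?m / 2 * of_real (1 / R t ^ 3) * (N + D - (1 + 2 * ?m) * a) * of_real (1 / R t)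
      = of_real (1 / R t ^ 4) * (- (a + D) / 2 + (?m * N + ?m * D - ?m * (1 + 2 * ?m) * a) / 2)"
      by (simp only: distrib_left)
    also have "?m * D = D" using \<delta> by (simp add: defs)
    also have "- (a + D) / 2 + (?m * N + D - ?m * (1 + 2 * ?m) * a) / 2 = - (?m\<^sup>2 + ?m / 2 + 1 / 2) * a + ?m * N / 2"
      by (simp add: field_simps power2_eq_square)
    also have "?m\<^sup>2 + ?m / 2 + 1 / 2 = of_real (q n)" by (simp add: q_def M.\<mu>_def)
    finally show ?thesis unfolding r h defs[symmetric] scaleR_conv_of_real by simp
  qed
  with d4 show ?thesis by simp
qed

end
end

section \<open>Exponential decay and preservation of convexity\<close>

text \<open>The constant is explained by \<open>(1 + |n|)\<^sup>4 \<le> 8 \<omega>\<^sup>4 (1 + (n/\<omega>)\<^sup>4)\<close> and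
  \<open>(1 + (n/\<omega>)\<^sup>4) / 10 \<le> q n\<close>.\<close>

definition decay_rate :: "nat \<Rightarrow> real" where "decay_rate \<omega> = 1 / (80 * real \<omega> ^ 4)"

text \<open>The first bound serves to invert \<open>1 + g\<close> in the norm of order \<open>j + 4\<close>, the second one to make the
  nonlinear part smaller than half of the dissipation.\<close>

definition smallness :: "nat \<Rightarrow> nat \<Rightarrow> real" where
  "smallness \<omega> j = min (1 / (4 * 2 ^ (j + 4))) (decay_rate \<omega> / (60 * 4 ^ (j + 4)))"

lemma decay_rate_pos: "\<omega> \<ge> 1 \<Longrightarrow> decay_rate \<omega> > 0"
  by (simp add: decay_rate_def)

lemma smallness_pos: "\<omega> \<ge> 1 \<Longrightarrow> smallness \<omega> j > 0"
  using decay_rate_pos by (simp add: smallness_def)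

lemma periodic_frac:
  fixes f :: "real \<Rightarrow> 'a"
  assumes per: "\<And>w. f (w + 1) = f w"
  shows "f (frac w) = f w"
proof -
  have "f (w + of_int i) = f w" for i
  proof (induction i rule: int_induct[of _ 0])
    case base then show ?case by simp
  next
    case (step1 i) then show ?case using per[of "w + of_int i"] by (simp add: add.assoc)
  next
    case (step2 i) then show ?case using per[of "w + of_int (i - 1)"] by (simp add: algebra_simps)
  qed
  from this[of "- \<lfloor>w\<rfloor>"] show ?thesis by (simp add: frac_def)
qed

lemma continuous_le_at_endpoint:
  fixes f :: "real \<Rightarrow> real"
  assumes c: "continuous_on {a..s} f" and as: "a < s" and le: "\<And>r. a \<le> r \<Longrightarrow> r < s \<Longrightarrow> f r \<le> c"
  shows "f s \<le> c"
proof (rule tendsto_upperbound)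
  have "(f \<longlongrightarrow> f s) (at s within {a..s})"
    using c as by (simp add: continuous_on_def)
  then show "(f \<longlongrightarrow> f s) (at s within {a..<s})" by (rule tendsto_within_subset) auto
  show "\<forall>\<^sub>F r in at s within {a..<s}. f r \<le> c"
    unfolding eventually_at_filter using le by (intro always_eventually) auto
  show "at s within {a..<s} \<noteq> bot"
    using as by (simp add: trivial_limit_within islimpt_Ico)
qed

context winding_flow begin

definition G :: "nat \<Rightarrow> real \<Rightarrow> real" where "G j t = wnorm j (moving_circle.coeff x g t)"

abbreviation rate :: real where "rate \<equiv> decay_rate \<omega>"

abbreviation threshold :: "nat \<Rightarrow> real" where "threshold \<equiv> smallness \<omega>"

lemmas rate_pos = decay_rate_pos[OF \<omega>_ge_1]

lemmas threshold_pos = smallness_pos[OF \<omega>_ge_1]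

text \<open>With \<open>y = (n/\<omega>)\<^sup>2\<close> the claim reduces to \<open>0.9 y\<^sup>2 - 2.5 y + 1.9 \<ge> 0\<close>, and this quadratic polynomial
  has negative discriminant.\<close>

lemma q_ge: "q n \<ge> rate * wt n ^ 4"
proof -
  define s where "s = \<bar>real_of_int n\<bar> / \<omega>"
  have s: "s \<ge> 0" by (simp add: s_def)
  have w: "real \<omega> \<ge> 1" using \<omega>_ge_1 by simp
  have q: "q n = (1 - s\<^sup>2)\<^sup>2 + (1 - s\<^sup>2) / 2 + 1 / 2"
    unfolding q_def s_def by (simp add: power_divide)
  have "wt n \<le> \<omega> * (1 + s)" using w by (simp add: s_def distrib_left)
  then have "wt n ^ 4 \<le> (\<omega> * (1 + s)) ^ 4" by (intro power_mono) auto
  also have "\<dots> = real \<omega> ^ 4 * (1 + s) ^ 4" by (simp add: power_mult_distrib)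
  finally have "rate * wt n ^ 4 \<le> rate * (real \<omega> ^ 4 * (1 + s) ^ 4)"
    using rate_pos by (intro mult_left_mono) auto
  also have "\<dots> = (1 + s) ^ 4 / 80" using w by (simp add: decay_rate_def)
  also have "(1 + s) ^ 4 \<le> 8 * (1 + s ^ 4)"
  proof -
    have "(1 + s)\<^sup>2 \<le> 2 * (1 + s\<^sup>2)" using zero_le_power2[of "1 - s"] by (simp add: power2_eq_square algebra_simps)
    then have "((1 + s)\<^sup>2)\<^sup>2 \<le> (2 * (1 + s\<^sup>2))\<^sup>2" by (intro power_mono) auto
    also have "\<dots> = 4 * (1 + s\<^sup>2)\<^sup>2" by (simp only: power_mult_distrib) simp
    also have "(1 + s\<^sup>2)\<^sup>2 \<le> 2 * (1 + (s\<^sup>2)\<^sup>2)" using zero_le_power2[of "1 - s\<^sup>2"] by (simp add: power2_eq_square algebra_simps)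
    finally show ?thesis by (simp add: power_mult[symmetric])
  qed
  also have "8 * (1 + s ^ 4) / 80 \<le> q n"
  proof -
    define y where "y = s\<^sup>2"
    have "0 \<le> (18 * y - 25)\<^sup>2" by simp
    then have "0 \<le> 324 * (y * y) - 900 * y + 625" by (simp add: power2_eq_square algebra_simps)
    moreover have "(1 - y)\<^sup>2 = 1 - 2 * y + y * y" by (simp add: power2_eq_square algebra_simps)
    moreover have "s ^ 4 = y * y" by (simp add: y_def power2_eq_square power4_eq_xxxx)
    ultimately show ?thesis unfolding q y_def[symmetric] by (simp add: field_simps)
  qed
  finally show ?thesis by simp
qed

text \<open>The decay lemma for the coefficients of \<open>g\<close>: the smallness makes the nonlinear part an
  admissible forcing.\<close>

lemma decay_step:
  assumes S: "S \<subseteq> {0..}" "\<And>t u. t \<in> S \<Longrightarrow> \<kappa> t u > 0"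
    and t12: "t1 \<le> t2" "{t1..t2} \<subseteq> S"
    and small: "\<And>t. t \<in> {t1..t2} \<Longrightarrow> G 0 t \<le> threshold j"
  shows "G j t2 * R t2 powr rate \<le> G j t1 * R t1 powr rate"
proof (cases "t1 = t2")
  case False
  then have t12': "t1 < t2" using t12 by simp
  interpret M: multiple_moving_circle S x \<omega> by (rule circle[OF S])
  have tS: "t \<in> S" "t \<ge> 0" if "t \<in> {t1..t2}" for t using that t12 S by auto
  note ng = smooth_periodic_g[OF S] and nb = smooth_periodic_b[OF S]
  define e where "e t n = of_real (M.\<mu> n) * M.nonlinear_part g b t n / 2" for t n
  obtain C where C: "\<And>t n. t \<in> {t1..t2} \<Longrightarrow> wt n ^ (j + 6) * norm (M.coeff g t n) \<le> C"
    using M.coeff_bounded_on_compact[OF ng compact_Icc t12(2), of "j + 6"] by blast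
  have nl: "rapid (\<lambda>n. of_real (M.\<mu> n) * M.nonlinear_part g b t n)"
    "wnorm j (\<lambda>n. of_real (M.\<mu> n) * M.nonlinear_part g b t n) \<le> 60 * 4 ^ (j + 4) * G 0 t * G (j + 4) t"
    if t: "t \<in> {t1..t2}" for t
  proof -
    have "2 ^ (j + 4) * wnorm 0 (M.coeff g t) \<le> 2 ^ (j + 4) * (1 / (4 * 2 ^ (j + 4)))"
      using small[OF t] by (intro mult_left_mono) (auto simp: G_def smallness_def)
    also have "\<dots> = 1 / 4" by simp
    finally have sm: "2 ^ (j + 4) * wnorm 0 (M.coeff g t) \<le> 1 / 4" .
    show "rapid (\<lambda>n. of_real (M.\<mu> n) * M.nonlinear_part g b t n)"
      by (rule M.nonlinear_estimate(1)[OF ng nb tS(1)[OF t] reciprocal[OF S] sm])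
    show "wnorm j (\<lambda>n. of_real (M.\<mu> n) * M.nonlinear_part g b t n) \<le> 60 * 4 ^ (j + 4) * G 0 t * G (j + 4) t"
      unfolding G_def by (rule M.nonlinear_estimate(2)[OF ng nb tS(1)[OF t] reciprocal[OF S] sm])
  qed
  have half: "norm (e t n) \<le> 1 / 2 * norm (of_real (M.\<mu> n) * M.nonlinear_part g b t n)" for t n
    by (simp add: e_def norm_divide norm_mult)
  show ?thesis unfolding G_def
  proof (rule weighted_decay[OF t12' rate_pos, where e = e and q = q and C = C])
    fix t assume t: "t \<in> {t1..t2}"
    show "R t > 0" by (rule R_pos[OF tS(2)[OF t]])
    show "(R has_real_derivative 1 / (2 * R t ^ 3)) (at t within {t1..t2})" by (rule R_deriv[OF tS(2)[OF t]])
    show "((\<lambda>r. M.coeff g r n) has_vector_derivative (1 / R t ^ 4) *\<^sub>R (- q n *\<^sub>R M.coeff g t n + e t n)) (at t within {t1..t2})" for n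
      unfolding e_def by (rule has_vector_derivative_within_subset[OF coeff_g_derivative[OF S tS(1)[OF t]] t12(2)])
    show "wt n ^ (j + 6) * norm (M.coeff g t n) \<le> C" for n by (rule C[OF t])
    show "rapid (M.coeff g t)" by (rule M.coeff_rapid[OF ng tS(1)[OF t]])
    show "rapid (e t)" by (rule wnorm_compare0(1)[OF nl(1)[OF t] half])
    have "wnorm j (e t) \<le> 1 / 2 * wnorm j (\<lambda>n. of_real (M.\<mu> n) * M.nonlinear_part g b t n)"
      by (rule wnorm_compare0(2)[OF nl(1)[OF t] half])
    also have "\<dots> \<le> 1 / 2 * (60 * 4 ^ (j + 4) * G 0 t * G (j + 4) t)"
      by (rule mult_left_mono[OF nl(2)[OF t]]) simp
    also have "60 * 4 ^ (j + 4) * G 0 t * G (j + 4) t \<le> rate * G (j + 4) t"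
    proof (rule mult_right_mono)
      have "60 * 4 ^ (j + 4) * G 0 t \<le> 60 * 4 ^ (j + 4) * (rate / (60 * 4 ^ (j + 4)))"
        using small[OF t] by (intro mult_left_mono) (auto simp: smallness_def)
      then show "60 * 4 ^ (j + 4) * G 0 t \<le> rate" by simp
    qed (simp add: G_def wnorm_nonneg)
    finally show "wnorm j (e t) \<le> rate / 2 * wnorm (j + 4) (M.coeff g t)" by (simp add: G_def)
  qed (rule q_ge)
qed simp

lemma R_mono: "0 \<le> s \<Longrightarrow> s \<le> t \<Longrightarrow> R s \<le> R t"
  unfolding R_def using R4_pos[of s] by (intro powr_mono2) auto

lemma G_nonneg: "G j t \<ge> 0"
  by (simp add: G_def wnorm_nonneg)

lemma decay_consequence:
  assumes "0 \<le> s" "s \<le> t" "G j t * R t powr rate \<le> G j s * R s powr rate"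
  shows "G j t \<le> G j s"
proof -
  have "R s powr rate \<le> R t powr rate"
    using R_mono[OF assms(1,2)] R_pos[OF assms(1)] rate_pos by (intro powr_mono2) auto
  then have "G j s * R s powr rate \<le> G j s * R t powr rate" by (intro mult_left_mono G_nonneg)
  with assms(3) have "G j t * R t powr rate \<le> G j s * R t powr rate" by linarith
  moreover have "R t powr rate > 0" using R_pos[of t] assms by simp
  ultimately show ?thesis by simp
qed

text \<open>Up to the first time at which the threshold is reached, \<open>G 0\<close> is at most its initial value; by
  continuity it is so at that time, too.\<close>

lemma small_stays:
  assumes T: "T \<ge> 0" and pos: "\<And>t u. t \<in> {0..T} \<Longrightarrow> \<kappa> t u > 0" and G0: "G 0 0 < threshold 0"
    and t: "t \<in> {0..T}"
  shows "G 0 t < threshold 0"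
proof (rule ccontr)
  assume neg: "\<not> G 0 t < threshold 0"
  have S: "{0..T} \<subseteq> {0..}" by auto
  interpret M: multiple_moving_circle "{0..T}" x \<omega> by (rule circle[OF S pos])
  note ng = smooth_periodic_g[OF S pos]
  obtain C where C: "\<And>t n. t \<in> {0..T} \<Longrightarrow> wt n ^ (0 + 2) * norm (M.coeff g t n) \<le> C"
    using M.coeff_bounded_on_compact[OF ng compact_Icc order_refl, of "0 + 2"] by blast
  have cont: "continuous_on {0..T} (G 0)" unfolding G_def
  proof (rule continuous_on_wnorm[where C = C])
    show "wt n ^ (0 + 2) * norm (M.coeff g t n) \<le> C" if "t \<in> {0..T}" for t n by (rule C[OF that])
    show "rapid (M.coeff g t)" if "t \<in> {0..T}" for t by (rule M.coeff_rapid[OF ng that])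
    show "continuous_on {0..T} (\<lambda>t. M.coeff g t n)" for n
      unfolding continuous_on_eq_continuous_within
      using has_vector_derivative_continuous[OF coeff_g_derivative[OF S pos]] by blast
  qed
  define Z where "Z = {s \<in> {0..T}. threshold 0 \<le> G 0 s}"
  have "closed Z" unfolding Z_def
    by (rule continuous_on_closed_Collect_le[OF continuous_on_const cont]) simp
  moreover have "bounded Z" unfolding Z_def by (rule bounded_subset[of "{0..T}"]) auto
  ultimately have "compact Z" by (simp add: compact_eq_bounded_closed)
  moreover have "Z \<noteq> {}" using neg t by (auto simp: Z_def)
  ultimately obtain s where s: "s \<in> Z" "\<And>r. r \<in> Z \<Longrightarrow> s \<le> r" using compact_attains_inf by metis
  have s0: "0 \<le> s" "s \<le> T" "threshold 0 \<le> G 0 s" using s(1) by (auto simp: Z_def)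
  have "s \<noteq> 0" using s0(3) G0 by auto
  then have sp: "s > 0" using s0 by simp
  have below: "G 0 r \<le> G 0 0" if r: "0 \<le> r" "r < s" for r
  proof (rule decay_consequence[OF order_refl r(1)])
    show "G 0 r * R r powr rate \<le> G 0 0 * R 0 powr rate"
    proof (rule decay_step[OF S pos r(1)])
      show "{0..r} \<subseteq> {0..T}" using r s0 by auto
      fix w assume w: "w \<in> {0..r}"
      then have "w \<notin> Z" using s(2)[of w] r by auto
      then show "G 0 w \<le> threshold 0" using w r s0 by (auto simp: Z_def)
    qed
  qed
  have "G 0 s \<le> G 0 0"
    by (rule continuous_le_at_endpoint[OF continuous_on_subset[OF cont] sp below]) (use s0 in auto)
  with s0 G0 show False by simp
qed

text \<open>Up to the first time at which the deviation equals \<open>1 / 2\<close> somewhere, the curvature is positive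
  and the coefficients remain small.  The sum of the coefficients of \<open>b\<close> bounds \<open>b\<close> uniformly, so
  the deviation is less than \<open>1 / 2\<close> at that time.\<close>

lemma curvature_close:
  assumes init: "\<And>u. \<bar>\<kappa> 0 u * R 0 - 1\<bar> < 1 / 2" and G0: "G 0 0 < threshold 0" and t: "t \<ge> 0"
  shows "\<bar>\<kappa> t u * R t - 1\<bar> < 1 / 2"
proof (rule ccontr)
  assume neg: "\<not> \<bar>\<kappa> t u * R t - 1\<bar> < 1 / 2"
  define h where "h y = \<bar>\<kappa> (fst y) (snd y) * R (fst y) - 1\<bar>" for y :: "real \<times> real"
  have \<kappa>c: "continuous_on ({0..} \<times> UNIV) (\<lambda>y. \<kappa> (fst y) (snd y))"
    using u_smooth_continuous[OF \<kappa>_smooth] by (simp add: case_prod_unfold)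
  have Rc: "continuous_on ({0..} \<times> UNIV) (\<lambda>y. R (fst y))"
    by (rule continuous_on_compose2[OF R_cont]) (auto intro!: continuous_intros)
  have hc: "continuous_on ({0..} \<times> UNIV) h" unfolding h_def by (intro continuous_intros \<kappa>c Rc)
  have frac: "\<kappa> r (frac w) = \<kappa> r w" if "r \<ge> 0" for r w
    by (rule periodic_frac[of "\<kappa> r"]) (rule \<kappa>_period[OF that])
  define Z where "Z = {y \<in> {0..t} \<times> {0..1}. 1 / 2 \<le> h y}"
  have "compact Z"
  proof -
    have "continuous_on ({0..t} \<times> {0..1}) h" by (rule continuous_on_subset[OF hc]) auto
    then have "closed Z" unfolding Z_def
      by (intro continuous_on_closed_Collect_le continuous_on_const closed_Times) auto
    moreover have "bounded Z" unfolding Z_def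
      by (rule bounded_subset[of "{0..t} \<times> {0..1::real}"]) (auto intro: bounded_Times)
    ultimately show ?thesis by (simp add: compact_eq_bounded_closed)
  qed
  then have "compact (fst ` Z)" by (intro compact_continuous_image continuous_intros)
  moreover have "fst ` Z \<noteq> {}"
  proof -
    have "frac u \<in> {0..1}" using frac_lt_1[of u] by (simp add: less_imp_le)
    then have "(t, frac u) \<in> Z" using neg t by (auto simp: Z_def h_def frac)
    then show ?thesis by blast
  qed
  ultimately obtain s where s: "s \<in> fst ` Z" "\<And>r. r \<in> fst ` Z \<Longrightarrow> s \<le> r" using compact_attains_inf by metis
  obtain w where w: "(s, w) \<in> Z" using s(1) by force
  have s0: "0 \<le> s" "s \<le> t" "1 / 2 \<le> h (s, w)" using w by (auto simp: Z_def)
  have "s \<noteq> 0" using s0(3) init[of w] by (auto simp: h_def)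
  then have sp: "s > 0" using s0 by simp
  have below: "h (r, a) < 1 / 2" if r: "0 \<le> r" "r < s" for r a
  proof (rule ccontr)
    assume "\<not> ?thesis"
    moreover have "frac a \<in> {0..1}" using frac_lt_1[of a] by (simp add: less_imp_le)
    ultimately have "(r, frac a) \<in> Z" using r s0 by (auto simp: Z_def h_def frac)
    then have "r \<in> fst ` Z" by force
    with s(2) r show False by force
  qed
  have upto: "h (r, a) \<le> 1 / 2" if r: "r \<in> {0..s}" for r a
  proof (cases "r < s")
    case True then show ?thesis using below[of r a] r by simp
  next
    case False
    then have rs: "r = s" using r by simp
    have c: "continuous_on {0..s} (\<lambda>r. h (r, a))"
      by (rule continuous_on_compose2[OF hc]) (auto intro!: continuous_intros)
    show ?thesis unfolding rs
      by (rule continuous_le_at_endpoint[OF c sp less_imp_le[OF below]])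
  qed
  have pos: "\<kappa> r a > 0" if r: "r \<in> {0..s}" for r a
  proof -
    have "\<kappa> r a * R r \<ge> 1 / 2" using upto[OF r, of a] unfolding h_def fst_conv snd_conv by linarith
    then have "\<kappa> r a * R r > 0" by linarith
    then show ?thesis using R_pos[of r] r by (simp add: zero_less_mult_iff)
  qed
  have S: "{0..s} \<subseteq> {0..}" by auto
  have sS: "s \<in> {0..s}" using s0 by simp
  interpret M: multiple_moving_circle "{0..s}" x \<omega> by (rule circle[OF S pos])
  have Gs: "G 0 s < threshold 0" by (rule small_stays[OF s0(1) pos G0 sS])
  have "threshold 0 \<le> 1 / 64" by (simp add: smallness_def)
  with Gs have g64: "wnorm 0 (M.coeff g s) < 1 / 64" by (simp add: G_def)
  have "norm (b s w) \<le> wnorm 0 (M.coeff b s)"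
    by (rule M.norm_le_wnorm_coeff[OF smooth_periodic_b[OF S pos] sS])
  also have "\<dots> \<le> 2 * wnorm 0 (M.coeff g s)"
    by (rule M.reciprocal_wnorm(1)[OF smooth_periodic_g[OF S pos] smooth_periodic_b[OF S pos] sS reciprocal[OF S pos], of 0]) (use g64 in simp_all)
  finally have "norm (b s w) < 1 / 2" using g64 by simp
  moreover have "norm (b s w) = h (s, w)" by (simp only: b_def h_def norm_of_real fst_conv snd_conv)
  ultimately show False using s0(3) by simp
qed

text \<open>The case \<open>j = 0\<close> is used first: once \<open>G 0\<close> has decayed below the threshold for \<open>j\<close>, the norm of
  order \<open>j\<close> decays as well.\<close>

lemma G_tendsto_0:
  assumes pos: "\<And>t u. t \<ge> 0 \<Longrightarrow> \<kappa> t u > 0" and G0: "G 0 0 < threshold 0"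
  shows "(G j \<longlongrightarrow> 0) at_top"
proof -
  have S: "{0..} \<subseteq> {0::real..}" and posS: "\<And>t u. t \<in> {0..} \<Longrightarrow> \<kappa> t u > 0" using pos by auto
  have Rinf: "filterlim (\<lambda>t. R t powr rate) at_top at_top"
  proof (unfold filterlim_at_top_ge[where c = 0], intro allI impI)
    fix Z :: real assume Z: "0 \<le> Z"
    have "\<forall>\<^sub>F t in at_top. Z powr (1 / rate) \<le> R t"
      using R_at_top unfolding filterlim_at_top by blast
    then show "\<forall>\<^sub>F t in at_top. Z \<le> R t powr rate"
    proof eventually_elim
      case (elim t)
      have "Z = (Z powr (1 / rate)) powr rate" using rate_pos Z by (simp add: powr_powr)
      also have "\<dots> \<le> R t powr rate" using elim rate_pos by (intro powr_mono2) auto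
      finally show ?case .
    qed
  qed
  have conv: "(G j \<longlongrightarrow> 0) at_top" if T: "T \<ge> 0" "\<And>t. t \<ge> T \<Longrightarrow> G 0 t \<le> threshold j" for j T
  proof (rule tendsto_sandwich)
    show "\<forall>\<^sub>F t in at_top. 0 \<le> G j t" by (simp add: G_nonneg)
    show "\<forall>\<^sub>F t in at_top. G j t \<le> (G j T * R T powr rate) / R t powr rate"
      using eventually_ge_at_top[of T]
    proof eventually_elim
      case (elim t)
      have "G j t * R t powr rate \<le> G j T * R T powr rate"
        by (rule decay_step[OF S posS elim]) (use T in auto)
      moreover have "R t powr rate > 0" using R_pos[of t] T elim by simp
      ultimately show ?case by (simp add: pos_le_divide_eq)
    qed
    show "((\<lambda>t. (G j T * R T powr rate) / R t powr rate) \<longlongrightarrow> 0) at_top"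
      by (rule real_tendsto_divide_at_top[OF tendsto_const Rinf])
  qed simp
  have "G 0 t \<le> threshold 0" if "t \<ge> 0" for t
    using small_stays[of t t] that pos G0 by (auto intro: less_imp_le)
  from conv[OF order_refl this] have "(G 0 \<longlongrightarrow> 0) at_top" .
  then have "\<forall>\<^sub>F t in at_top. G 0 t < threshold j" using threshold_pos by (rule order_tendstoD(2))
  then obtain T where "\<And>t. t \<ge> T \<Longrightarrow> G 0 t < threshold j" unfolding eventually_at_top_linorder by blast
  then show ?thesis by (intro conv[of "max T 0"]) (auto intro: less_imp_le)
qed

end

section \<open>The initial curve and the drift of the centre\<close>

context winding_flow begin

abbreviation k :: "real \<Rightarrow> real \<Rightarrow> real" where "k \<equiv> angle_curvature \<theta> v"

text \<open>The integral of \<open>k\<^sub>s\<^sup>2\<close> over the initial curve.\<close>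

definition energy0 :: real where
  "energy0 = integral {0..1} (\<lambda>u. (partial_u k 0 u)\<^sup>2 / v 0 u)"

lemma energy0_integrand_cont: "continuous_on {0..1} (\<lambda>u. (partial_u k 0 u)\<^sup>2 / v 0 u)"
  by (intro continuous_intros cont_slices[OF u_smooth_partial[OF curvature_velocity_smooth(1)]] cont_slices[OF v_smooth])
    (use v_pos[of 0] in \<open>auto simp: less_imp_neq[symmetric]\<close>)

text \<open>The mean of \<open>L k\<close> with respect to arc length is \<open>2 \<pi> \<sigma> \<omega>\<close>, and \<open>k\<close> differs from its mean by at
  most \<open>\<integral> |k\<^sub>s| ds\<close>, which is bounded by Young's inequality.\<close>

lemma initial_curvature:
  assumes \<epsilon>: "\<epsilon> > 0" and small: "L 0 ^ 3 * energy0 < \<epsilon>"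
  shows "\<bar>L 0 * k 0 u - 2 * pi * \<sigma> * \<omega>\<bar> \<le> sqrt \<epsilon>"
proof -
  define k' where "k' = partial_u k 0"
  have kd: "(k 0 has_vector_derivative k' w) (at w)" for w
    unfolding k'_def by (rule u_smooth_derivative[OF curvature_velocity_smooth(1)]) simp
  have k'c: "continuous_on A k'" for A unfolding k'_def by (rule cont_slices[OF u_smooth_partial[OF curvature_velocity_smooth(1)]]) simp
  have kc: "continuous_on A (k 0)" for A by (rule cont_slices[OF curvature_velocity_smooth(1)]) simp
  have vc: "continuous_on A (v 0)" for A by (rule cont_slices[OF v_smooth]) simp
  have vp: "v 0 w > 0" for w by (rule v_pos) simp
  define V where "V = integral {0..1} (\<lambda>w. \<bar>k' w\<bar>)"
  have Lp: "L 0 > 0" by (rule L_pos) simp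
  have osc: "\<bar>k 0 a - k 0 c\<bar> \<le> V" if "a \<in> {0..1}" "c \<in> {0..1}" "c \<le> a" for a c
  proof -
    have "(k' has_integral k 0 a - k 0 c) {c..a}"
      by (rule fundamental_theorem_of_calculus[OF that(3)]) (rule has_vector_derivative_at_within[OF kd])
    then have "\<bar>k 0 a - k 0 c\<bar> = norm (integral {c..a} k')" by (simp add: integral_unique)
    also have "\<dots> \<le> integral {c..a} (\<lambda>w. \<bar>k' w\<bar>)"
      by (rule integral_norm_bound_integral) (auto intro!: integrable_continuous_real continuous_intros k'c)
    also have "\<dots> \<le> V" unfolding V_def
      by (rule integral_subset_le) (use that in \<open>auto intro!: integrable_continuous_real continuous_intros k'c\<close>)
    finally show ?thesis .
  qed
  have osc': "\<bar>k 0 a - k 0 c\<bar> \<le> V" if "a \<in> {0..1}" "c \<in> {0..1}" for a c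
    using osc[OF that] osc[OF that(2,1)] by (cases "c \<le> a") (auto simp: abs_minus_commute)
  \<comment> \<open>the weight for which both terms of Young's inequality are of order \<open>sqrt \<epsilon> / L\<close>\<close>
  define a where "a = (L 0)\<^sup>2 / sqrt \<epsilon>"
  have a: "a > 0" using Lp \<epsilon> by (simp add: a_def)
  have "V \<le> integral {0..1} (\<lambda>w. a / 2 * ((k' w)\<^sup>2 / v 0 w) + 1 / (2 * a) * v 0 w)"
    unfolding V_def
  proof (rule integral_le)
    show "(\<lambda>w. \<bar>k' w\<bar>) integrable_on {0..1}" by (intro integrable_continuous_real continuous_intros k'c)
    show "(\<lambda>w. a / 2 * ((k' w)\<^sup>2 / v 0 w) + 1 / (2 * a) * v 0 w) integrable_on {0..1}"
      by (intro integrable_continuous_real continuous_intros k'c vc) (use vp in \<open>auto simp: less_imp_neq[symmetric]\<close>)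
    fix w
    have "0 \<le> (a * \<bar>k' w\<bar> - v 0 w)\<^sup>2" by simp
    then have "2 * a * v 0 w * \<bar>k' w\<bar> \<le> a\<^sup>2 * (k' w)\<^sup>2 + (v 0 w)\<^sup>2" by (simp add: power2_eq_square algebra_simps)
    then have "\<bar>k' w\<bar> \<le> (a\<^sup>2 * (k' w)\<^sup>2 + (v 0 w)\<^sup>2) / (2 * a * v 0 w)"
      using a vp[of w] by (simp add: pos_le_divide_eq mult_ac)
    also have "\<dots> = a / 2 * ((k' w)\<^sup>2 / v 0 w) + 1 / (2 * a) * v 0 w"
      using a vp[of w] by (simp add: field_simps power2_eq_square)
    finally show "\<bar>k' w\<bar> \<le> a / 2 * ((k' w)\<^sup>2 / v 0 w) + 1 / (2 * a) * v 0 w" .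
  qed
  also have "\<dots> = a / 2 * energy0 + 1 / (2 * a) * L 0"
  proof -
    have 1: "(\<lambda>w. a / 2 * ((k' w)\<^sup>2 / v 0 w)) integrable_on {0..1}"
      by (intro integrable_continuous_real continuous_intros k'c vc) (use vp in \<open>auto simp: less_imp_neq[symmetric]\<close>)
    have 2: "(\<lambda>w. 1 / (2 * a) * v 0 w) integrable_on {0..1}"
      by (intro integrable_continuous_real continuous_intros vc)
    show ?thesis unfolding energy0_def L_def k'_def[symmetric]
      by (simp only: integral_add[OF 1 2] integral_mult_right)
  qed
  finally have "L 0 * V \<le> L 0 * (a / 2 * energy0 + 1 / (2 * a) * L 0)" using Lp by (intro mult_left_mono) auto
  also have "\<dots> = (L 0 ^ 3 * energy0) / (2 * sqrt \<epsilon>) + sqrt \<epsilon> / 2"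
    using Lp \<epsilon> by (simp add: a_def field_simps power2_eq_square power3_eq_cube)
  also have "(L 0 ^ 3 * energy0) / (2 * sqrt \<epsilon>) \<le> \<epsilon> / (2 * sqrt \<epsilon>)"
    using small \<epsilon> by (intro divide_right_mono) auto
  also have "\<epsilon> / (2 * sqrt \<epsilon>) = sqrt \<epsilon> / 2" using \<epsilon> by (simp add: field_simps real_sqrt_mult_self)
  finally have LV: "L 0 * V \<le> sqrt \<epsilon>" by simp
  have main: "\<bar>L 0 * k 0 u - 2 * pi * \<sigma> * \<omega>\<bar> \<le> sqrt \<epsilon>" if u: "u \<in> {0..1}" for u
  proof -
    have "((\<lambda>w. partial_u \<theta> 0 w) has_integral \<theta> 0 1 - \<theta> 0 0) {0..1}"
      by (rule fundamental_theorem_of_calculus[OF zero_le_one])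
        (rule has_vector_derivative_at_within, rule u_smooth_derivative[OF \<theta>_smooth], simp)
    moreover have "partial_u \<theta> 0 = (\<lambda>w. k 0 w * v 0 w)"
      using vp by (auto simp: angle_curvature_def fun_eq_iff less_imp_neq[symmetric])
    moreover have "\<theta> 0 1 - \<theta> 0 0 = 2 * pi * \<sigma> * \<omega>" using \<theta>_period[of 0 0] by simp
    ultimately have 1: "((\<lambda>w. k 0 w * v 0 w) has_integral 2 * pi * \<sigma> * \<omega>) {0..1}" by simp
    have 2: "((\<lambda>w. k 0 u * v 0 w) has_integral k 0 u * L 0) {0..1}"
      unfolding L_def by (intro has_integral_mult_right integrable_integral integrable_continuous_real vc)
    have "((\<lambda>w. k 0 u * v 0 w - k 0 w * v 0 w) has_integral k 0 u * L 0 - 2 * pi * \<sigma> * \<omega>) {0..1}"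
      by (rule has_integral_diff[OF 2 1])
    then have "\<bar>L 0 * k 0 u - 2 * pi * \<sigma> * \<omega>\<bar> = norm (integral {0..1} (\<lambda>w. k 0 u * v 0 w - k 0 w * v 0 w))"
      by (simp add: integral_unique mult.commute)
    also have "\<dots> \<le> integral {0..1} (\<lambda>w. V * v 0 w)"
    proof (rule integral_norm_bound_integral)
      show "norm (k 0 u * v 0 w - k 0 w * v 0 w) \<le> V * v 0 w" if "w \<in> {0..1}" for w
        unfolding left_diff_distrib[symmetric] using osc'[OF u that] vp[of w] by (simp add: abs_mult)
    qed (auto intro!: integrable_continuous_real continuous_intros kc vc)
    also have "\<dots> = L 0 * V" by (simp add: L_def mult.commute)
    finally show ?thesis using LV by simp
  qed
  have "k 0 (frac u) = k 0 u"
  proof (rule periodic_frac[of "k 0"])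
    show "k 0 (w + 1) = k 0 w" for w using \<kappa>_period[of 0 w] \<sigma>_cases by (auto simp: \<kappa>_def)
  qed
  moreover have "frac u \<in> {0..1}" using frac_lt_1[of u] by (simp add: less_imp_le)
  ultimately show ?thesis using main[of "frac u"] by simp
qed

text \<open>The coefficient of \<open>g\<close> at 0 vanishes by the choice of \<open>R0\<close>.  The other ones are those of \<open>D g\<close>
  divided by \<open>2 \<pi> |n|\<close>; these are square summable with a bound in terms of the energy, by Bessel's
  inequality.\<close>

lemma initial_coefficients:
  assumes init: "\<And>u. \<bar>\<kappa> 0 u * R 0 - 1\<bar> < 1 / 2" and small: "L 0 ^ 3 * energy0 < \<epsilon>"
  shows "G 0 0 \<le> sqrt ((\<Sum>\<^sub>\<infinity>n. 1 / wt n ^ 2) * \<epsilon>)"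
proof -
  have kR: "\<kappa> 0 u * R0 > 1 / 2" for u
    using init[of u] unfolding R_0 by linarith
  have pos0: "\<kappa> 0 u > 0" for u
  proof -
    have "\<kappa> 0 u * R0 > 0" using kR[of u] by linarith
    then show ?thesis using R0_pos by (simp add: zero_less_mult_iff)
  qed
  have S: "{0} \<subseteq> {0::real..}" and pos: "\<And>t u. t \<in> {0} \<Longrightarrow> \<kappa> t u > 0" using pos0 by auto
  have S0: "(0::real) \<in> {0}" by simp
  interpret M: multiple_moving_circle "{0}" x \<omega> by (rule circle[OF S pos])
  interpret c: circle_coordinate "x 0" "M.xu 0" by (rule M.coordinate[OF S0])
  have ng: "M.smooth_periodic g" by (rule smooth_periodic_g[OF S pos])
  note nD = M.smooth_periodic_D[OF ng]
  have a0: "M.coeff g 0 0 = 0"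
  proof -
    have rho0: "M.coeff rho 0 0 = of_real (L 0) / of_real (2 * pi * \<omega>)" by (rule coeff_rho_0[OF S pos S0])
    have "M.coeff g 0 0 = M.coeff rho 0 0 / R 0 - (if (0::int) = 0 then 1 else 0)"
      by (rule coeff_g_eq[OF S pos S0])
    then show ?thesis using L_pos[of 0] \<omega>_ge_1 unfolding rho0 R_0 by (simp add: R0_def)
  qed
  have Dg: "M.D g 0 u = of_real (- (2 * pi * \<omega>) * partial_u \<kappa> 0 u / (R0 * \<kappa> 0 u ^ 3 * v 0 u))" for u
  proof -
    have kd: "(\<kappa> 0 has_real_derivative partial_u \<kappa> 0 u) (at u)"
      using u_smooth_derivative[OF \<kappa>_smooth, of 0 u] by (simp add: has_real_derivative_iff_has_vector_derivative)
    have "((\<lambda>u. 1 / (\<kappa> 0 u * R 0) - 1) has_real_derivative - partial_u \<kappa> 0 u / (R0 * (\<kappa> 0 u)\<^sup>2)) (at u)"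
      using pos0[of u] R0_pos by (auto intro!: derivative_eq_intros kd simp: R_0 field_simps power2_eq_square)
    then have "(g 0 has_vector_derivative of_real (- partial_u \<kappa> 0 u / (R0 * (\<kappa> 0 u)\<^sup>2))) (at u)"
      unfolding g_def[abs_def] by (rule has_vector_derivative_of_real)
    then have "partial_u g 0 u = of_real (- partial_u \<kappa> 0 u / (R0 * (\<kappa> 0 u)\<^sup>2))"
      by (rule partial_u_eqI)
    then have "M.D g 0 u = of_real ((- partial_u \<kappa> 0 u / (R0 * (\<kappa> 0 u)\<^sup>2)) / (\<kappa> 0 u * v 0 u / (2 * pi * \<omega>)))"
      by (simp add: M.D_def x_u_eq)
    also have "(- partial_u \<kappa> 0 u / (R0 * (\<kappa> 0 u)\<^sup>2)) / (\<kappa> 0 u * v 0 u / (2 * pi * \<omega>)) = - (2 * pi * \<omega>) * partial_u \<kappa> 0 u / (R0 * \<kappa> 0 u ^ 3 * v 0 u)"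
      using \<omega>_ge_1 by (simp add: field_simps power2_eq_square power3_eq_cube)
    finally show ?thesis .
  qed
  have k\<kappa>: "(partial_u \<kappa> 0 u)\<^sup>2 = (partial_u k 0 u)\<^sup>2" for u
  proof -
    have "partial_u \<kappa> 0 u = \<sigma> * partial_u k 0 u"
      unfolding \<kappa>_def[abs_def]
      by (rule partial_u_eqI, rule has_vector_derivative_mult_right, rule u_smooth_derivative[OF curvature_velocity_smooth(1)]) simp
    then show ?thesis using \<sigma>_cases by auto
  qed
  have int: "integral {0..1} (\<lambda>u. (norm (M.D g 0 u))\<^sup>2 * M.xu 0 u) \<le> L 0 ^ 3 * energy0"
  proof -
    have "integral {0..1} (\<lambda>u. (norm (M.D g 0 u))\<^sup>2 * M.xu 0 u) \<le> integral {0..1} (\<lambda>u. L 0 ^ 3 * ((partial_u k 0 u)\<^sup>2 / v 0 u))"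
    proof (rule integral_le)
      show "(\<lambda>u. (norm (M.D g 0 u))\<^sup>2 * M.xu 0 u) integrable_on {0..1}"
        by (intro integrable_continuous_real continuous_intros M.smooth_periodic_cont[OF nD S0] c.X'_cont')
      show "(\<lambda>u. L 0 ^ 3 * ((partial_u k 0 u)\<^sup>2 / v 0 u)) integrable_on {0..1}"
        by (rule integrable_continuous_real[OF continuous_on_mult[OF continuous_on_const energy0_integrand_cont]])
      fix u
      let ?w = "2 * pi * real \<omega>"
      have w: "?w > 0" using \<omega>_ge_1 by simp
      have vp: "v 0 u > 0" by (rule v_pos) simp
      have "(norm (M.D g 0 u))\<^sup>2 * M.xu 0 u = (- ?w * partial_u \<kappa> 0 u / (R0 * \<kappa> 0 u ^ 3 * v 0 u))\<^sup>2 * (\<kappa> 0 u * v 0 u / ?w)"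
        unfolding Dg norm_of_real power2_abs by (simp add: x_u_eq)
      also have "\<dots> = ?w * R0 ^ 3 * (1 / (\<kappa> 0 u * R0) ^ 5) * ((partial_u k 0 u)\<^sup>2 / v 0 u)"
        unfolding k\<kappa>[symmetric] using w vp pos0[of u] R0_pos by (simp add: field_simps eval_nat_numeral)
      also have "\<dots> \<le> ?w * R0 ^ 3 * 32 * ((partial_u k 0 u)\<^sup>2 / v 0 u)"
      proof (intro mult_right_mono mult_left_mono)
        have "(1 / 2) ^ 5 \<le> (\<kappa> 0 u * R0) ^ 5" using kR[of u] by (intro power_mono) auto
        then have "1 / (\<kappa> 0 u * R0) ^ 5 \<le> 1 / ((1 / 2) ^ 5)" by (intro divide_left_mono) (use kR[of u] pos0[of u] R0_pos in auto)
        then show "1 / (\<kappa> 0 u * R0) ^ 5 \<le> 32" by (simp add: eval_nat_numeral)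
      qed (use w R0_pos vp in auto)
      also have "?w * R0 ^ 3 * 32 \<le> L 0 ^ 3"
      proof -
        have "L 0 = ?w * R0" using \<omega>_ge_1 by (simp add: R0_def)
        then have "L 0 ^ 3 = ?w * R0 ^ 3 * ?w\<^sup>2" by (simp add: power2_eq_square power3_eq_cube)
        moreover have "32 \<le> ?w\<^sup>2"
        proof -
          have "6 * 1 \<le> 2 * pi * real \<omega>" using pi_gt3 \<omega>_ge_1 by (intro mult_mono) auto
          then have "6\<^sup>2 \<le> ?w\<^sup>2" by (intro power_mono) auto
          then show ?thesis by simp
        qed
        moreover have "0 \<le> ?w * R0 ^ 3" using w R0_pos by simp
        ultimately show ?thesis by (metis mult_left_mono)
      qed
      finally show "(norm (M.D g 0 u))\<^sup>2 * M.xu 0 u \<le> L 0 ^ 3 * ((partial_u k 0 u)\<^sup>2 / v 0 u)"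
        using vp by (simp add: mult_right_mono divide_right_mono)
    qed
    then show ?thesis unfolding energy0_def integral_mult_right .
  qed
  have an: "norm (M.coeff g 0 n) \<le> (1 / wt n) * norm (M.coeff (M.D g) 0 n)" for n
  proof (cases "n = 0")
    case True then show ?thesis by (simp add: a0)
  next
    case False
    then have n1: "\<bar>real_of_int n\<bar> \<ge> 1" by (simp flip: of_int_abs)
    have "wt n * norm (M.coeff g 0 n) \<le> (2 * pi * \<bar>real_of_int n\<bar>) * norm (M.coeff g 0 n)"
    proof (rule mult_right_mono)
      have "2 * \<bar>real_of_int n\<bar> \<le> (2 * pi) * \<bar>real_of_int n\<bar>" using pi_gt3 by (intro mult_right_mono) auto
      then show "wt n \<le> 2 * pi * \<bar>real_of_int n\<bar>" using n1 by linarith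
    qed simp
    also have "\<dots> = norm (M.coeff (M.D g) 0 n)" by (simp add: M.coeff_D[OF ng S0] norm_mult)
    finally show ?thesis by (simp add: pos_le_divide_eq mult.commute)
  qed
  show ?thesis unfolding G_def
  proof (rule wnorm_leI(2))
    fix F :: "int set" assume F: "finite F"
    have "(\<Sum>n\<in>F. wt n ^ 0 * norm (M.coeff g 0 n)) \<le> (\<Sum>n\<in>F. (1 / wt n) * norm (M.coeff (M.D g) 0 n))"
      by (rule sum_mono) (use an in simp)
    also have "\<dots> \<le> sqrt ((\<Sum>\<^sub>\<infinity>n. 1 / wt n ^ 2) * \<epsilon>)"
    proof (rule real_le_rsqrt)
      have "(\<Sum>n\<in>F. (1 / wt n) * norm (M.coeff (M.D g) 0 n))\<^sup>2 \<le> (\<Sum>n\<in>F. (1 / wt n)\<^sup>2) * (\<Sum>n\<in>F. (norm (M.coeff (M.D g) 0 n))\<^sup>2)"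
        by (rule Cauchy_Schwarz_ineq_sum)
      also have "\<dots> \<le> (\<Sum>\<^sub>\<infinity>n. 1 / wt n ^ 2) * \<epsilon>"
      proof (rule mult_mono)
        show "(\<Sum>n\<in>F. (1 / wt n)\<^sup>2) \<le> (\<Sum>\<^sub>\<infinity>n. 1 / wt n ^ 2)"
          unfolding power_divide power_one
          by (rule finite_sum_le_infsum[OF summable_inverse_square_int F]) auto
        have "(\<Sum>n\<in>F. (norm (M.coeff (M.D g) 0 n))\<^sup>2) \<le> integral {0..1} (\<lambda>u. (norm (M.D g 0 u))\<^sup>2 * M.xu 0 u)"
          unfolding M.coeff_def by (rule c.bessel[OF M.smooth_periodic_cont[OF nD S0] F])
        then show "(\<Sum>n\<in>F. (norm (M.coeff (M.D g) 0 n))\<^sup>2) \<le> \<epsilon>" using int small by linarith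
      qed (auto intro!: infsum_nonneg sum_nonneg)
      finally show "(\<Sum>n\<in>F. (1 / wt n) * norm (M.coeff (M.D g) 0 n))\<^sup>2 \<le> (\<Sum>\<^sub>\<infinity>n. 1 / wt n ^ 2) * \<epsilon>" .
    qed
    finally show "(\<Sum>n\<in>F. wt n ^ 0 * norm (M.coeff g 0 n)) \<le> sqrt ((\<Sum>\<^sub>\<infinity>n. 1 / wt n ^ 2) * \<epsilon>)" .
  qed
qed

lemma cis_\<theta>_derivative:
  assumes t: "t \<ge> 0"
  shows "((\<lambda>u. cis (\<theta> t u)) has_vector_derivative cis (\<theta> t u) * (\<i> * of_real (partial_u \<theta> t u))) (at u)"
  using has_derivative_cis[OF u_smooth_derivative[OF \<theta>_smooth, of t u, unfolded has_vector_derivative_def]] t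
  by (simp add: has_vector_derivative_def scaleR_conv_of_real mult_ac)

lemma cis_\<theta>_smooth: "u_smooth {0..} (\<lambda>t u. cis (\<theta> t u))"
proof (rule u_smooth_linear_ode[where h = "\<lambda>t u. \<i> * of_real (partial_u \<theta> t u)"])
  have "continuous_on ({0..} \<times> UNIV) (\<lambda>y. \<theta> (fst y) (snd y))"
    using u_smooth_continuous[OF \<theta>_smooth] by (simp add: case_prod_unfold)
  then show "continuous_on ({0..} \<times> UNIV) (\<lambda>(t, u). cis (\<theta> t u))"
    by (auto simp: case_prod_unfold intro!: continuous_intros)
  show "u_smooth {0..} (\<lambda>t u. \<i> * of_real (partial_u \<theta> t u))"
    by (intro u_smooth_mult u_smooth_const u_smooth_of_real u_smooth_partial \<theta>_smooth) auto
qed (use cis_\<theta>_derivative in auto)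

lemma cis_\<theta>_period: "t \<ge> 0 \<Longrightarrow> cis (\<theta> t (u + 1)) = cis (\<theta> t u)"
proof -
  assume t: "t \<ge> 0"
  have "cis (2 * pi * of_int (\<sigma> * int \<omega>)) = 1" by (rule cis_multiple_2pi) auto
  then show ?thesis unfolding \<theta>_period[OF t] cis_mult[symmetric] by simp
qed

context
  assumes pos: "\<And>t u. t \<ge> 0 \<Longrightarrow> \<kappa> t u > 0"
begin

lemma \<kappa>_pos: "t \<in> {0..} \<Longrightarrow> \<kappa> t u > 0" using pos by simp

interpretation M: multiple_moving_circle "{0..}" x \<omega> by (rule circle[OF order_refl \<kappa>_pos])

lemma smooth_periodic_z: "M.smooth_periodic z"
  unfolding M.smooth_periodic_def using z_smooth z_period by simp

text \<open>The mean of \<open>z\<close> with respect to the tangent angle changes because the points move and because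
  the measure \<open>d\<theta>\<close> changes.  After two integrations by parts both effects are equal.\<close>

lemma center_derivative:
  assumes t: "t \<ge> 0"
  shows "((\<lambda>r. M.coeff z r 0) has_vector_derivative 2 * \<i> * M.coeff (\<lambda>t u. of_real (F t u)) t (- \<sigma> * int \<omega>)) (at t within {0..})"
proof -
  define c where "c = real_of_int \<sigma> / (2 * pi * \<omega>)"
  define y where "y t u = partial_u F t u / v t u" for t u
  have tS: "t \<in> {0..}" using t by simp
  have y_smooth: "u_smooth {0..} y" unfolding y_def[abs_def]
    by (intro u_smooth_divide u_smooth_partial curvature_velocity_smooth v_smooth) (use v_pos in \<open>auto simp: less_imp_neq[symmetric]\<close>)
  have xu: "M.xu r u = c * partial_u \<theta> r u" if "r \<ge> 0" for r u
    unfolding x_u_eq[OF that] \<theta>_u_eq[OF that] c_def using \<sigma>_sq by (simp add: mult.assoc[symmetric])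
  define W where "W r u = z r u * of_real (c * partial_u \<theta> r u)" for r u
  define W' where "W' r u = z r u * of_real (c * partial_u y r u) + (\<i> * F r u * cis (\<theta> r u)) * of_real (c * partial_u \<theta> r u)" for r u
  have cz: "continuous_on ({0..} \<times> UNIV) (\<lambda>w. f (fst w) (snd w))" if "u_smooth {0..} f" for f :: "real \<Rightarrow> real \<Rightarrow> complex"
    using u_smooth_continuous[OF that] by (simp add: case_prod_unfold)
  have cr: "continuous_on ({0..} \<times> UNIV) (\<lambda>w. f (fst w) (snd w))" if "u_smooth {0..} f" for f :: "real \<Rightarrow> real \<Rightarrow> real"
    using u_smooth_continuous[OF that] by (simp add: case_prod_unfold)
  have Wd: "((\<lambda>r. W r u) has_vector_derivative W' r u) (at r within {0..})" if r: "r \<ge> 0" for r u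
    unfolding W_def[abs_def] W'_def
  proof (rule has_vector_derivative_mult[OF z_t[OF r]])
    show "((\<lambda>r. complex_of_real (c * partial_u \<theta> r u)) has_vector_derivative of_real (c * partial_u y r u)) (at r within {0..})"
      by (rule bounded_linear.has_vector_derivative[OF bounded_linear_of_real has_vector_derivative_mult_right[OF \<theta>_ut[OF r, folded y_def[abs_def]]]])
  qed
  have "((\<lambda>r. integral (cbox 0 1) (W r)) has_vector_derivative integral (cbox 0 1) (W' t)) (at t within {0..})"
  proof (rule leibniz_rule_vector_derivative[OF Wd])
    show "W r integrable_on cbox 0 1" if "r \<in> {0..}" for r
    proof -
      have "continuous_on {0..1} (W r)" unfolding W_def[abs_def]
        using that by (intro continuous_intros u_smooth_continuous_slice[OF z_smooth] u_smooth_continuous_slice[OF u_smooth_partial[OF \<theta>_smooth]])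
      then show ?thesis by (simp add: integrable_continuous_real)
    qed
    have "continuous_on ({0..} \<times> UNIV) (\<lambda>w. W' (fst w) (snd w))" unfolding W'_def
      by (intro continuous_intros cz cr z_smooth u_smooth_partial y_smooth curvature_velocity_smooth \<theta>_smooth cis_\<theta>_smooth)
    then have "continuous_on ({0..} \<times> UNIV) (\<lambda>(r, u). W' r u)" by (simp add: case_prod_unfold)
    then show "continuous_on ({0..} \<times> cbox 0 1) (\<lambda>(r, u). W' r u)" by (rule continuous_on_subset) auto
  qed (use t in auto)
  then have "((\<lambda>r. integral {0..1} (W r)) has_vector_derivative integral {0..1} (W' t)) (at t within {0..})" by simp
  then have d: "((\<lambda>r. M.coeff z r 0) has_vector_derivative integral {0..1} (W' t)) (at t within {0..})"
    by (rule has_vector_derivative_transform[OF tS, rotated])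
      (simp add: M.coeff_def fourier_coeff_def W_def[abs_def] xu)
  have Fper: "F t (u + 1) = F t u" for u
    using M.smooth_periodic_period[OF smooth_periodic_F[OF order_refl \<kappa>_pos] tS, of u] by simp
  have F'per: "partial_u F t (u + 1) = partial_u F t u" for u
    by (rule periodic_deriv[of "F t" 0]) (auto simp: Fper intro: u_smooth_derivative[OF curvature_velocity_smooth(2) tS])
  note Fd = bounded_linear.has_vector_derivative[OF bounded_linear_of_real u_smooth_derivative[OF curvature_velocity_smooth(2) tS]]
  note yd = bounded_linear.has_vector_derivative[OF bounded_linear_of_real u_smooth_derivative[OF y_smooth tS]]
  note slices = u_smooth_continuous_slice[OF z_smooth tS] u_smooth_continuous_slice[OF u_smooth_partial[OF \<theta>_smooth] tS]
    u_smooth_continuous_slice[OF v_smooth tS] u_smooth_continuous_slice[OF curvature_velocity_smooth(2) tS] u_smooth_continuous_slice[OF u_smooth_partial[OF curvature_velocity_smooth(2)] tS]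
    u_smooth_continuous_slice[OF y_smooth tS] u_smooth_continuous_slice[OF u_smooth_partial[OF y_smooth] tS] u_smooth_continuous_slice[OF cis_\<theta>_smooth tS]
  \<comment> \<open>two integrations by parts over a period\<close>
  have 1: "((\<lambda>u. z t u * of_real (partial_u y t u) + (v t u * cis (\<theta> t u)) * of_real (y t u)) has_integral 0) {0..1}"
  proof -
    have "((\<lambda>u. z t u * of_real (partial_u y t u) + (v t u * cis (\<theta> t u)) * of_real (y t u)) has_integral
        z t 1 * of_real (y t 1) - z t 0 * of_real (y t 0)) {0..1}"
      by (rule fundamental_theorem_of_calculus[OF zero_le_one])
        (rule has_vector_derivative_at_within, rule has_vector_derivative_mult[OF z_u[OF t] yd])
    moreover have "z t 1 = z t 0" "y t 1 = y t 0"
      using z_period[OF t, of 0] F'per[of 0] v_period[OF t, of 0] by (simp_all add: y_def)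
    ultimately show ?thesis by simp
  qed
  have 2: "((\<lambda>u. of_real (F t u) * (cis (\<theta> t u) * (\<i> * of_real (partial_u \<theta> t u))) + of_real (partial_u F t u) * cis (\<theta> t u)) has_integral 0) {0..1}"
  proof -
    have "((\<lambda>u. of_real (F t u) * (cis (\<theta> t u) * (\<i> * of_real (partial_u \<theta> t u))) + of_real (partial_u F t u) * cis (\<theta> t u)) has_integral
        of_real (F t 1) * cis (\<theta> t 1) - of_real (F t 0) * cis (\<theta> t 0)) {0..1}"
      by (rule fundamental_theorem_of_calculus[OF zero_le_one])
        (rule has_vector_derivative_at_within, rule has_vector_derivative_mult[OF Fd cis_\<theta>_derivative[OF t]])
    moreover have "F t 1 = F t 0" "cis (\<theta> t 1) = cis (\<theta> t 0)"
      using Fper[of 0] cis_\<theta>_period[OF t, of 0] by simp_all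
    ultimately show ?thesis by simp
  qed
  have vy: "complex_of_real (v t u) * of_real (y t u) = of_real (partial_u F t u)" for u
    using v_pos[OF t, of u] by (simp add: y_def)
  define I where "I = integral {0..1} (\<lambda>u. (\<i> * F t u * cis (\<theta> t u)) * of_real (partial_u \<theta> t u))"
  have I: "((\<lambda>u. (\<i> * F t u * cis (\<theta> t u)) * of_real (partial_u \<theta> t u)) has_integral I) {0..1}"
    unfolding I_def by (intro integrable_integral integrable_continuous_real continuous_intros slices)
  have "((\<lambda>u. W' t u) has_integral of_real c * (2 * I)) {0..1}"
  proof -
    have "W' t = (\<lambda>u. of_real c * ((z t u * of_real (partial_u y t u) + (v t u * cis (\<theta> t u)) * of_real (y t u))
      - (of_real (F t u) * (cis (\<theta> t u) * (\<i> * of_real (partial_u \<theta> t u))) + of_real (partial_u F t u) * cis (\<theta> t u))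
      + 2 * ((\<i> * F t u * cis (\<theta> t u)) * of_real (partial_u \<theta> t u))))"
    proof
      fix u
      have "(v t u * cis (\<theta> t u)) * of_real (y t u) = of_real (partial_u F t u) * cis (\<theta> t u)"
        unfolding vy[symmetric] by (simp add: mult_ac)
      then show "W' t u = of_real c * ((z t u * of_real (partial_u y t u) + (v t u * cis (\<theta> t u)) * of_real (y t u))
        - (of_real (F t u) * (cis (\<theta> t u) * (\<i> * of_real (partial_u \<theta> t u))) + of_real (partial_u F t u) * cis (\<theta> t u))
        + 2 * ((\<i> * F t u * cis (\<theta> t u)) * of_real (partial_u \<theta> t u)))"
        by (simp add: W'_def algebra_simps)
    qed
    moreover have "((\<lambda>u. of_real c * ((z t u * of_real (partial_u y t u) + (v t u * cis (\<theta> t u)) * of_real (y t u))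
      - (of_real (F t u) * (cis (\<theta> t u) * (\<i> * of_real (partial_u \<theta> t u))) + of_real (partial_u F t u) * cis (\<theta> t u))
      + 2 * ((\<i> * F t u * cis (\<theta> t u)) * of_real (partial_u \<theta> t u)))) has_integral of_real c * (0 - 0 + 2 * I)) {0..1}"
      by (intro has_integral_mult_right has_integral_add has_integral_diff 1 2 I)
    ultimately show ?thesis by simp
  qed
  then have W'I: "integral {0..1} (W' t) = 2 * (of_real c * I)" by (simp add: integral_unique)
  have "\<i> * M.coeff (\<lambda>t u. of_real (F t u)) t (- \<sigma> * int \<omega>) = of_real c * I"
  proof -
    have "- (2 * pi * of_int (- \<sigma> * int \<omega>) * x t u) = \<theta> t u" for u
      by (subst \<theta>_eq) (simp add: mult_ac)
    then have "M.coeff (\<lambda>t u. of_real (F t u)) t (- \<sigma> * int \<omega>) = integral {0..1} (\<lambda>u. of_real (F t u) * cis (\<theta> t u) * of_real (c * partial_u \<theta> t u))"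
      unfolding M.coeff_def fourier_coeff_def by (simp only: xu[OF t])
    then have "\<i> * M.coeff (\<lambda>t u. of_real (F t u)) t (- \<sigma> * int \<omega>) =
        \<i> * integral {0..1} (\<lambda>u. of_real (F t u) * cis (\<theta> t u) * of_real (c * partial_u \<theta> t u))" by simp
    also have "\<dots> = integral {0..1} (\<lambda>u. \<i> * (of_real (F t u) * cis (\<theta> t u) * of_real (c * partial_u \<theta> t u)))"
      by (rule integral_mult_right[symmetric])
    also have "\<dots> = integral {0..1} (\<lambda>u. of_real c * ((\<i> * F t u * cis (\<theta> t u)) * of_real (partial_u \<theta> t u)))"
      by (rule integral_cong) (simp add: mult_ac)
    also have "\<dots> = of_real c * I" unfolding I_def by (rule integral_mult_right)
    finally show ?thesis .
  qed
  then have "integral {0..1} (W' t) = 2 * \<i> * M.coeff (\<lambda>t u. of_real (F t u)) t (- \<sigma> * int \<omega>)"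
    unfolding W'I by (simp add: mult.assoc)
  with d show ?thesis by simp
qed

text \<open>The speed of the centre is at most \<open>o(1) R\<^sup>-\<^sup>3\<close>, hence \<open>o(1) R'\<close>, because a circle has no mode
  \<open>\<plusminus> \<omega>\<close> in its normal velocity.\<close>

lemma center_tendsto:
  assumes G0: "G 0 0 < threshold 0"
  shows "((\<lambda>t. M.coeff z t 0 / R t) \<longlongrightarrow> 0) at_top"
proof (rule tendstoI)
  fix e :: real assume e: "e > 0"
  \<comment> \<open>\<open>104 = 4 * 13 * 2\<close>, with 13 from the bound for \<open>H\<close> and 2 from the passage from \<open>g\<close> to \<open>b\<close>\<close>
  have "\<forall>\<^sub>F t in at_top. G 2 t < e / 104"
    using G_tendsto_0[OF pos G0, of 2] e by (intro order_tendstoD(2)[of _ 0]) auto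
  moreover have "\<forall>\<^sub>F t in at_top. G 0 t < 1 / 64"
    using G_tendsto_0[OF pos G0, of 0] by (intro order_tendstoD(2)[of _ 0]) auto
  ultimately have "\<forall>\<^sub>F t in at_top. G 2 t < e / 104 \<and> G 0 t < 1 / 64" by eventually_elim simp
  then obtain T0 where T0: "\<And>t. t \<ge> T0 \<Longrightarrow> G 2 t < e / 104 \<and> G 0 t < 1 / 64"
    unfolding eventually_at_top_linorder by blast
  define T where "T = max T0 0"
  have T: "T \<ge> 0" "\<And>t. t \<ge> T \<Longrightarrow> G 2 t < e / 104" "\<And>t. t \<ge> T \<Longrightarrow> G 0 t < 1 / 64"
    using T0 by (auto simp: T_def)
  let ?c = "\<lambda>t. M.coeff z t 0"
  let ?c' = "\<lambda>t. 2 * \<i> * M.coeff (\<lambda>t u. of_real (F t u)) t (- \<sigma> * int \<omega>)"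
  have bnd: "norm (?c' t) \<le> (e / 2) * (1 / (2 * R t ^ 3))" if t: "t \<ge> T" for t
  proof -
    have t0: "t \<ge> 0" and tS: "t \<in> {0..}" using t T by auto
    have Rp: "R t > 0" by (rule R_pos[OF t0])
    note nb = smooth_periodic_b[OF order_refl \<kappa>_pos] and ng = smooth_periodic_g[OF order_refl \<kappa>_pos]
    have sm: "2 ^ 2 * wnorm 0 (M.coeff g t) \<le> 1 / 4" using T(3)[OF t] by (simp add: G_def)
    note rec = M.reciprocal_wnorm[OF ng nb tS reciprocal[OF order_refl \<kappa>_pos] sm]
    have "wnorm 0 (M.coeff b t) \<le> 1 / 2" using rec(1) T(3)[OF t] by (simp add: G_def)
    from M.coeff_H_bound[OF nb tS _ this, of "- \<sigma> * int \<omega>"]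
    have "norm (M.coeff (M.H b) t (- \<sigma> * int \<omega>)) \<le> 13 * wnorm 2 (M.coeff b t)" using \<sigma>_cases \<omega>_ge_1 by auto
    also have "\<dots> \<le> 13 * (2 * G 2 t)" using rec(2) by (simp add: G_def)
    also have "\<dots> \<le> e / 4" using T(2)[OF t] by simp
    finally have H: "norm (M.coeff (M.H b) t (- \<sigma> * int \<omega>)) \<le> e / 4" .
    have "norm (M.coeff (\<lambda>t u. of_real (F t u)) t (- \<sigma> * int \<omega>)) = norm (\<sigma> * M.coeff (\<lambda>t u. of_real (F t u)) t (- \<sigma> * int \<omega>))"
      using \<sigma>_cases by (auto simp: norm_mult)
    also have "\<dots> = 1 / 2 * (1 / R t ^ 3) * norm (M.coeff (M.H b) t (- \<sigma> * int \<omega>))"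
    proof -
      have "\<sigma> * M.coeff (\<lambda>t u. of_real (F t u)) t (- \<sigma> * int \<omega>) =
          - (1 / 2) * of_real (1 / R t ^ 3) * M.coeff (M.H b) t (- \<sigma> * int \<omega>)"
        by (rule coeff_F[OF order_refl \<kappa>_pos tS])
      then show ?thesis using Rp by (simp only: norm_mult) (simp add: norm_divide norm_power)
    qed
    finally have "norm (?c' t) = (1 / R t ^ 3) * norm (M.coeff (M.H b) t (- \<sigma> * int \<omega>))"
      by (simp add: norm_mult)
    also have "\<dots> \<le> (1 / R t ^ 3) * (e / 4)" using H Rp by (intro mult_left_mono) auto
    finally show ?thesis by (simp add: mult_ac)
  qed
  have diff: "norm (?c t - ?c T) \<le> e / 2 * R t - e / 2 * R T" if t: "t > T" for t
  proof (rule differentiable_bound_general[OF t, of ?c "\<lambda>t. e / 2 * R t" ?c' "\<lambda>t. e / 2 * (1 / (2 * R t ^ 3))"])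
    have "continuous_on {0..} ?c"
      unfolding continuous_on_eq_continuous_within
      using has_vector_derivative_continuous[OF center_derivative] by auto
    then show "continuous_on {T..t} ?c" by (rule continuous_on_subset) (use T in auto)
    have "continuous_on {T..t} R" by (rule continuous_on_subset[OF R_cont]) (use T in auto)
    then show "continuous_on {T..t} (\<lambda>t. e / 2 * R t)" by (intro continuous_intros)
    fix r assume r: "T < r" "r < t"
    then have r0: "r \<ge> 0" and rp: "r > 0" using T by auto
    have "at r within {0..} = at r" by (rule at_within_interior) (use rp in \<open>simp add: interior_real_atLeast\<close>)
    with center_derivative[OF r0] show "(?c has_vector_derivative ?c' r) (at r)" by simp
    show "((\<lambda>t. e / 2 * R t) has_vector_derivative e / 2 * (1 / (2 * R r ^ 3))) (at r)"
      using R_deriv[OF r0, of UNIV] by (intro has_vector_derivative_mult_right) (simp add: has_real_derivative_iff_has_vector_derivative)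
    show "norm (?c' r) \<le> e / 2 * (1 / (2 * R r ^ 3))" by (rule bnd) (use r in simp)
  qed
  have "\<forall>\<^sub>F t in at_top. norm (?c T) / (e / 2) < R t"
    using R_at_top unfolding filterlim_at_top_dense by blast
  then show "\<forall>\<^sub>F t in at_top. dist (?c t / R t) 0 < e"
    using eventually_gt_at_top[of T]
  proof eventually_elim
    case (elim t)
    have Rp: "R t > 0" "R T > 0" using R_pos elim T by auto
    have "norm (?c t) \<le> norm (?c T) + norm (?c t - ?c T)" using norm_triangle_sub[of "?c t" "?c T"] by simp
    also have "\<dots> \<le> norm (?c T) + (e / 2 * R t - e / 2 * R T)" using diff[OF elim(2)] by simp
    also have "\<dots> \<le> norm (?c T) + e / 2 * R t" using Rp e by simp
    also have "norm (?c T) < e / 2 * R t" using elim(1) e by (simp add: pos_divide_less_eq mult.commute)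
    finally have "norm (?c t) < e * R t" by simp
    then show ?case using Rp by (simp add: norm_divide pos_divide_less_eq)
  qed
qed

end
end

section \<open>Smooth convergence\<close>

lemma smooth_Suc: "smooth f \<Longrightarrow> smooth (\<lambda>u. vector_derivative f (at u))"
  unfolding smooth_def
proof (intro allI)
  fix n u assume *: "\<forall>n u. iterated_vd n f differentiable (at u)"
  have "iterated_vd n (\<lambda>u. vector_derivative f (at u)) = iterated_vd (Suc n) f"
    by (simp only: funpow_Suc_right o_def)
  with *[rule_format, of "Suc n" u]
  show "iterated_vd n (\<lambda>u. vector_derivative f (at u)) differentiable (at u)" by (simp only:)
qed

lemma smooth_derivative: "smooth f \<Longrightarrow> (f has_vector_derivative vector_derivative f (at u)) (at u)"
proof -
  assume "smooth f"
  then have "iterated_vd 0 f differentiable (at u)" unfolding smooth_def by blast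
  then have "f differentiable (at u)" by simp
  then show ?thesis by (rule vector_derivative_works[THEN iffD1])
qed

lemma iterated_vd_add:
  "smooth f \<Longrightarrow> smooth g \<Longrightarrow> iterated_vd n (\<lambda>u. f u + g u) = (\<lambda>u. iterated_vd n f u + iterated_vd n g u)"
proof (induction n arbitrary: f g)
  case (Suc n)
  have "(\<lambda>v. vector_derivative (\<lambda>u. f u + g u) (at v)) = (\<lambda>v. vector_derivative f (at v) + vector_derivative g (at v))"
    using Suc.prems by (intro ext vector_derivative_at has_vector_derivative_add smooth_derivative)
  then show ?case using Suc.IH[OF smooth_Suc[OF Suc.prems(1)] smooth_Suc[OF Suc.prems(2)]]
    by (simp only: funpow_Suc_right o_def)
qed simp

lemma iterated_vd_linear:
  assumes h: "bounded_linear h"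
  shows "smooth f \<Longrightarrow> iterated_vd n (\<lambda>u. h (f u)) = (\<lambda>u. h (iterated_vd n f u))"
proof (induction n arbitrary: f)
  case (Suc n)
  have "(\<lambda>v. vector_derivative (\<lambda>u. h (f u)) (at v)) = (\<lambda>v. h (vector_derivative f (at v)))"
    using Suc.prems by (intro ext vector_derivative_at bounded_linear.has_vector_derivative[OF h] smooth_derivative)
  then show ?case using Suc.IH[OF smooth_Suc[OF Suc.prems]]
    by (simp only: funpow_Suc_right o_def)
qed simp

lemma smooth_affine: "smooth (\<lambda>y::real. a * y + c)"
proof -
  have id: "u_smooth {0} (\<lambda>t u. u)"
  proof (rule u_smoothI)
    show "u_smooth {0} (\<lambda>t u. 1::real)" by (rule u_smooth_const) simp
  qed (auto simp: case_prod_unfold intro!: continuous_intros)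
  have "u_smooth {0} (\<lambda>t u. a * u + c)"
    by (intro u_smooth_add u_smooth_mult u_smooth_const id) auto
  from u_smooth_imp_smooth[OF this, of 0] show ?thesis by simp
qed

text \<open>The derivative with respect to \<open>x t\<close> for values in any normed space.\<close>

definition coord_deriv :: "(real \<Rightarrow> real \<Rightarrow> real) \<Rightarrow> (real \<Rightarrow> real \<Rightarrow> 'a::real_normed_vector) \<Rightarrow> real \<Rightarrow> real \<Rightarrow> 'a" where
  "coord_deriv x f t u = (1 / partial_u x t u) *\<^sub>R partial_u f t u"

context moving_circle begin

lemma u_smooth_coord_deriv: "u_smooth S f \<Longrightarrow> u_smooth S (coord_deriv x f)"
  unfolding coord_deriv_def[abs_def]
  by (intro u_smooth_bilinear[OF bounded_bilinear_scaleR] u_smooth_divide u_smooth_const u_smooth_partial x_smooth)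
    (use xu_pos in \<open>auto simp: less_imp_neq[symmetric]\<close>)

lemma coord_deriv_complex: "coord_deriv x f = D f"
  by (simp add: fun_eq_iff coord_deriv_def D_def scaleR_conv_of_real divide_inverse mult.commute)

definition inverse_coordinate :: "real \<Rightarrow> real \<Rightarrow> real" where
  "inverse_coordinate t = inv (x t)"

context
  fixes t assumes t: "t \<in> S"
begin

interpretation c: circle_coordinate "x t" "xu t" by (rule coordinate[OF t])

abbreviation "\<phi> \<equiv> inverse_coordinate t"

lemma surj_x: "surj (x t)"
proof -
  have X_int: "x t (of_int k) = x t 0 + of_int k" for k :: int
  proof (induction k rule: int_induct[of _ 0])
    case base then show ?case by simp
  next
    case (step1 i) then show ?case using x_period[OF t, of "of_int i"] by (simp add: add.assoc)
  next
    case (step2 i) then show ?case using x_period[OF t, of "of_int (i - 1)"] by simp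
  qed
  have "\<exists>u. x t u = y" for y
  proof -
    define k where "k = \<lfloor>y - x t 0\<rfloor>"
    have "x t (of_int k) \<le> y" "y \<le> x t (of_int (k + 1))"
      unfolding X_int k_def by linarith+
    then show ?thesis using IVT'[of "x t" "of_int k" y "of_int (k + 1)"] c.X_cont by auto
  qed
  then show ?thesis unfolding surj_def by metis
qed

lemma x_\<phi>: "x t (\<phi> y) = y"
  unfolding inverse_coordinate_def by (rule surj_f_inv_f[OF surj_x])

lemma \<phi>_x: "\<phi> (x t u) = u"
  unfolding inverse_coordinate_def
  by (rule inv_f_f) (rule strict_mono_imp_inj_on[OF c.X_strict_mono])

lemma \<phi>_period: "\<phi> (y + 1) = \<phi> y + 1"
proof -
  have "x t (\<phi> y + 1) = y + 1" using x_period[OF t, of "\<phi> y"] by (simp add: x_\<phi>)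
  then show ?thesis using \<phi>_x[of "\<phi> y + 1"] by simp
qed

lemma \<phi>_derivative: "(\<phi> has_real_derivative 1 / xu t (\<phi> y)) (at y)"
proof -
  have "isCont \<phi> (x t (\<phi> y))"
    by (rule isCont_inverse_function[where f = "x t" and d = 1])
      (use c.X_cont[of UNIV] in \<open>auto simp: \<phi>_x continuous_on_eq_continuous_at\<close>)
  then have cont: "isCont \<phi> y" by (simp add: x_\<phi>)
  have "(\<phi> has_real_derivative inverse (xu t (\<phi> y))) (at y)"
    by (rule DERIV_inverse_function[where f = "x t" and a = "y - 1" and b = "y + 1"])
      (use c.X_deriv[of "\<phi> y"] c.X'_pos[of "\<phi> y"] cont in \<open>auto simp: x_\<phi>\<close>)
  then show ?thesis by (simp add: inverse_eq_divide)
qed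

lemma compose_derivative:
  assumes "u_smooth S f"
  shows "((\<lambda>y. f t (\<phi> y)) has_vector_derivative coord_deriv x f t (\<phi> y)) (at y)"
  using vector_diff_chain_at[OF \<phi>_derivative[of y, unfolded has_real_derivative_iff_has_vector_derivative]
      u_smooth_derivative[OF assms t, of "\<phi> y"]]
  by (simp add: o_def coord_deriv_def)

text \<open>The derivatives in the new parameter are iterates of the coordinate derivative, so no formula
  for higher derivatives of a composition is needed.\<close>

lemma iterated_vd_compose:
  "u_smooth S f \<Longrightarrow> iterated_vd n (\<lambda>y. f t (\<phi> y)) = (\<lambda>y. (coord_deriv x ^^ n) f t (\<phi> y))"
proof (induction n arbitrary: f)
  case (Suc n)
  have "(\<lambda>v. vector_derivative (\<lambda>y. f t (\<phi> y)) (at v)) = (\<lambda>v. coord_deriv x f t (\<phi> v))"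
    using compose_derivative[OF Suc.prems] by (intro ext vector_derivative_at)
  then show ?case using Suc.IH[OF u_smooth_coord_deriv[OF Suc.prems]]
    by (simp only: funpow_Suc_right o_def)
qed simp

lemma smooth_compose:
  assumes f: "u_smooth S f"
  shows "smooth (\<lambda>y. f t (\<phi> y))"
  unfolding smooth_def
proof (intro allI)
  fix n y
  have "u_smooth S ((coord_deriv x ^^ n) f)" using f by (induction n) (auto intro: u_smooth_coord_deriv)
  from compose_derivative[OF this] show "iterated_vd n (\<lambda>y. f t (\<phi> y)) differentiable (at y)"
    unfolding iterated_vd_compose[OF f] by (rule differentiableI_vector)
qed

lemma circle_diffeo_\<phi>: "circle_diffeo \<phi>"
proof -
  have "u_smooth S (\<lambda>t u. u)"
  proof (rule u_smoothI)
    show "u_smooth S (\<lambda>t u. 1::real)" by (rule u_smooth_const) simp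
  qed (auto simp: case_prod_unfold intro!: continuous_intros)
  from smooth_compose[OF this] have "smooth \<phi>" by simp
  then have 1: "circle_map_lift \<phi>" unfolding circle_map_lift_def
    using \<phi>_period by (intro conjI exI[of _ 1]) auto
  have 2: "circle_map_lift (x t)" unfolding circle_map_lift_def
    using u_smooth_imp_smooth[OF x_smooth t] x_period[OF t] by (intro conjI exI[of _ 1]) auto
  show ?thesis unfolding circle_diffeo_def using 1 2 x_\<phi> \<phi>_x by blast
qed

end
end

text \<open>Multiplication of a function by a character shifts its coefficients.\<close>

lemma wnorm_shift:
  assumes "rapid a"
  shows "rapid (\<lambda>n. a (n - m))" "wnorm j (\<lambda>n. a (n - m)) \<le> wt m ^ j * wnorm j a"
proof -
  have *: "(\<Sum>n\<in>F. wt n ^ j * norm (a (n - m))) \<le> wt m ^ j * wnorm j a" if F: "finite F" for F j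
  proof -
    have "(\<Sum>n\<in>F. wt n ^ j * norm (a (n - m))) \<le> (\<Sum>n\<in>F. wt m ^ j * (wt (n - m) ^ j * norm (a (n - m))))"
    proof (rule sum_mono)
      fix n
      have "wt n \<le> wt m * wt (n - m)"
      proof -
        have "\<bar>real_of_int n\<bar> \<le> \<bar>real_of_int m\<bar> + \<bar>real_of_int (n - m)\<bar>" by simp
        moreover have "0 \<le> \<bar>real_of_int m\<bar> * \<bar>real_of_int (n - m)\<bar>" by simp
        ultimately show ?thesis by (simp only: distrib_left distrib_right mult_1_left mult_1_right)
      qed
      then have "wt n ^ j \<le> (wt m * wt (n - m)) ^ j" by (intro power_mono) auto
      then have "wt n ^ j * norm (a (n - m)) \<le> (wt m * wt (n - m)) ^ j * norm (a (n - m))" by (rule mult_right_mono) simp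
      then show "wt n ^ j * norm (a (n - m)) \<le> wt m ^ j * (wt (n - m) ^ j * norm (a (n - m)))"
        by (simp only: power_mult_distrib mult.assoc)
    qed
    also have "\<dots> = wt m ^ j * (\<Sum>n\<in>F. wt (n - m) ^ j * norm (a (n - m)))" by (simp only: sum_distrib_left)
    also have "(\<Sum>n\<in>F. wt (n - m) ^ j * norm (a (n - m))) = (\<Sum>l\<in>(\<lambda>n. n - m) ` F. wt l ^ j * norm (a l))"
      by (subst sum.reindex) (auto simp: inj_on_def)
    also have "wt m ^ j * \<dots> \<le> wt m ^ j * wnorm j a"
      by (intro mult_left_mono sum_le_wnorm assms) (use F in auto)
    finally show ?thesis .
  qed
  show "rapid (\<lambda>n. a (n - m))" unfolding rapid_def using wnorm_leI(1)[OF *] by blast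
  show "wnorm j (\<lambda>n. a (n - m)) \<le> wt m ^ j * wnorm j a" by (rule wnorm_leI(2)[OF *])
qed

text \<open>This circle is the primitive of the unit tangent \<open>cis (2 \<pi> \<sigma> \<omega> y)\<close>; it is the standard circle
  after a rotation by a quarter turn, and after a reversal if \<open>\<sigma> = - 1\<close>.\<close>

lemma multiple_circle_explicit:
  assumes \<omega>: "\<omega> \<ge> 1" and \<sigma>: "\<sigma> = 1 \<or> \<sigma> = (- 1 :: int)"
  shows "multiple_circle \<omega> (1 / (2 * real \<omega> * pi)) (\<lambda>y. plane (cis (2 * pi * \<sigma> * \<omega> * y) / (2 * pi * \<i> * \<sigma> * \<omega>)))"
  unfolding multiple_circle_def
proof (intro exI conjI allI)
  define \<phi> where "\<phi> y = of_int \<sigma> * (y - 1 / (4 * real \<omega>))" for y :: real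
  have ss: "real_of_int \<sigma> * (real_of_int \<sigma> * a) = a" for a using \<sigma> by auto
  have 1: "circle_map_lift \<phi>" unfolding circle_map_lift_def
  proof (intro conjI exI[of _ \<sigma>] allI)
    have "\<phi> = (\<lambda>y. of_int \<sigma> * y + (- of_int \<sigma> / (4 * real \<omega>)))" by (auto simp: \<phi>_def fun_eq_iff algebra_simps)
    then show "smooth \<phi>" using smooth_affine[of "of_int \<sigma>" "- of_int \<sigma> / (4 * real \<omega>)"] by simp
  qed (simp add: \<phi>_def algebra_simps)
  have 2: "circle_map_lift (\<lambda>y. of_int \<sigma> * y + 1 / (4 * real \<omega>))" unfolding circle_map_lift_def
    by (intro conjI exI[of _ \<sigma>] allI smooth_affine) (simp add: algebra_simps)
  show "circle_diffeo \<phi>" unfolding circle_diffeo_def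
    by (intro conjI 1 exI[of _ "\<lambda>y. of_int \<sigma> * y + 1 / (4 * real \<omega>)"] 2) (auto simp: \<phi>_def ss)
  fix y :: real
  define A where "A = 2 * pi * real \<omega> * y"
  have arg: "2 * pi * real \<omega> * \<phi> y = \<sigma> * A - \<sigma> * (pi / 2)"
    using \<omega> by (simp add: \<phi>_def A_def field_simps)
  have "cis (2 * pi * \<sigma> * \<omega> * y) / (2 * pi * \<i> * \<sigma> * \<omega>) = of_real (1 / (2 * real \<omega> * pi)) * (- \<i> * \<sigma> * cis (\<sigma> * A))"
    using \<sigma> \<omega> by (auto simp: A_def field_simps)
  also have "- \<i> * \<sigma> * cis (\<sigma> * A) = Complex (cos (\<sigma> * A - \<sigma> * (pi / 2))) (sin (\<sigma> * A - \<sigma> * (pi / 2)))"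
    using \<sigma> by (auto simp: complex_eq_iff cos_diff sin_diff cos_add sin_add)
  finally have "cis (2 * pi * \<sigma> * \<omega> * y) / (2 * pi * \<i> * \<sigma> * \<omega>) =
      (1 / (2 * real \<omega> * pi)) *\<^sub>R Complex (cos (\<sigma> * A - \<sigma> * (pi / 2))) (sin (\<sigma> * A - \<sigma> * (pi / 2)))"
    by (simp only: scaleR_conv_of_real)
  then show "plane (cis (2 * pi * \<sigma> * \<omega> * y) / (2 * pi * \<i> * \<sigma> * \<omega>)) =
      (1 / (2 * real \<omega> * pi)) *\<^sub>R vector [cos (2 * pi * real \<omega> * \<phi> y), sin (2 * pi * real \<omega> * \<phi> y)]"
    unfolding arg by (simp add: plane_def vec_eq_iff forall_2)
qed

context winding_flow begin

context
  assumes pos: "\<And>t u. t \<ge> 0 \<Longrightarrow> \<kappa> t u > 0" and G0: "G 0 0 < threshold 0"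
begin

lemma \<kappa>_pos': "t \<in> {0..} \<Longrightarrow> \<kappa> t u > 0" using pos by simp

interpretation M: multiple_moving_circle "{0..}" x \<omega> by (rule circle[OF order_refl \<kappa>_pos'])

lemma smooth_periodic_g': "M.smooth_periodic g" by (rule smooth_periodic_g[OF order_refl \<kappa>_pos'])

lemma length_ratio:
  assumes t: "t \<ge> 0"
  shows "of_real (L t / (2 * pi * \<omega> * R t)) = 1 + M.coeff g t 0"
proof -
  have tS: "t \<in> {0..}" using t by simp
  have rho: "M.coeff rho t 0 = of_real (L t) / of_real (2 * pi * \<omega>)" by (rule coeff_rho_0[OF order_refl \<kappa>_pos' tS])
  have "M.coeff g t 0 = M.coeff rho t 0 / R t - (if (0::int) = 0 then 1 else 0)"
    by (rule coeff_g_eq[OF order_refl \<kappa>_pos' tS])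
  then show ?thesis unfolding rho by simp
qed

lemma length_ratio_tendsto: "((\<lambda>t. L t / (2 * pi * \<omega> * R t)) \<longlongrightarrow> 1) at_top"
proof -
  have "((\<lambda>t. L t / (2 * pi * \<omega> * R t) - 1) \<longlongrightarrow> 0) at_top"
  proof (rule Lim_null_comparison[OF _ G_tendsto_0[OF pos G0, of 0]])
    show "\<forall>\<^sub>F t in at_top. norm (L t / (2 * pi * \<omega> * R t) - 1) \<le> G 0 t"
      using eventually_ge_at_top[of 0]
    proof eventually_elim
      case (elim t)
      then have tS: "t \<in> {0..}" by simp
      have "complex_of_real (L t / (2 * pi * \<omega> * R t) - 1) = M.coeff g t 0"
        using length_ratio[OF elim] by (simp only: of_real_diff) simp
      then have "norm (L t / (2 * pi * \<omega> * R t) - 1) = norm (M.coeff g t 0)" by (metis norm_of_real real_norm_def)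
      also have "\<dots> \<le> G 0 t"
        using term_le_wnorm[OF M.coeff_rapid[OF smooth_periodic_g' tS], of 0 0] by (simp add: G_def)
      finally show ?case .
    qed
  qed
  then show ?thesis by (rule LIM_zero_cancel)
qed

text \<open>The rescaled curve minus the point of the limit circle with the same tangent direction.\<close>

definition h :: "real \<Rightarrow> real \<Rightarrow> complex" where
  "h t u = z t u * of_real (1 / L t) - cis (\<theta> t u) * (1 / (2 * pi * \<i> * \<sigma> * \<omega>))"

lemma L_cont: "continuous_on {0..} L"
proof -
  have "continuous_on {0..} (\<lambda>t. of_real (R t) * (1 + M.coeff g t 0) * of_real (2 * pi * \<omega>))"
  proof (intro continuous_intros R_cont)
    show "continuous_on {0..} (\<lambda>t. M.coeff g t 0)"
      unfolding continuous_on_eq_continuous_within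
      by (intro ballI has_vector_derivative_continuous, rule coeff_g_derivative[OF order_refl \<kappa>_pos'])
  qed
  then have "continuous_on {0..} (\<lambda>t. Re (of_real (R t) * (1 + M.coeff g t 0) * of_real (2 * pi * \<omega>)))"
    by (rule continuous_on_Re)
  then show ?thesis
  proof (rule continuous_on_eq)
    fix t :: real assume "t \<in> {0..}"
    then have t: "t \<ge> 0" by simp
    show "Re (of_real (R t) * (1 + M.coeff g t 0) * of_real (2 * pi * \<omega>)) = L t"
      unfolding length_ratio[OF t, symmetric] of_real_mult[symmetric] Re_complex_of_real
      using R_pos[OF t] \<omega>_ge_1 by simp
  qed
qed

lemma smooth_periodic_cis: "M.smooth_periodic (\<lambda>t u. cis (\<theta> t u))"
  unfolding M.smooth_periodic_def using cis_\<theta>_smooth cis_\<theta>_period by simp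

lemma smooth_periodic_z_L: "M.smooth_periodic (\<lambda>t u. z t u * of_real (1 / L t))"
proof (rule M.smooth_periodic_mult[OF smooth_periodic_z[OF pos]])
  have "continuous_on {0..} (\<lambda>t. complex_of_real (1 / L t))"
    by (intro continuous_intros L_cont) (use L_pos in \<open>auto simp: less_imp_neq[symmetric]\<close>)
  then show "M.smooth_periodic (\<lambda>t u. of_real (1 / L t))" by (rule M.smooth_periodic_const)
qed

lemma smooth_periodic_h: "M.smooth_periodic h"
  unfolding h_def[abs_def]
  by (intro M.smooth_periodic_diff smooth_periodic_z_L M.smooth_periodic_mult smooth_periodic_cis M.smooth_periodic_const continuous_intros)

lemma cis_\<theta>_chr: "cis (\<theta> t u) = cis (2 * pi * of_int (\<sigma> * int \<omega>) * x t u)"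
  by (subst \<theta>_eq) (simp add: mult_ac)

lemma coeff_cis_mult:
  "t \<in> {0..} \<Longrightarrow> M.coeff (\<lambda>t u. f t u * cis (\<theta> t u)) t n = M.coeff f t (n - \<sigma> * int \<omega>)"
proof -
  assume t: "t \<in> {0..}"
  interpret c: circle_coordinate "x t" "M.xu t" by (rule M.coordinate[OF t])
  show ?thesis unfolding M.coeff_def cis_\<theta>_chr by (rule c.fc_shift)
qed

text \<open>Both curves have the same unit tangent, so only the difference of their length elements remains;
  division by \<open>L\<close> has removed the mean of \<open>g\<close>.\<close>

lemma D_h:
  assumes t: "t \<ge> 0"
  shows "M.D h t u = of_real (2 * pi * \<omega> * R t / L t) * (g t u - M.coeff g t 0) * cis (\<theta> t u)"
proof -
  have Rp: "R t > 0" and Lp: "L t > 0" and kp: "\<kappa> t u > 0" and vp: "v t u > 0"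
    using t R_pos L_pos pos v_pos by auto
  have w: "real \<omega> \<noteq> 0" using \<omega>_ge_1 by simp
  have "(h t has_vector_derivative v t u * cis (\<theta> t u) * of_real (1 / L t) -
      cis (\<theta> t u) * (\<i> * of_real (partial_u \<theta> t u)) * (1 / (2 * pi * \<i> * \<sigma> * \<omega>))) (at u)"
    unfolding h_def[abs_def]
    by (intro has_vector_derivative_diff has_vector_derivative_mult_left z_u[OF t] cis_\<theta>_derivative[OF t])
  then have "partial_u h t u = v t u * cis (\<theta> t u) * of_real (1 / L t) -
      cis (\<theta> t u) * (\<i> * of_real (partial_u \<theta> t u)) * (1 / (2 * pi * \<i> * \<sigma> * \<omega>))" by (rule partial_u_eqI)
  also have "\<dots> = of_real (v t u / L t - \<kappa> t u * v t u / (2 * pi * \<omega>)) * cis (\<theta> t u)"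
    unfolding \<theta>_u_eq[OF t] using \<sigma>_cases w Lp by (auto simp: field_simps)
  finally have "M.D h t u = of_real ((v t u / L t - \<kappa> t u * v t u / (2 * pi * \<omega>)) / (\<kappa> t u * v t u / (2 * pi * \<omega>))) * cis (\<theta> t u)"
    by (simp add: M.D_def x_u_eq[OF t])
  also have "(v t u / L t - \<kappa> t u * v t u / (2 * pi * \<omega>)) / (\<kappa> t u * v t u / (2 * pi * \<omega>)) =
      2 * pi * \<omega> * R t / L t * (1 / (\<kappa> t u * R t) - 1 - (L t / (2 * pi * \<omega> * R t) - 1))"
    using w Lp Rp kp vp by (simp add: field_simps)
  also have "complex_of_real \<dots> = of_real (2 * pi * \<omega> * R t / L t) * (g t u - M.coeff g t 0)"
  proof -
    have "M.coeff g t 0 = of_real (L t / (2 * pi * \<omega> * R t) - 1)"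
      using length_ratio[OF t] by (simp only: of_real_diff) simp
    then show ?thesis by (simp only: g_def of_real_mult of_real_diff)
  qed
  finally show ?thesis by simp
qed

text \<open>The coefficient of \<open>h\<close> at 0 is the centre of the rescaled curve.  The other ones are at most those
  of \<open>D h\<close>, which are shifted coefficients of \<open>g\<close>.\<close>

lemma wnorm_h_le:
  assumes t: "t \<ge> 0"
  shows "wnorm j (M.coeff h t) \<le> norm (M.coeff z t 0) / L t + (2 * pi * \<omega> * R t / L t) * (wt (\<sigma> * int \<omega>) ^ j * G j t)"
proof -
  have tS: "t \<in> {0..}" using t by simp
  have Rp: "R t > 0" and Lp: "L t > 0" using t R_pos L_pos by auto
  define lam where "lam = 2 * pi * \<omega> * R t / L t"
  have lam: "lam \<ge> 0" using Rp Lp by (simp add: lam_def)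
  note ng = smooth_periodic_g'
  let ?m = "\<sigma> * int \<omega>"
  have cD: "norm (M.coeff (M.D h) t n) \<le> lam * norm (M.coeff g t (n - ?m))" for n
  proof -
    have "M.coeff (M.D h) t n = M.coeff (\<lambda>t' u. (of_real lam * (g t' u - M.coeff g t 0)) * cis (\<theta> t' u)) t n"
      by (rule M.coeff_cong) (simp only: D_h[OF t] lam_def)
    also have "\<dots> = M.coeff (\<lambda>t' u. of_real lam * (g t' u - M.coeff g t 0)) t (n - ?m)" by (rule coeff_cis_mult[OF tS])
    also have "\<dots> = of_real lam * M.coeff (\<lambda>t' u. g t' u - M.coeff g t 0) t (n - ?m)"
      using M.coeff_cmult[OF tS, of "\<lambda>_. of_real lam"] by simp
    also have "M.coeff (\<lambda>t' u. g t' u - M.coeff g t 0) t (n - ?m) = M.coeff g t (n - ?m) - (if n - ?m = 0 then M.coeff g t 0 else 0)"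
      using M.coeff_diff[OF ng M.smooth_periodic_const tS, of "\<lambda>_. M.coeff g t 0" "n - ?m"] M.coeff_const[OF tS, of "\<lambda>_. M.coeff g t 0" "n - ?m"] by simp
    finally have "norm (M.coeff (M.D h) t n) = lam * norm (M.coeff g t (n - ?m) - (if n - ?m = 0 then M.coeff g t 0 else 0))"
      using lam by (simp add: norm_mult)
    also have "\<dots> \<le> lam * norm (M.coeff g t (n - ?m))" using lam by (intro mult_left_mono) auto
    finally show ?thesis .
  qed
  have h0: "M.coeff h t 0 = M.coeff z t 0 * of_real (1 / L t)"
  proof -
    have one: "M.smooth_periodic (\<lambda>t u. cis (\<theta> t u) * (1 / (2 * pi * \<i> * \<sigma> * \<omega>)))"
      by (intro M.smooth_periodic_mult smooth_periodic_cis M.smooth_periodic_const continuous_intros)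
    have "M.coeff (\<lambda>t u. cis (\<theta> t u) * (1 / (2 * pi * \<i> * \<sigma> * \<omega>))) t 0 = M.coeff (\<lambda>t u. (1 / (2 * pi * \<i> * \<sigma> * \<omega>)) * cis (\<theta> t u)) t 0"
      by (rule M.coeff_cong) simp
    also have "\<dots> = 0"
      using coeff_cis_mult[OF tS, of "\<lambda>t u. 1 / (2 * pi * \<i> * \<sigma> * \<omega>)" 0] M.coeff_const[OF tS, of "\<lambda>t. 1 / (2 * pi * \<i> * \<sigma> * \<omega>)" "0 - ?m"]
        \<sigma>_cases \<omega>_ge_1 by auto
    finally have c0: "M.coeff (\<lambda>t u. cis (\<theta> t u) * (1 / (2 * pi * \<i> * \<sigma> * \<omega>))) t 0 = 0" .
    have "M.coeff (\<lambda>t u. z t u * of_real (1 / L t)) t 0 = M.coeff (\<lambda>t u. of_real (1 / L t) * z t u) t 0"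
      by (rule M.coeff_cong) simp
    also have "\<dots> = of_real (1 / L t) * M.coeff z t 0" by (rule M.coeff_cmult[OF tS])
    finally show ?thesis unfolding h_def[abs_def] M.coeff_diff[OF smooth_periodic_z_L one tS] c0 by simp
  qed
  note rs = wnorm_shift[OF M.coeff_rapid[OF ng tS], where m = ?m]
  show ?thesis
  proof (rule wnorm_leI(2))
    fix F' :: "int set" assume F': "finite F'"
    have pt: "wt n ^ j * norm (M.coeff h t n) \<le> (if n = 0 then norm (M.coeff h t 0) else 0) + lam * (wt n ^ j * norm (M.coeff g t (n - ?m)))" for n
    proof (cases "n = 0")
      case True then show ?thesis using lam by simp
    next
      case False
      then have n1: "\<bar>real_of_int n\<bar> \<ge> 1" by (simp flip: of_int_abs)
      have "1 * norm (M.coeff h t n) \<le> (2 * pi * \<bar>real_of_int n\<bar>) * norm (M.coeff h t n)"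
      proof (rule mult_right_mono)
        have "1 * 1 \<le> (2 * pi) * \<bar>real_of_int n\<bar>" using pi_gt3 n1 by (intro mult_mono) auto
        then show "1 \<le> 2 * pi * \<bar>real_of_int n\<bar>" by simp
      qed simp
      also have "\<dots> = norm (M.coeff (M.D h) t n)" by (simp add: M.coeff_D[OF smooth_periodic_h tS] norm_mult)
      also have "\<dots> \<le> lam * norm (M.coeff g t (n - ?m))" by (rule cD)
      finally have "wt n ^ j * norm (M.coeff h t n) \<le> wt n ^ j * (lam * norm (M.coeff g t (n - ?m)))"
        by (intro mult_left_mono) auto
      then show ?thesis using False by (simp add: mult_ac)
    qed
    have "(\<Sum>n\<in>F'. wt n ^ j * norm (M.coeff h t n)) \<le> (\<Sum>n\<in>F'. (if n = 0 then norm (M.coeff h t 0) else 0) + lam * (wt n ^ j * norm (M.coeff g t (n - ?m))))"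
      by (rule sum_mono) (rule pt)
    also have "\<dots> = (\<Sum>n\<in>F'. (if n = 0 then norm (M.coeff h t 0) else 0)) + lam * (\<Sum>n\<in>F'. wt n ^ j * norm (M.coeff g t (n - ?m)))"
      by (simp only: sum.distrib sum_distrib_left)
    also have "\<dots> \<le> norm (M.coeff h t 0) + lam * (wt ?m ^ j * G j t)"
    proof (intro add_mono mult_left_mono)
      show "(\<Sum>n\<in>F'. (if n = 0 then norm (M.coeff h t 0) else 0)) \<le> norm (M.coeff h t 0)" using F' by simp
      show "(\<Sum>n\<in>F'. wt n ^ j * norm (M.coeff g t (n - ?m))) \<le> wt ?m ^ j * G j t"
        unfolding G_def by (rule order_trans[OF sum_le_wnorm[OF rs(1) F'] rs(2)])
    qed (rule lam)
    also have "norm (M.coeff h t 0) = norm (M.coeff z t 0) / L t" using Lp by (simp add: h0 norm_mult norm_divide)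
    finally show "(\<Sum>n\<in>F'. wt n ^ j * norm (M.coeff h t n)) \<le> norm (M.coeff z t 0) / L t + (2 * pi * \<omega> * R t / L t) * (wt ?m ^ j * G j t)"
      unfolding lam_def .
  qed
qed

lemma wnorm_h_tendsto: "((\<lambda>t. wnorm j (M.coeff h t)) \<longlongrightarrow> 0) at_top"
proof (rule tendsto_sandwich)
  let ?C = "wt (\<sigma> * int \<omega>) ^ j"
  let ?r = "\<lambda>t. L t / (2 * pi * \<omega> * R t)"
  show "\<forall>\<^sub>F t in at_top. 0 \<le> wnorm j (M.coeff h t)" by (simp add: wnorm_nonneg)
  show "\<forall>\<^sub>F t in at_top. wnorm j (M.coeff h t) \<le> norm (M.coeff z t 0 / R t) * (1 / (2 * pi * \<omega>)) * inverse (?r t) + inverse (?r t) * (?C * G j t)"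
    using eventually_ge_at_top[of 0]
  proof eventually_elim
    case (elim t)
    have "R t > 0" "L t > 0" using elim R_pos L_pos by auto
    then have "norm (M.coeff z t 0) / L t = norm (M.coeff z t 0 / R t) * (1 / (2 * pi * \<omega>)) * inverse (?r t)"
      "2 * pi * \<omega> * R t / L t = inverse (?r t)"
      using \<omega>_ge_1 by (auto simp: norm_divide field_simps)
    then show ?case using wnorm_h_le[OF elim, of j] by (simp only:)
  qed
  have "((\<lambda>t. norm (M.coeff z t 0 / R t) * (1 / (2 * pi * \<omega>)) * inverse (?r t) + inverse (?r t) * (?C * G j t)) \<longlongrightarrow>
      0 * (1 / (2 * pi * \<omega>)) * inverse 1 + inverse 1 * (?C * 0)) at_top"
    by (intro tendsto_intros tendsto_norm_zero center_tendsto[OF pos G0] length_ratio_tendsto G_tendsto_0[OF pos G0]) auto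
  then show "((\<lambda>t. norm (M.coeff z t 0 / R t) * (1 / (2 * pi * \<omega>)) * inverse (?r t) + inverse (?r t) * (?C * G j t)) \<longlongrightarrow> 0) at_top" by simp
qed simp

text \<open>In the parameter \<open>x\<close> the rescaled curve is the limit circle plus \<open>h\<close>, and the derivatives of \<open>h\<close>
  are bounded by the norms of its coefficients.\<close>

lemma rescaled_flow_converges:
  "converges_smoothly_up_to_reparam (\<lambda>t u. plane (z t u * of_real (1 / L t)))
     (\<lambda>y. plane (cis (2 * pi * \<sigma> * \<omega> * y) / (2 * pi * \<i> * \<sigma> * \<omega>)))"
  unfolding converges_smoothly_up_to_reparam_def
proof (intro exI conjI allI impI)
  fix t :: real assume "t \<ge> 0"
  then show "circle_diffeo (M.inverse_coordinate t)" by (intro M.circle_diffeo_\<phi>) simp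
next
  define C where "C y = plane (cis (2 * pi * \<sigma> * \<omega> * y) / (2 * pi * \<i> * \<sigma> * \<omega>))" for y :: real
  let ?\<eta> = "\<lambda>t y. plane (z t (M.inverse_coordinate t y) * of_real (1 / L t))"
  let ?H = "\<lambda>t y. h t (M.inverse_coordinate t y)"
  have split: "?\<eta> t = (\<lambda>y. plane (?H t y) + C y)" if t: "t \<ge> 0" for t
  proof
    fix y
    have tS: "t \<in> {0..}" using t by simp
    have "\<theta> t (M.inverse_coordinate t y) = 2 * pi * \<sigma> * \<omega> * y"
      using \<theta>_eq[of t "M.inverse_coordinate t y"] by (simp add: M.x_\<phi>[OF tS] mult_ac)
    then have "z t (M.inverse_coordinate t y) * of_real (1 / L t) = ?H t y + cis (2 * pi * \<sigma> * \<omega> * y) / (2 * pi * \<i> * \<sigma> * \<omega>)"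
      by (simp add: h_def)
    then show "?\<eta> t y = plane (?H t y) + C y" unfolding C_def
      by (simp only: bounded_linear.linear[OF bounded_linear_plane, THEN linear_add])
  qed
  have H_smooth: "smooth (?H t)" if "t \<ge> 0" for t
    by (rule M.smooth_compose) (use that smooth_periodic_h M.smooth_periodic_u_smooth in auto)
  have pH_smooth: "smooth (\<lambda>y. plane (?H t y))" if "t \<ge> 0" for t
    by (rule M.smooth_compose[where f = "\<lambda>t u. plane (h t u)"])
      (use that smooth_periodic_h M.smooth_periodic_u_smooth u_smooth_linear[OF bounded_linear_plane] in auto)
  have C_smooth: "smooth C"
  proof -
    have c: "u_smooth {0..} (\<lambda>t u. plane (cis (\<theta> t u) * (1 / (2 * pi * \<i> * \<sigma> * \<omega>))))"
      by (intro u_smooth_linear[OF bounded_linear_plane] u_smooth_mult cis_\<theta>_smooth u_smooth_const) simp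
    have "smooth (\<lambda>y. plane (cis (\<theta> 0 (M.inverse_coordinate 0 y)) * (1 / (2 * pi * \<i> * \<sigma> * \<omega>))))"
      by (rule M.smooth_compose[OF _ c]) simp
    moreover have "\<theta> 0 (M.inverse_coordinate 0 y) = 2 * pi * \<sigma> * \<omega> * y" for y
      using \<theta>_eq[of 0 "M.inverse_coordinate 0 y"] by (simp add: M.x_\<phi> mult_ac)
    ultimately show ?thesis by (simp add: C_def[abs_def])
  qed
  have "uniform_limit UNIV (\<lambda>t. iterated_vd n (?\<eta> t)) (iterated_vd n C) at_top" for n
    unfolding uniform_limit_iff
  proof (intro allI impI)
    fix e :: real assume e: "e > 0"
    have "((\<lambda>t. (2 * pi) ^ n * wnorm n (M.coeff h t)) \<longlongrightarrow> (2 * pi) ^ n * 0) at_top"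
      by (intro tendsto_intros wnorm_h_tendsto)
    then have "\<forall>\<^sub>F t in at_top. (2 * pi) ^ n * wnorm n (M.coeff h t) < e"
      using e by (intro order_tendstoD(2)) auto
    then show "\<forall>\<^sub>F t in at_top. \<forall>y\<in>UNIV. dist (iterated_vd n (?\<eta> t) y) (iterated_vd n C y) < e"
      using eventually_ge_at_top[of 0]
    proof eventually_elim
      case (elim t)
      have tS: "t \<in> {0..}" using elim by simp
      show ?case
      proof
        fix y
        have "iterated_vd n (?\<eta> t) y = iterated_vd n (\<lambda>y. plane (?H t y)) y + iterated_vd n C y"
          unfolding split[OF elim(2)] iterated_vd_add[OF pH_smooth[OF elim(2)] C_smooth] ..
        also have "iterated_vd n (\<lambda>y. plane (?H t y)) y = plane ((M.D ^^ n) h t (M.inverse_coordinate t y))"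
          unfolding iterated_vd_linear[OF bounded_linear_plane H_smooth[OF elim(2)]]
            M.iterated_vd_compose[OF tS M.smooth_periodic_u_smooth[OF smooth_periodic_h]]
          by (simp only: M.coord_deriv_complex[abs_def])
        finally have "dist (iterated_vd n (?\<eta> t) y) (iterated_vd n C y) = norm ((M.D ^^ n) h t (M.inverse_coordinate t y))"
          by (simp add: dist_norm norm_plane)
        also have "\<dots> \<le> (2 * pi) ^ n * wnorm n (M.coeff h t)" by (rule M.sup_norm_D_power[OF smooth_periodic_h tS])
        finally show "dist (iterated_vd n (?\<eta> t) y) (iterated_vd n C y) < e" using elim(1) by simp
      qed
    qed
  qed
  then show "converges_smoothly (\<lambda>t u. ?\<eta> t u) (\<lambda>y. plane (cis (2 * pi * \<sigma> * \<omega> * y) / (2 * pi * \<i> * \<sigma> * \<omega>)))"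
    unfolding converges_smoothly_def C_def[abs_def] by blast
qed

end
end

lemma converges_up_to_reparam_cong:
  assumes conv: "converges_smoothly_up_to_reparam \<eta> c"
    and eq: "\<And>t u. t \<ge> 0 \<Longrightarrow> \<eta>' t u = \<eta> t u"
  shows "converges_smoothly_up_to_reparam \<eta>' c"
proof -
  obtain \<phi> where \<phi>: "\<And>t. t \<ge> 0 \<Longrightarrow> circle_diffeo (\<phi> t)"
    and lim: "\<And>n. uniform_limit UNIV (\<lambda>t. iterated_vd n (\<lambda>u. \<eta> t (\<phi> t u))) (iterated_vd n c) at_top"
    using conv unfolding converges_smoothly_up_to_reparam_def converges_smoothly_def by blast
  have "uniform_limit UNIV (\<lambda>t. iterated_vd n (\<lambda>u. \<eta>' t (\<phi> t u))) (iterated_vd n c) at_top" for n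
  proof (rule uniform_limit_cong[THEN iffD1, OF _ _ lim[of n]])
    show "\<forall>\<^sub>F t in at_top. \<forall>u\<in>UNIV. iterated_vd n (\<lambda>u. \<eta> t (\<phi> t u)) u = iterated_vd n (\<lambda>u. \<eta>' t (\<phi> t u)) u"
      using eventually_ge_at_top[of 0] by eventually_elim (simp add: eq)
  qed simp
  with \<phi> show ?thesis unfolding converges_smoothly_up_to_reparam_def converges_smoothly_def by blast
qed

theorem theorem1p2:
  fixes \<omega> :: nat
  assumes "\<omega> \<ge> 1"
  shows "\<exists>\<epsilon>::real. \<epsilon> > 0 \<and>
    (\<forall>(\<gamma>0 :: real \<Rightarrow> real^2) (\<gamma> :: real \<Rightarrow> real \<Rightarrow> real^2).
       immersed_curve \<gamma>0 \<longrightarrow>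
       \<bar>turning_number \<gamma>0\<bar> = real \<omega> \<longrightarrow>
       curve_length \<gamma>0 ^ 3 * arc_integral \<gamma>0 (\<lambda>u. (arc_deriv \<gamma>0 (curvature \<gamma>0) u)\<^sup>2) < \<epsilon> \<longrightarrow>
       free_elastic_flow \<gamma>0 \<gamma> \<longrightarrow>
       (\<exists>c. multiple_circle \<omega> (1 / (2 * real \<omega> * pi)) c \<and>
            converges_smoothly_up_to_reparam
              (\<lambda>t u. (1 / curve_length (\<gamma> t)) *\<^sub>R \<gamma> t u) c))"
proof -
  define S2 where "S2 = (\<Sum>\<^sub>\<infinity>n::int. 1 / wt n ^ 2)"
  have S2: "S2 \<ge> 0" unfolding S2_def by (rule infsum_nonneg) simp
  \<comment> \<open>1 keeps the curvature positive, the other bound makes \<open>wnorm 0\<close> of the coefficients small\<close>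
  define \<epsilon> where "\<epsilon> = min 1 ((smallness \<omega> 0)\<^sup>2 / (4 * (S2 + 1)))"
  have sp: "smallness \<omega> 0 > 0" by (rule smallness_pos[OF assms])
  have \<epsilon>: "\<epsilon> > 0" "\<epsilon> \<le> 1" using S2 sp by (auto simp: \<epsilon>_def)
  have S2\<epsilon>: "sqrt (S2 * \<epsilon>) < smallness \<omega> 0"
  proof -
    have "S2 * \<epsilon> \<le> (S2 + 1) * ((smallness \<omega> 0)\<^sup>2 / (4 * (S2 + 1)))"
      using S2 \<epsilon> by (intro mult_mono) (auto simp: \<epsilon>_def)
    also have "\<dots> = (smallness \<omega> 0 / 2)\<^sup>2"
    proof -
      have canc: "a * (d / (4 * a)) = d / 4" if "a \<noteq> 0" for a d :: real using that by simp
      have "S2 + 1 \<noteq> 0" using S2 by simp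
      from canc[OF this] show ?thesis by (simp only: power_divide) simp
    qed
    finally have "sqrt (S2 * \<epsilon>) \<le> sqrt ((smallness \<omega> 0 / 2)\<^sup>2)" by (rule real_sqrt_le_mono)
    also have "\<dots> = smallness \<omega> 0 / 2" using sp by simp
    finally show ?thesis using sp by simp
  qed
  show ?thesis
  proof (intro exI[of _ \<epsilon>] conjI \<epsilon>(1) allI impI)
    fix \<gamma>0 :: "real \<Rightarrow> real^2" and \<gamma> :: "real \<Rightarrow> real \<Rightarrow> real^2"
    assume turn: "\<bar>turning_number \<gamma>0\<bar> = real \<omega>"
      and small: "curve_length \<gamma>0 ^ 3 * arc_integral \<gamma>0 (\<lambda>u. (arc_deriv \<gamma>0 (curvature \<gamma>0) u)\<^sup>2) < \<epsilon>"
      and flow: "free_elastic_flow \<gamma>0 \<gamma>"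
    obtain z \<theta> v m where T: "tangent_angle_flow z \<theta> v m"
      and \<gamma>z: "\<And>t u. t \<ge> 0 \<Longrightarrow> \<gamma> t u = plane (z t u)"
      and sp: "\<And>t u. t \<ge> 0 \<Longrightarrow> speed (\<gamma> t) u = v t u"
      and cu: "\<And>t u. t \<ge> 0 \<Longrightarrow> curvature (\<gamma> t) u = angle_curvature \<theta> v t u"
      by (rule free_elastic_flow_tangent_angle[OF flow], rule that) blast+
    interpret T: tangent_angle_flow z \<theta> v m by (rule T)
    have \<gamma>0: "\<gamma> 0 = \<gamma>0" using flow by (simp add: free_elastic_flow_def)
    have vp: "v 0 u > 0" for u by (rule T.v_pos) simp
    have "turning_number \<gamma>0 = 1 / (2 * pi) * integral {0..1} (partial_u \<theta> 0)"
      using vp sp[of 0] cu[of 0]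
      by (simp add: turning_number_def arc_integral_def \<gamma>0 angle_curvature_def less_imp_neq[symmetric])
    moreover have "(partial_u \<theta> 0 has_integral \<theta> 0 1 - \<theta> 0 0) {0..1}"
      by (rule fundamental_theorem_of_calculus[OF zero_le_one])
        (rule has_vector_derivative_at_within, rule u_smooth_derivative[OF T.\<theta>_smooth], simp)
    moreover have "\<theta> 0 1 - \<theta> 0 0 = 2 * pi * m" using T.\<theta>_period[of 0 0] by simp
    ultimately have "turning_number \<gamma>0 = m" by (simp add: integral_unique)
    then have am: "\<bar>m\<bar> = int \<omega>" using turn by linarith
    define \<sigma> where "\<sigma> = sgn m"
    have \<sigma>: "\<sigma> = 1 \<or> \<sigma> = - 1" "m = \<sigma> * int \<omega>"
      using am assms by (auto simp: \<sigma>_def sgn_if)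
    interpret W: winding_flow z \<theta> v \<sigma> \<omega>
      by (intro winding_flow.intro winding_flow_axioms.intro) (use T \<sigma> assms in auto)
    have L: "curve_length (\<gamma> t) = W.L t" if "t \<ge> 0" for t
      using sp[OF that] by (simp add: curve_length_def arc_integral_def W.L_def)
    have "arc_integral \<gamma>0 (\<lambda>u. (arc_deriv \<gamma>0 (curvature \<gamma>0) u)\<^sup>2) = W.energy0"
    proof -
      have c: "curvature \<gamma>0 = angle_curvature \<theta> v 0" using cu[of 0] \<gamma>0 by auto
      have s: "speed \<gamma>0 u = v 0 u" for u using sp[of 0] \<gamma>0 by simp
      show ?thesis unfolding W.energy0_def arc_integral_def arc_deriv_def c s
        by (rule integral_cong) (use vp in \<open>simp add: partial_u_def power2_eq_square less_imp_neq[symmetric]\<close>)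
    qed
    then have en: "W.L 0 ^ 3 * W.energy0 < \<epsilon>" using small L[of 0] \<gamma>0 by simp
    have init: "\<bar>W.\<kappa> 0 u * W.R 0 - 1\<bar> < 1 / 2" for u
    proof -
      have w: "2 * pi * real \<omega> > 0" using assms by simp
      have "W.\<kappa> 0 u * W.R 0 - 1 = \<sigma> * (W.L 0 * angle_curvature \<theta> v 0 u - 2 * pi * \<sigma> * \<omega>) / (2 * pi * \<omega>)"
        unfolding W.R_0 W.R0_def W.\<kappa>_def using \<sigma>(1) assms by (auto simp: field_simps)
      then have "\<bar>W.\<kappa> 0 u * W.R 0 - 1\<bar> = \<bar>W.L 0 * angle_curvature \<theta> v 0 u - 2 * pi * \<sigma> * \<omega>\<bar> / (2 * pi * \<omega>)"
        using \<sigma>(1) by (auto simp: abs_mult abs_divide abs_minus_commute)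
      also have "\<dots> \<le> 1 / (2 * pi * \<omega>)"
      proof (rule divide_right_mono)
        have "sqrt \<epsilon> \<le> 1" using \<epsilon> by simp
        then show "\<bar>W.L 0 * angle_curvature \<theta> v 0 u - 2 * pi * \<sigma> * \<omega>\<bar> \<le> 1"
          using W.initial_curvature[OF \<epsilon>(1) en, of u] by linarith
      qed (use w in simp)
      also have "\<dots> < 1 / 2"
      proof -
        have "3 * 1 \<le> pi * real \<omega>" using pi_gt3 assms by (intro mult_mono) auto
        then have "2 < 2 * pi * real \<omega>" by simp
        then show ?thesis by (simp add: divide_strict_left_mono)
      qed
      finally show ?thesis .
    qed
    have G0: "W.G 0 0 < smallness \<omega> 0"
      using W.initial_coefficients[OF init en] S2\<epsilon> unfolding S2_def by linarith
    have pos: "W.\<kappa> t u > 0" if t: "t \<ge> 0" for t u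
    proof -
      have "W.\<kappa> t u * W.R t > 0" using W.curvature_close[OF init G0 t, of u] by linarith
      then show ?thesis using W.R_pos[OF t] by (simp add: zero_less_mult_iff)
    qed
    define c where "c = (\<lambda>y. plane (cis (2 * pi * \<sigma> * \<omega> * y) / (2 * pi * \<i> * \<sigma> * \<omega>)))"
    have "converges_smoothly_up_to_reparam (\<lambda>t u. plane (z t u * of_real (1 / W.L t))) c"
      unfolding c_def by (rule W.rescaled_flow_converges[OF pos G0])
    then have "converges_smoothly_up_to_reparam (\<lambda>t u. (1 / curve_length (\<gamma> t)) *\<^sub>R \<gamma> t u) c"
    proof (rule converges_up_to_reparam_cong)
      show "(1 / curve_length (\<gamma> t)) *\<^sub>R \<gamma> t u = plane (z t u * of_real (1 / W.L t))" if "t \<ge> 0" for t u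
        unfolding L[OF that] \<gamma>z[OF that] bounded_linear.linear[OF bounded_linear_plane, THEN linear_scale, symmetric]
        by (simp add: scaleR_conv_of_real mult.commute)
    qed
    then show "\<exists>c. multiple_circle \<omega> (1 / (2 * real \<omega> * pi)) c \<and>
            converges_smoothly_up_to_reparam (\<lambda>t u. (1 / curve_length (\<gamma> t)) *\<^sub>R \<gamma> t u) c"
      using multiple_circle_explicit[OF assms \<sigma>(1)] unfolding c_def by blast
  qed
qed

end
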